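(* (a) For every fixed integer $r\ge 2$ and every $\beta\in\{\operatorname{tw},\operatorname{la},\operatorname{pw},\operatorname{ppw}\}$, \[\lim_{n\to\infty}\frac{\beta^\times(r;n)}{n^r}=1.\] (b) For every fixed integer $r\ge 2$ and every $\beta\in\{\eta,\nu,\mu,\xi\}$, $\beta^\times(r;n)=\Theta(n^r)$ as $n\to\infty$. Specifically, as $n\to\infty$, \[\left\lceil\sqrt{2r+\frac14}-\frac12\right\rceil^{-r}-o(1)\le\frac{\beta^\times(r;n)}{n^r}\le(\sqrt r)^{-r}+o(1).\]
   Context: All graphs are finite, simple and undirected. An $r$-decomposition of the complete graph $K_n=([n],E)$ is a partition of $E$ into edge sets $E_1,\dots,E_r$ (possibly empty) of spanning subgraphs $G_i=([n],E_i)$. For a nonnegative integer valued graph parameter $\beta$, $\beta^\times(r;n):=\max\{\beta(G_1)\cdots\beta(G_r)\}$, the maximum over all $r$-decompositions $G_1,\dots,G_r$ of $K_n$. Tree-width and variants. For a graph with no edges, $\operatorname{tw},\operatorname{la},\operatorname{pw},\operatorname{ppw}$ are all $0$. For $G$ with an edge and positive integers $k$: a $k$-tree is built by starting with $K_{k+1}$ and repeatedly adding a new vertex joined to all vertices of an existing $k$-clique. A facet of a maximal clique (order $k+1$) of a $k$-tree is one of its $k$-clique subgraphs. A linear $k$-tree starts with $K_{k+1}$ and each new vertex is joined to a facet that includes the vertex added in the previous step. A $k$-caterpillar starts with $K_{k+1}$ and each new vertex is joined to the $k$ vertices of some facet of the maximal clique added in the previous step. A two-sided $k$-tree starts with $K_{k+1}$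 and each new vertex is joined to the vertices of an existing $K_k$ that either includes a vertex of degree $k$ or is the same $K_k$ to which some previous vertex was connected. Then the tree-width $\operatorname{tw}(G)$, largeur d'arborescence $\operatorname{la}(G)$, path-width $\operatorname{pw}(G)$, proper path-width $\operatorname{ppw}(G)$ is the minimum $k$ such that $G$ is a subgraph of a $k$-tree, two-sided $k$-tree, $k$-caterpillar, linear $k$-tree, respectively. Hadwiger number: $\eta(G)$ is the maximum order of a clique minor of $G$. Colin de Verdière type parameters. For a graph $G$ on $[n]$, $\mathcal S(G)$ is the set of real symmetric $n\times n$ matrices $A=[a_{ij}]$ such that for $i\ne j$, $a_{ij}\neq 0$ iff $ij$ is an edge of $G$ (diagonal unrestricted). $A$ satisfies the Strong Arnold Property if there is no nonzero real symmetric $X$ with $AX=O$, $A\circ X=O$, $I\circ X=O$ ($\circ$ the entrywise product). $\xi(G)$ is the maximum nullity of $A\in\mathcal S(G)$ satisfying the Strong Arnold Property; $\nu(G)$ is the maximum nullity of positive semidefinite $A\in\mathcal S(G)$ satisfying the Strong Arnold Property; $\mu(G)$ is the maximum nullity of $A\in\mathcal S(G)$ satisfying the Strong Arnold Property, having exactly one negative eigenvalue, and with $a_{ij}\le 0$ for all $i\neq j$. Here $r$ and $\beta$ are fixed, and $o(1)$ denotes a function of $n$ tending to $0$ as $n\to\infty$; $f=\Theta(g)$ means there are positive constants $c,C,N$ with $c|g(n)|\le|f(n)|\le C|g(n)|$ for all $n\ge N$. *)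

theory Defs
  imports
    Complex_Main
    "HOL-Library.Landau_Symbols"
    "HOL-Library.Disjoint_Sets"
    "Jordan_Normal_Form.Matrix_Kernel"
    "Jordan_Normal_Form.Char_Poly"
begin

text \<open>
  A graph is a pair of a vertex set and a set of two-element edges. The vertex set \<open>[n]\<close> is
  represented by \<open>{..<n}\<close>, in agreement with the row and column indices of an \<open>n \<times> n\<close> matrix.
  Parameters of graphs on \<open>[n]\<close> take \<open>n\<close> and the edge set as arguments.
\<close>

type_synonym 'a graph = "'a set \<times> 'a set set"

definition all_edges :: "'a set \<Rightarrow> 'a set set" where
  "all_edges V = {e. e \<subseteq> V \<and> card e = 2}"

definition complete_graph :: "'a set \<Rightarrow> 'a graph" where
  "complete_graph V = (V, all_edges V)"

definition subgraph :: "'a graph \<Rightarrow> 'a graph \<Rightarrow> bool" where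
  "subgraph G H \<longleftrightarrow> fst G \<subseteq> fst H \<and> snd G \<subseteq> snd H"

definition clique_in :: "'a graph \<Rightarrow> 'a set \<Rightarrow> bool" where
  "clique_in G K \<longleftrightarrow> subgraph (complete_graph K) G"

definition vertex_degree :: "'a graph \<Rightarrow> 'a \<Rightarrow> nat" where
  "vertex_degree G v = card {e \<in> snd G. v \<in> e}"

definition join_vertex :: "'a \<Rightarrow> 'a set \<Rightarrow> 'a graph \<Rightarrow> 'a graph" where
  "join_vertex v K G = (insert v (fst G), snd G \<union> {{v, u} |u. u \<in> K})"

definition facet_of :: "nat \<Rightarrow> 'a set \<Rightarrow> 'a set \<Rightarrow> bool" where
  "facet_of k Q F \<longleftrightarrow> F \<subseteq> Q \<and> card F = k"


section \<open>Decompositions of the complete graph\<close>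

definition decomposition :: "nat \<Rightarrow> nat \<Rightarrow> (nat \<Rightarrow> nat set set) \<Rightarrow> bool" where
  "decomposition r n E \<longleftrightarrow>
     disjoint_family_on E {1..r} \<and> (\<Union>i\<in>{1..r}. E i) = all_edges {..<n}"

definition beta_times :: "(nat \<Rightarrow> nat set set \<Rightarrow> nat) \<Rightarrow> nat \<Rightarrow> nat \<Rightarrow> nat" where
  "beta_times \<beta> r n = Max {(\<Prod>i=1..r. \<beta> n (E i)) |E. decomposition r n E}"


section \<open>Tree-width and its variants\<close>

inductive k_tree :: "nat \<Rightarrow> 'a graph \<Rightarrow> bool" for k where
  start: "card V = k + 1 \<Longrightarrow> k_tree k (complete_graph V)"
| step: "k_tree k G \<Longrightarrow> v \<notin> fst G \<Longrightarrow> clique_in G K \<Longrightarrow> card K = k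
    \<Longrightarrow> k_tree k (join_vertex v K G)"

text \<open>
  In the construction of a linear k-tree the last argument is the vertex added in the previous
  step. It is \<open>None\<close> right after the start, where the first new vertex may be joined
  to any facet.
\<close>

inductive linear_k_tree_seq :: "nat \<Rightarrow> 'a graph \<Rightarrow> 'a option \<Rightarrow> bool" for k where
  start: "card V = k + 1 \<Longrightarrow> linear_k_tree_seq k (complete_graph V) None"
| step: "linear_k_tree_seq k G p \<Longrightarrow> v \<notin> fst G
    \<Longrightarrow> clique_in G Q \<Longrightarrow> card Q = k + 1 \<Longrightarrow> facet_of k Q F
    \<Longrightarrow> (case p of None \<Rightarrow> True | Some w \<Rightarrow> w \<in> F)
    \<Longrightarrow> linear_k_tree_seq k (join_vertex v F G) (Some v)"

definition linear_k_tree :: "nat \<Rightarrow> 'a graph \<Rightarrow> bool" where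
  "linear_k_tree k G \<longleftrightarrow> (\<exists>p. linear_k_tree_seq k G p)"

text \<open>
  In the construction of a k-caterpillar the last argument is the maximal clique added in the
  previous step.
\<close>

inductive k_caterpillar_seq :: "nat \<Rightarrow> 'a graph \<Rightarrow> 'a set \<Rightarrow> bool" for k where
  start: "card V = k + 1 \<Longrightarrow> k_caterpillar_seq k (complete_graph V) V"
| step: "k_caterpillar_seq k G Q \<Longrightarrow> v \<notin> fst G \<Longrightarrow> facet_of k Q F
    \<Longrightarrow> k_caterpillar_seq k (join_vertex v F G) (insert v F)"

definition k_caterpillar :: "nat \<Rightarrow> 'a graph \<Rightarrow> bool" where
  "k_caterpillar k G \<longleftrightarrow> (\<exists>Q. k_caterpillar_seq k G Q)"

text \<open>
  In the construction of a two-sided k-tree the last argument collects the k-cliques to which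
  some vertex has been joined in an earlier step.
\<close>

inductive two_sided_k_tree_seq :: "nat \<Rightarrow> 'a graph \<Rightarrow> 'a set set \<Rightarrow> bool" for k where
  start: "card V = k + 1 \<Longrightarrow> two_sided_k_tree_seq k (complete_graph V) {}"
| step: "two_sided_k_tree_seq k G P \<Longrightarrow> v \<notin> fst G
    \<Longrightarrow> clique_in G K \<Longrightarrow> card K = k
    \<Longrightarrow> (\<exists>w\<in>K. vertex_degree G w = k) \<or> K \<in> P
    \<Longrightarrow> two_sided_k_tree_seq k (join_vertex v K G) (insert K P)"

definition two_sided_k_tree :: "nat \<Rightarrow> 'a graph \<Rightarrow> bool" where
  "two_sided_k_tree k G \<longleftrightarrow> (\<exists>P. two_sided_k_tree_seq k G P)"

text \<open>
  The host graph may have further vertices; since all of \<open>nat\<close> is available for them,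
  containment up to isomorphism is the same as containment on the nose.
\<close>

definition min_host :: "(nat \<Rightarrow> nat graph \<Rightarrow> bool) \<Rightarrow> nat \<Rightarrow> nat set set \<Rightarrow> nat" where
  "min_host host n E =
     (if E = {} then 0 else LEAST k. 0 < k \<and> (\<exists>H. host k H \<and> subgraph ({..<n}, E) H))"

definition tw :: "nat \<Rightarrow> nat set set \<Rightarrow> nat" where
  "tw = min_host k_tree"

definition la :: "nat \<Rightarrow> nat set set \<Rightarrow> nat" where
  "la = min_host two_sided_k_tree"

definition pw :: "nat \<Rightarrow> nat set set \<Rightarrow> nat" where
  "pw = min_host k_caterpillar"

definition ppw :: "nat \<Rightarrow> nat set set \<Rightarrow> nat" where
  "ppw = min_host linear_k_tree"


section \<open>Hadwiger number\<close>

definition connected_on :: "'a set set \<Rightarrow> 'a set \<Rightarrow> bool" where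
  "connected_on E B \<longleftrightarrow> B \<noteq> {} \<and>
     (\<forall>u\<in>B. \<forall>v\<in>B. (u, v) \<in> {(x, y). x \<in> B \<and> y \<in> B \<and> {x, y} \<in> E}\<^sup>*)"

text \<open>
  \<open>H\<close> is a minor of \<open>G\<close>: contracting each branch set \<open>B w\<close> to one vertex, and then deleting
  vertices and edges, turns \<open>G\<close> into \<open>H\<close>.
\<close>

definition minor_of :: "'b graph \<Rightarrow> 'a graph \<Rightarrow> bool" where
  "minor_of H G \<longleftrightarrow> (\<exists>B.
     (\<forall>w\<in>fst H. B w \<subseteq> fst G \<and> connected_on (snd G) (B w)) \<and>
     disjoint_family_on B (fst H) \<and>
     (\<forall>x\<in>fst H. \<forall>y\<in>fst H. {x, y} \<in> snd H \<longrightarrow> (\<exists>u\<in>B x. \<exists>v\<in>B y. {u, v} \<in> snd G)))"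

definition hadwiger :: "nat \<Rightarrow> nat set set \<Rightarrow> nat" where
  "hadwiger n E = Max {m. minor_of (complete_graph {..<m}) ({..<n}, E)}"


section \<open>Colin de Verdiere type parameters\<close>

definition sym_matrices :: "nat \<Rightarrow> nat set set \<Rightarrow> real mat set" where
  "sym_matrices n E = {A \<in> carrier_mat n n. transpose_mat A = A \<and>
     (\<forall>i<n. \<forall>j<n. i \<noteq> j \<longrightarrow> (A $$ (i, j) \<noteq> 0 \<longleftrightarrow> {i, j} \<in> E))}"

definition hadamard_prod :: "real mat \<Rightarrow> real mat \<Rightarrow> real mat" where
  "hadamard_prod A B = mat (dim_row A) (dim_col A) (\<lambda>ij. A $$ ij * B $$ ij)"

definition strong_arnold :: "nat \<Rightarrow> real mat \<Rightarrow> bool" where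
  "strong_arnold n A \<longleftrightarrow> \<not> (\<exists>X \<in> carrier_mat n n. X \<noteq> 0\<^sub>m n n \<and> transpose_mat X = X \<and>
     A * X = 0\<^sub>m n n \<and> hadamard_prod A X = 0\<^sub>m n n \<and> hadamard_prod (1\<^sub>m n) X = 0\<^sub>m n n)"

definition pos_semidef :: "nat \<Rightarrow> real mat \<Rightarrow> bool" where
  "pos_semidef n A \<longleftrightarrow> (\<forall>v \<in> carrier_vec n. 0 \<le> v \<bullet> (A *\<^sub>v v))"

text \<open>Negative eigenvalues are counted with multiplicity.\<close>

definition num_neg_eigenvalues :: "real mat \<Rightarrow> nat" where
  "num_neg_eigenvalues A = (\<Sum>x | x < 0 \<and> eigenvalue A x. order x (char_poly A))"

definition xi :: "nat \<Rightarrow> nat set set \<Rightarrow> nat" where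
  "xi n E = Max {kernel_dim A |A. A \<in> sym_matrices n E \<and> strong_arnold n A}"

definition nu :: "nat \<Rightarrow> nat set set \<Rightarrow> nat" where
  "nu n E = Max {kernel_dim A |A. A \<in> sym_matrices n E \<and> strong_arnold n A \<and> pos_semidef n A}"

text \<open>For \<open>n = 0\<close> no matrix has a negative eigenvalue and \<open>mu\<close> is unspecified.\<close>

definition mu :: "nat \<Rightarrow> nat set set \<Rightarrow> nat" where
  "mu n E = Max {kernel_dim A |A. A \<in> sym_matrices n E \<and> strong_arnold n A \<and>
     num_neg_eigenvalues A = 1 \<and> (\<forall>i<n. \<forall>j<n. i \<noteq> j \<longrightarrow> A $$ (i, j) \<le> 0)}"

end

theory Submission
  imports
    Defs
    "Jordan_Normal_Form.Spectral_Radius"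
    "HOL-Analysis.Convex"
    "HOL-Real_Asymp.Real_Asymp"
begin

text \<open>
  Both parts compare an upper bound that holds for every decomposition with a suitable decomposition.

  \<^bold>\<open>Tree-width and its variants.\<close> Each parameter is at most \<open>n\<close>, which bounds the product by
  \<open>n ^ r\<close>. Linear \<open>k\<close>-trees, \<open>k\<close>-caterpillars and two-sided \<open>k\<close>-trees are \<open>k\<close>-trees, so for the
  lower bound it is enough to make the tree-width of every colour class at least \<open>n - o(n)\<close>. A graph
  in which any two disjoint sets of \<open>m\<close> vertices are joined by an edge has tree-width at least
  \<open>n - 4 * m\<close> (\<open>k_tree_host_large\<close>), since a connected set of vertices that come late in the
  construction of a \<open>k\<close>-tree has at most \<open>k\<close> earlier neighbours. Colouring the edges at random
  with \<open>r\<close> colours yields this property for all classes with \<open>m\<close> of order \<open>sqrt n\<close>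
  (\<open>decomposition_without_holes\<close>).

  \<^bold>\<open>Upper bound for the Hadwiger number and the Colin de Verdiere type parameters.\<close> Each of
  these parameters satisfies \<open>(\<beta> n E)\<^sup>2 \<le> 2 * card E + 2 * n\<close>. A clique minor of order \<open>h\<close> needs
  \<open>h choose 2\<close> edges. For a matrix of nullity \<open>k\<close> with the Strong Arnold Property, the space of
  symmetric matrices built from kernel vectors has dimension \<open>k * (k + 1) / 2\<close>, and only the zero
  matrix in it vanishes on all edges and on the diagonal, so \<open>k * (k + 1) / 2 \<le> card E + n\<close>
  (\<open>strong_arnold_nullity_bound\<close>). The edge numbers of a decomposition add up to \<open>n choose 2\<close>, and the
  inequality between the arithmetic and the geometric mean gives the factor \<open>(1 / sqrt r) ^ r\<close>.

  \<^bold>\<open>Lower bound.\<close> Cut the vertices into \<open>s\<close> blocks of about \<open>n / s\<close> vertices, where \<open>s\<close> is the least number with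
  \<open>s * (s + 1) / 2 \<ge> r\<close>. Each colour class is then either a complete bipartite graph between two
  blocks or a disjoint union of complete graphs on blocks (\<open>clique_bipartite_decomposition\<close>). Both kinds
  of graphs have a clique minor of the size of a block. For \<open>nu\<close>, \<open>mu\<close> and \<open>xi\<close> there are explicit
  matrices on one clique or one complete bipartite graph whose nullity is one less than the size of
  the smaller block, and they are extended to the remaining vertices by an invertible block
  (\<open>core_matrix\<close>). The number of negative eigenvalues of these matrices is read off from their quadratic
  forms, by means of the spectral theorem for real symmetric matrices (\<open>one_negative_eigenvalue\<close>).
\<close>

no_notation inner (infix "\<bullet>" 70)  (* reserved for the scalar product of vec *)

section \<open>Tree-width of graphs without bipartite holes\<close>

definition no_bipartite_hole :: "nat \<Rightarrow> 'a set \<Rightarrow> 'a set set \<Rightarrow> bool" where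
  "no_bipartite_hole m V E \<longleftrightarrow>
     (\<forall>A B. A \<subseteq> V \<longrightarrow> B \<subseteq> V \<longrightarrow> A \<inter> B = {} \<longrightarrow> m \<le> card A \<longrightarrow> m \<le> card B \<longrightarrow>
        (\<exists>a\<in>A. \<exists>b\<in>B. {a, b} \<in> E))"

text \<open>
  Connectedness is expressed by cuts instead of paths: the only operation on connected sets below is
  the deletion of a vertex whose neighbours form a clique, and a cut of the smaller set extends to
  the larger one by putting the vertex on the right side.
\<close>

definition cut_connected :: "'a set set \<Rightarrow> 'a set \<Rightarrow> bool" where
  "cut_connected E C \<longleftrightarrow> C \<noteq> {} \<and>
     (\<forall>D. D \<subseteq> C \<longrightarrow> D \<noteq> {} \<longrightarrow> D \<noteq> C \<longrightarrow> (\<exists>x\<in>D. \<exists>y\<in>C - D. {x, y} \<in> E))"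

lemma cut_connected_cong:
  assumes "\<And>x y. x \<in> C \<Longrightarrow> y \<in> C \<Longrightarrow> {x, y} \<in> E \<longleftrightarrow> {x, y} \<in> E'"
  shows "cut_connected E C \<longleftrightarrow> cut_connected E' C"
proof -
  have "(\<exists>x\<in>D. \<exists>y\<in>C - D. {x, y} \<in> E) \<longleftrightarrow> (\<exists>x\<in>D. \<exists>y\<in>C - D. {x, y} \<in> E')" if "D \<subseteq> C" for D
    using that assms by (intro bex_cong) auto
  then show ?thesis unfolding cut_connected_def by simp
qed

lemma k_tree_wf:
  assumes "k_tree k H"
  shows "finite (fst H) \<and> (\<forall>e\<in>snd H. e \<subseteq> fst H)"
  using assms
proof induction
  case (start V)
  then have "finite V" by (intro card_ge_0_finite) simp
  then show ?case by (auto simp: complete_graph_def all_edges_def)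
next
  case (step G v K)
  then show ?case
    by (fastforce simp: join_vertex_def clique_in_def subgraph_def complete_graph_def)
qed

text \<open>
  The vertices of \<open>W\<close> that the construction of the \<open>k\<close>-tree adds last form \<open>X\<close>. If \<open>C\<close> is a
  connected part of \<open>X\<close> and \<open>c\<close> is the vertex of \<open>C\<close> that was added first, then every earlier
  neighbour of \<open>C\<close> belongs to the \<open>k\<close>-clique that \<open>c\<close> was joined to. The induction proves this one
  new vertex \<open>v\<close> at a time. Its neighbours form a clique \<open>K\<close>, so removing \<open>v\<close> from a connected set
  \<open>C \<noteq> {v}\<close> leaves a connected set, and a neighbour of \<open>v\<close> outside \<open>X\<close> is also a neighbour of any
  vertex in the nonempty set \<open>K \<inter> C\<close>.
\<close>

lemma k_tree_elimination:
  assumes "k_tree k H" and "W \<subseteq> fst H" and "q + k + 1 \<le> card W"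
  shows "\<exists>X\<subseteq>W. card X = q \<and>
    (\<forall>C\<subseteq>X. cut_connected (snd H) C \<longrightarrow> card {w \<in> W - X. \<exists>c\<in>C. {c, w} \<in> snd H} \<le> k)"
  using assms
proof (induction arbitrary: W q)
  case (start V)
  then have "finite V" by (intro card_ge_0_finite) simp
  then have "card W \<le> k + 1"
    using start card_mono[of V W] by (simp add: complete_graph_def)
  then have "q = 0" using start by simp
  then show ?case by (intro exI[of _ "{}"]) (auto simp: cut_connected_def)
next
  case (step G v K)
  define H where "H = join_vertex v K G"
  have fin: "finite (fst G)" and wf: "\<And>e. e \<in> snd G \<Longrightarrow> e \<subseteq> fst G"
    using k_tree_wf[OF step.hyps(1)] by auto
  have KG: "K \<subseteq> fst G" and clique: "\<And>x y. x \<in> K \<Longrightarrow> y \<in> K \<Longrightarrow> x \<noteq> y \<Longrightarrow> {x, y} \<in> snd G"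
    using step.hyps(3)
    by (auto simp: clique_in_def subgraph_def complete_graph_def all_edges_def)
  have finK: "finite K" using KG fin finite_subset by blast
  have fH: "fst H = insert v (fst G)" by (simp add: H_def join_vertex_def)
  have oldE: "{x, y} \<in> snd H \<longleftrightarrow> {x, y} \<in> snd G" if "x \<noteq> v" "y \<noteq> v" for x y
    using that by (auto simp: H_def join_vertex_def doubleton_eq_iff)
  have newE: "{v, y} \<in> snd H \<longleftrightarrow> y \<in> K" for y
    using wf[of "{v, y}"] step.hyps(2) KG
    by (auto simp: H_def join_vertex_def doubleton_eq_iff)
  have finW: "finite W" using step.prems(1) fin fH H_def finite_subset by (metis finite_insert)
  show ?case unfolding H_def[symmetric]
  proof (cases "v \<in> W \<and> q \<noteq> 0")
    case False
    show "\<exists>X\<subseteq>W. card X = q \<and>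
      (\<forall>C\<subseteq>X. cut_connected (snd H) C \<longrightarrow> card {w \<in> W - X. \<exists>c\<in>C. {c, w} \<in> snd H} \<le> k)"
    proof (cases "q = 0")
      case True
      then show ?thesis by (intro exI[of _ "{}"]) (auto simp: cut_connected_def)
    next
      case q: False
      then have vW: "v \<notin> W" using False by simp
      then have WG: "W \<subseteq> fst G" using step.prems(1) by (auto simp: join_vertex_def)
      obtain X where X: "X \<subseteq> W" "card X = q"
        "\<And>C. C \<subseteq> X \<Longrightarrow> cut_connected (snd G) C \<Longrightarrow> card {w \<in> W - X. \<exists>c\<in>C. {c, w} \<in> snd G} \<le> k"
        using step.IH[OF WG step.prems(2)] by blast
      have "card {w \<in> W - X. \<exists>c\<in>C. {c, w} \<in> snd H} \<le> k"
        if C: "C \<subseteq> X" "cut_connected (snd H) C" for C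
      proof -
        have Cv: "\<And>x. x \<in> C \<Longrightarrow> x \<noteq> v" using C X(1) vW by auto
        then have "cut_connected (snd G) C"
          using C(2) oldE cut_connected_cong[of C "snd G" "snd H"] Cv by simp
        moreover have "(\<exists>c\<in>C. {c, w} \<in> snd H) \<longleftrightarrow> (\<exists>c\<in>C. {c, w} \<in> snd G)" if "w \<in> W" for w
          using that Cv vW oldE by metis
        then have "{w \<in> W - X. \<exists>c\<in>C. {c, w} \<in> snd H} = {w \<in> W - X. \<exists>c\<in>C. {c, w} \<in> snd G}"
          by auto
        ultimately show ?thesis using X(3) C(1) by simp
      qed
      then show ?thesis using X by blast
    qed
  next
    case True
    define W' where "W' = W - {v}"
    have W'G: "W' \<subseteq> fst G" using step.prems(1) by (auto simp: W'_def join_vertex_def)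
    have cW': "(q - 1) + k + 1 \<le> card W'"
      using True step.prems(2) finW by (simp add: W'_def)
    obtain X where X: "X \<subseteq> W'" "card X = q - 1"
      "\<And>C. C \<subseteq> X \<Longrightarrow> cut_connected (snd G) C \<Longrightarrow> card {w \<in> W' - X. \<exists>c\<in>C. {c, w} \<in> snd G} \<le> k"
      using step.IH[OF W'G cW'] by blast
    have vX: "v \<notin> X" using X(1) by (auto simp: W'_def)
    have finX: "finite X" using X(1) finW W'_def finite_subset by blast
    have diff: "W - insert v X = W' - X" by (auto simp: W'_def)
    have nv: "w \<noteq> v" if "w \<in> W' - X" for w using that by (auto simp: W'_def)
    have "card {w \<in> W' - X. \<exists>c\<in>C. {c, w} \<in> snd H} \<le> k"
      if C: "C \<subseteq> insert v X" "cut_connected (snd H) C" for C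
    proof -
      have cut: "\<And>D. D \<subseteq> C \<Longrightarrow> D \<noteq> {} \<Longrightarrow> D \<noteq> C \<Longrightarrow> \<exists>x\<in>D. \<exists>y\<in>C - D. {x, y} \<in> snd H"
        using C(2) unfolding cut_connected_def by blast
      consider "v \<notin> C" | "C = {v}" | "v \<in> C" "C - {v} \<noteq> {}" by blast
      then show ?thesis
      proof cases
        case 1
        then have CX: "C \<subseteq> X" using C(1) by blast
        have Cv: "x \<noteq> v" if "x \<in> C" for x using that 1 by auto
        have "cut_connected (snd G) C"
          using C(2) oldE Cv cut_connected_cong[of C "snd G" "snd H"] by simp
        moreover have "(\<exists>c\<in>C. {c, w} \<in> snd H) \<longleftrightarrow> (\<exists>c\<in>C. {c, w} \<in> snd G)" if "w \<in> W' - X" for w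
          using nv[OF that] Cv oldE by metis
        then have "{w \<in> W' - X. \<exists>c\<in>C. {c, w} \<in> snd H} = {w \<in> W' - X. \<exists>c\<in>C. {c, w} \<in> snd G}"
          by auto
        ultimately show ?thesis using X(3)[OF CX] by simp
      next
        case 2
        then have "{w \<in> W' - X. \<exists>c\<in>C. {c, w} \<in> snd H} \<subseteq> K" using newE by auto
        then show ?thesis using card_mono[OF finK] step.hyps(4) by fastforce
      next
        case 3
        define C' where "C' = C - {v}"
        have C'X: "C' \<subseteq> X" using C(1) by (auto simp: C'_def)
        have C'v: "x \<noteq> v" if "x \<in> C'" for x using that by (simp add: C'_def)
        have "\<exists>x\<in>D. \<exists>y\<in>C' - D. {x, y} \<in> snd G"
          if D: "D \<subseteq> C'" "D \<noteq> {}" "D \<noteq> C'" for D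
        proof (rule ccontr)
          assume no: "\<not> ?thesis"
          then have no': "\<And>x y. x \<in> D \<Longrightarrow> y \<in> C' - D \<Longrightarrow> {x, y} \<notin> snd H"
            using oldE C'v D(1) by (metis DiffD1 subsetD)
          obtain x y where xy: "x \<in> D" "y \<in> C - D" "{x, y} \<in> snd H"
            using cut[of D] D 3(1) by (auto simp: C'_def)
          then have "y = v" using no' by (auto simp: C'_def)
          then have "x \<in> K" using xy(3) newE by (simp add: insert_commute)
          obtain x' y' where x'y': "x' \<in> C' - D" "y' \<in> C - (C' - D)" "{x', y'} \<in> snd H"
            using cut[of "C' - D"] D 3(1) by (auto simp: C'_def)
          then have "y' = v \<or> y' \<in> D" by (auto simp: C'_def)
          then have "y' = v" using no' x'y' by (metis insert_commute)
          then have "x' \<in> K" using x'y'(3) newE by (simp add: insert_commute)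
          then show False using \<open>x \<in> K\<close> clique xy(1) x'y'(1) no by blast
        qed
        then have conn: "cut_connected (snd G) C'"
          using 3 unfolding cut_connected_def C'_def by blast
        obtain y where y: "y \<in> C'" "{v, y} \<in> snd H"
          using cut[of "{v}"] 3 by (auto simp: C'_def)
        have "{w \<in> W' - X. \<exists>c\<in>C. {c, w} \<in> snd H} \<subseteq> {w \<in> W' - X. \<exists>c\<in>C'. {c, w} \<in> snd G}"
        proof safe
          fix w c assume w: "w \<in> W'" "w \<notin> X" and c: "c \<in> C" "{c, w} \<in> snd H"
          show "\<exists>c\<in>C'. {c, w} \<in> snd G"
          proof (cases "c = v")
            case True
            then have "w \<in> K" "y \<in> K" using c y newE by auto
            moreover have "y \<noteq> w" using y(1) C'X w by blast
            ultimately show ?thesis using clique y(1) by blast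
          next
            case False
            then show ?thesis using c oldE nv w by (auto simp: C'_def)
          qed
        qed
        moreover have "finite {w \<in> W' - X. \<exists>c\<in>C'. {c, w} \<in> snd G}"
          using finW by (simp add: W'_def)
        ultimately show ?thesis
          using X(3)[OF C'X conn] card_mono le_trans by meson
      qed
    qed
    moreover have "insert v X \<subseteq> W" using X(1) True by (auto simp: W'_def)
    moreover have "card (insert v X) = q" using vX finX X(2) True by simp
    ultimately show "\<exists>X\<subseteq>W. card X = q \<and>
      (\<forall>C\<subseteq>X. cut_connected (snd H) C \<longrightarrow> card {w \<in> W - X. \<exists>c\<in>C. {c, w} \<in> snd H} \<le> k)"
      using diff by (intro exI[of _ "insert v X"]) simp
  qed
qed

lemma no_bipartite_hole_mono:
  "no_bipartite_hole m V E \<Longrightarrow> U \<subseteq> V \<Longrightarrow> no_bipartite_hole m U E"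
  unfolding no_bipartite_hole_def by (meson subset_trans)

text \<open>
  Among the unions of components of size at least \<open>m\<close> take a smallest one, \<open>A\<close>. Less than \<open>m\<close>
  vertices lie outside \<open>A\<close>, since no edge leaves \<open>A\<close>; hence \<open>A\<close> has more than \<open>2 * m\<close> vertices. If
  \<open>A\<close> split into two unions of components, both would have less than \<open>m\<close> vertices by minimality.
\<close>

lemma large_connected_subset:
  assumes hole: "no_bipartite_hole m X E" and fin: "finite X" and "0 < m" and big: "3 * m \<le> card X"
  shows "\<exists>C\<subseteq>X. cut_connected E C \<and> m \<le> card C"
proof -
  define closed where "closed A \<longleftrightarrow> A \<subseteq> X \<and> (\<forall>x\<in>A. \<forall>y\<in>X - A. {x, y} \<notin> E)" for A
  have "closed X \<and> m \<le> card X" using big by (simp add: closed_def)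
  then obtain A where A: "closed A" "m \<le> card A"
    and min: "\<And>D. closed D \<Longrightarrow> m \<le> card D \<Longrightarrow> card A \<le> card D"
    using ex_has_least_nat[of "\<lambda>A. closed A \<and> m \<le> card A" X card] by blast
  have AX: "A \<subseteq> X" and finA: "finite A" using A fin finite_subset by (auto simp: closed_def)
  have "card (X - A) < m"
  proof (rule ccontr)
    assume "\<not> ?thesis"
    then have "\<exists>a\<in>A. \<exists>b\<in>X - A. {a, b} \<in> E"
      using hole AX A(2) unfolding no_bipartite_hole_def
      by (metis Diff_disjoint Diff_subset not_le)
    then show False using A(1) by (auto simp: closed_def)
  qed
  then have bigA: "2 * m < card A"
    using big AX fin by (simp add: card_Diff_subset finA)
  have "\<exists>x\<in>D. \<exists>y\<in>A - D. {x, y} \<in> E" if D: "D \<subseteq> A" "D \<noteq> {}" "D \<noteq> A" for D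
  proof (rule ccontr)
    assume no: "\<not> ?thesis"
    have finD: "finite D" using D finA finite_subset by blast
    have "closed D" using no D(1) A(1) unfolding closed_def by blast
    moreover have "closed (A - D)"
      unfolding closed_def
    proof (intro conjI ballI)
      fix x y assume x: "x \<in> A - D" and y: "y \<in> X - (A - D)"
      show "{x, y} \<notin> E"
      proof (cases "y \<in> D")
        case True
        then show ?thesis using no x by (metis insert_commute)
      next
        case False
        then show ?thesis using A(1) x y by (auto simp: closed_def)
      qed
    qed (use AX in auto)
    moreover have "D \<subset> A" "A - D \<subset> A" using D by auto
    then have "card D < card A" "card (A - D) < card A"
      using finA psubset_card_mono by blast+
    ultimately have "card D < m" "card (A - D) < m" using min by (meson not_le)+
    then show False using bigA D(1) finD by (simp add: card_Diff_subset)
  qed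
  moreover have "A \<noteq> {}" using bigA by auto
  ultimately show ?thesis using A(2) AX unfolding cut_connected_def by blast
qed

text \<open>
  If \<open>k < n - 4 * m\<close>, then \<open>3 * m\<close> late vertices contain a connected set \<open>C\<close> of size at least \<open>m\<close>. It has at
  most \<open>k\<close> neighbours among the more than \<open>k + m\<close> early vertices, so more than \<open>m\<close> early vertices
  form a bipartite hole together with \<open>C\<close>.
\<close>

theorem k_tree_host_large:
  assumes hole: "no_bipartite_hole m {..<n} E" and m: "0 < m"
    and H: "k_tree k H" and sub: "subgraph ({..<n}, E) H"
  shows "n \<le> k + 4 * m"
proof (rule ccontr)
  assume "\<not> ?thesis"
  then have n: "3 * m + k + 1 \<le> card {..<n}" "k + 4 * m < n" using m by auto
  have sub': "{..<n} \<subseteq> fst H" "E \<subseteq> snd H" using sub by (auto simp: subgraph_def)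
  obtain X where X: "X \<subseteq> {..<n}" "card X = 3 * m"
    "\<And>C. C \<subseteq> X \<Longrightarrow> cut_connected (snd H) C \<Longrightarrow> card {w \<in> {..<n} - X. \<exists>c\<in>C. {c, w} \<in> snd H} \<le> k"
    using k_tree_elimination[OF H sub'(1) n(1)] by blast
  have finX: "finite X" using X(1) finite_subset by blast
  obtain C where C: "C \<subseteq> X" "cut_connected E C" "m \<le> card C"
    using large_connected_subset[OF no_bipartite_hole_mono[OF hole X(1)] finX m] X(2) by auto
  have "cut_connected (snd H) C"
    using C(2) sub'(2) unfolding cut_connected_def by (meson subsetD)
  define N where "N = {w \<in> {..<n} - X. \<exists>c\<in>C. {c, w} \<in> snd H}"
  have N: "card N \<le> k" "N \<subseteq> {..<n} - X" "finite N"
    using X(3)[OF C(1) \<open>cut_connected (snd H) C\<close>] by (auto simp: N_def)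
  have "card ({..<n} - X - N) = n - 3 * m - card N"
    using N X finX by (simp add: card_Diff_subset)
  then have "m \<le> card ({..<n} - X - N)" using N(1) n(2) by linarith
  moreover have "C \<subseteq> {..<n}" "C \<inter> ({..<n} - X - N) = {}" using C(1) X(1) by auto
  moreover have "{..<n} - X - N \<subseteq> {..<n}" by auto
  ultimately have "\<exists>a\<in>C. \<exists>b\<in>{..<n} - X - N. {a, b} \<in> E"
    using hole C(3) unfolding no_bipartite_hole_def by meson
  then obtain a b where "a \<in> C" "b \<in> {..<n} - X - N" "{a, b} \<in> E" by blast
  then show False using sub'(2) by (auto simp: N_def)
qed

text \<open>
  As soon as there is an edge, \<open>K\<^sub>n\<close> is an admissible host with \<open>k = n - 1 > 0\<close>, so the minimum in
  \<open>min_host\<close> is attained.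
\<close>

lemma min_host_host:
  assumes complete: "\<And>V k. card V = k + 1 \<Longrightarrow> host k (complete_graph V)"
    and E: "E \<subseteq> all_edges {..<n}" "E \<noteq> {}"
  shows "\<exists>H. host (min_host host n E) H \<and> subgraph ({..<n}, E) H" and "min_host host n E \<le> n"
proof -
  obtain e where "e \<subseteq> {..<n}" "card e = 2" using E by (auto simp: all_edges_def)
  then have "2 \<le> n" using card_mono[of "{..<n}" e] by simp
  then have "0 < n - 1 \<and> (\<exists>H. host (n - 1) H \<and> subgraph ({..<n}, E) H)"
    using complete[of "{..<n}" "n - 1"] E(1)
    by (intro conjI exI[of _ "complete_graph {..<n}"]) (auto simp: subgraph_def complete_graph_def)
  from LeastI[of "\<lambda>k. 0 < k \<and> (\<exists>H. host k H \<and> subgraph ({..<n}, E) H)", OF this]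
    Least_le[of "\<lambda>k. 0 < k \<and> (\<exists>H. host k H \<and> subgraph ({..<n}, E) H)", OF this]
  show "\<exists>H. host (min_host host n E) H \<and> subgraph ({..<n}, E) H" "min_host host n E \<le> n"
    using E(2) by (auto simp: min_host_def)
qed

lemma min_host_le:
  assumes "\<And>V k. card V = k + 1 \<Longrightarrow> host k (complete_graph V)" and "E \<subseteq> all_edges {..<n}"
  shows "min_host host n E \<le> n"
  using min_host_host(2)[of host E n] assms by (cases "E = {}") (auto simp: min_host_def)

lemma min_host_ge:
  assumes complete: "\<And>V k. card V = k + 1 \<Longrightarrow> host k (complete_graph V)"
    and k_tree: "\<And>k H. host k H \<Longrightarrow> k_tree k H"
    and E: "E \<subseteq> all_edges {..<n}"
    and hole: "no_bipartite_hole m {..<n} E" and m: "0 < m"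
  shows "n \<le> min_host host n E + 4 * m"
proof (cases "2 * m \<le> n")
  case True
  have "{..<m} \<subseteq> {..<n}" "{m..<2 * m} \<subseteq> {..<n}" "{..<m} \<inter> {m..<2 * m} = {}"
    using True by auto
  moreover have "m \<le> card {..<m}" "m \<le> card {m..<2 * m}" by auto
  ultimately have "\<exists>a\<in>{..<m}. \<exists>b\<in>{m..<2 * m}. {a, b} \<in> E"
    using hole unfolding no_bipartite_hole_def by meson
  then have "E \<noteq> {}" by blast
  from min_host_host(1)[of host, OF complete E this] show ?thesis
    using k_tree_host_large[OF hole m] k_tree by blast
qed simp

lemma clique_in_mono: "clique_in G Q \<Longrightarrow> F \<subseteq> Q \<Longrightarrow> clique_in G F"
  unfolding clique_in_def subgraph_def complete_graph_def all_edges_def by fastforce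

lemma linear_k_tree_is_k_tree:
  assumes "linear_k_tree k H" shows "k_tree k H"
proof -
  have "k_tree k H" if "linear_k_tree_seq k H p" for p
    using that by induction
      (auto intro!: k_tree.intros intro: clique_in_mono simp: facet_of_def)
  then show ?thesis using assms by (auto simp: linear_k_tree_def)
qed

lemma two_sided_k_tree_is_k_tree:
  assumes "two_sided_k_tree k H" shows "k_tree k H"
proof -
  have "k_tree k H" if "two_sided_k_tree_seq k H P" for P
    using that by induction (auto intro!: k_tree.intros)
  then show ?thesis using assms by (auto simp: two_sided_k_tree_def)
qed

text \<open>
  The clique that the last argument of the construction records is really a clique of the current
  graph; this has to be carried through the induction, because the construction rule itself only
  says that the new vertex is joined to a \<open>k\<close>-subset of it.
\<close>

lemma k_caterpillar_is_k_tree: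
  assumes "k_caterpillar k H" shows "k_tree k H"
proof -
  have "k_tree k H \<and> clique_in H Q" if "k_caterpillar_seq k H Q" for Q
    using that
  proof induction
    case (start V)
    then show ?case
      using k_tree.start[OF start] by (auto simp: clique_in_def subgraph_def)
  next
    case (step G Q v F)
    then have F: "clique_in G F" "card F = k" using clique_in_mono[of G Q F] by (simp_all add: facet_of_def)
    have "clique_in (join_vertex v F G) (insert v F)"
      unfolding clique_in_def subgraph_def complete_graph_def join_vertex_def all_edges_def
    proof (simp, intro conjI subsetI)
      show "x \<in> insert v (fst G)" if "x \<in> F" for x
        using that F by (auto simp: clique_in_def subgraph_def complete_graph_def)
      fix e assume "e \<in> {e. e \<subseteq> insert v F \<and> card e = 2}"
      then obtain x y where e: "e = {x, y}" "x \<noteq> y" "x \<in> insert v F" "y \<in> insert v F"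
        by (auto simp: card_2_iff)
      show "e \<in> snd G \<union> {{v, u} |u. u \<in> F}"
      proof (cases "x = v \<or> y = v")
        case True
        then show ?thesis using e by (auto simp: insert_commute)
      next
        case False
        then show ?thesis using e F
          by (auto simp: clique_in_def subgraph_def complete_graph_def all_edges_def)
      qed
    qed
    then show ?case using step F by (auto intro!: k_tree.intros)
  qed
  then show ?thesis using assms by (auto simp: k_caterpillar_def)
qed

lemma treewidth_params:
  assumes "\<beta> \<in> {tw, la, pw, ppw}" and E: "E \<subseteq> all_edges {..<n}"
  shows "\<beta> n E \<le> n"
    and "no_bipartite_hole m {..<n} E \<Longrightarrow> 0 < m \<Longrightarrow> n \<le> \<beta> n E + 4 * m"
proof -
  obtain host where host: "\<beta> = min_host host"
    and complete: "\<And>V k. card V = k + 1 \<Longrightarrow> host k (complete_graph V)"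
    and k_tree: "\<And>k H. host k H \<Longrightarrow> k_tree k H"
    using assms(1) k_tree.start linear_k_tree_is_k_tree two_sided_k_tree_is_k_tree
      k_caterpillar_is_k_tree linear_k_tree_seq.start two_sided_k_tree_seq.start
      k_caterpillar_seq.start
    unfolding tw_def la_def pw_def ppw_def linear_k_tree_def two_sided_k_tree_def k_caterpillar_def
    by (smt (verit) insert_iff singletonD)
  show "\<beta> n E \<le> n" unfolding host by (rule min_host_le[of host, OF complete E])
  show "n \<le> \<beta> n E + 4 * m" if "no_bipartite_hole m {..<n} E" "0 < m"
    unfolding host by (rule min_host_ge[of host, OF complete k_tree E that])
qed


section \<open>Products over decompositions\<close>

lemma finite_all_edges: "finite V \<Longrightarrow> finite (all_edges V)"
  unfolding all_edges_def by (rule finite_subset[of _ "Pow V"]) auto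

lemma decomposition_subset: "decomposition r n E \<Longrightarrow> i \<in> {1..r} \<Longrightarrow> E i \<subseteq> all_edges {..<n}"
  unfolding decomposition_def by blast

lemma decomposition_of_colouring:
  assumes "\<And>e. e \<in> all_edges {..<n} \<Longrightarrow> f e \<in> {1..r}"
  shows "decomposition r n (\<lambda>i. {e \<in> all_edges {..<n}. f e = i})"
  using assms by (auto simp: decomposition_def disjoint_family_on_def)

text \<open>
  A decomposition is arbitrary outside \<open>{1..r}\<close>, so there are infinitely many of them; the product
  depends only on the finitely many possible restrictions to \<open>{1..r}\<close>.
\<close>

lemma finite_beta_products: "finite {(\<Prod>i=1..r. \<beta> n (E i)) |E. decomposition r n E}"
proof (rule finite_subset)
  show "{(\<Prod>i=1..r. \<beta> n (E i)) |E. decomposition r n E} \<subseteq>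
      (\<lambda>E. \<Prod>i=1..r. \<beta> n (E i)) ` (PiE {1..r} (\<lambda>_. Pow (all_edges {..<n})))"
  proof safe
    fix E assume "decomposition r n E"
    then have "restrict E {1..r} \<in> PiE {1..r} (\<lambda>_. Pow (all_edges {..<n}))"
      using decomposition_subset by auto
    moreover have "(\<Prod>i=1..r. \<beta> n (E i)) = (\<Prod>i=1..r. \<beta> n (restrict E {1..r} i))"
      by (intro prod.cong) auto
    ultimately show "(\<Prod>i=1..r. \<beta> n (E i)) \<in>
        (\<lambda>E. \<Prod>i=1..r. \<beta> n (E i)) ` (PiE {1..r} (\<lambda>_. Pow (all_edges {..<n})))"
      by blast
  qed
  show "finite ((\<lambda>E. \<Prod>i=1..r. \<beta> n (E i)) ` (PiE {1..r} (\<lambda>_. Pow (all_edges {..<n}))))"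
    by (intro finite_imageI finite_PiE) (auto simp: finite_all_edges)
qed

lemma beta_times_ge:
  assumes "decomposition r n E" and "\<And>i. i \<in> {1..r} \<Longrightarrow> c \<le> \<beta> n (E i)"
  shows "c ^ r \<le> beta_times \<beta> r n"
proof -
  have "c ^ r = (\<Prod>i=1..r. c)" by simp
  also have "\<dots> \<le> (\<Prod>i=1..r. \<beta> n (E i))" using assms(2) by (intro prod_mono) auto
  also have "\<dots> \<le> beta_times \<beta> r n"
    unfolding beta_times_def using assms(1) by (intro Max_ge finite_beta_products) auto
  finally show ?thesis .
qed

lemma beta_times_attained:
  assumes "1 \<le> r"
  shows "\<exists>E. decomposition r n E \<and> beta_times \<beta> r n = (\<Prod>i=1..r. \<beta> n (E i))"
proof -
  have "decomposition r n (\<lambda>i. {e \<in> all_edges {..<n}. 1 = i})"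
    using assms by (intro decomposition_of_colouring) auto
  then have "{(\<Prod>i=1..r. \<beta> n (E i)) |E. decomposition r n E} \<noteq> {}" by blast
  from Max_in[OF finite_beta_products[of \<beta> n r] this] show ?thesis unfolding beta_times_def by auto
qed


section \<open>Random decompositions and tree-width\<close>

text \<open>
  A union bound over all triples of a colour \<open>i\<close> and two disjoint \<open>m\<close>-sets \<open>A\<close>, \<open>B\<close>. There are at
  most \<open>r * 4 ^ n\<close> of them, and the fraction \<open>((r - 1) / r) ^ (m * m)\<close> of all edge colourings avoids
  the colour \<open>i\<close> on the \<open>m * m\<close> edges between \<open>A\<close> and \<open>B\<close>.
\<close>

lemma decomposition_without_holes:
  assumes r: "1 \<le> r" and count: "r * 4 ^ n * (r - 1) ^ (m * m) < r ^ (m * m)"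
  shows "\<exists>E. decomposition r n E \<and> (\<forall>i\<in>{1..r}. no_bipartite_hole m {..<n} (E i))"
proof -
  define K where "K = all_edges {..<n}"
  define cross :: "nat set \<Rightarrow> nat set \<Rightarrow> nat set set" where
    "cross A B = (\<lambda>(a, b). {a, b}) ` (A \<times> B)" for A B
  define bad where
    "bad i A B = PiE K (\<lambda>e. if e \<in> cross A B then {1..r} - {i} else {1..r})" for i A B
  define T where "T = {(i, A, B). i \<in> {1..r} \<and> A \<subseteq> {..<n} \<and> B \<subseteq> {..<n} \<and>
     A \<inter> B = {} \<and> card A = m \<and> card B = m}"
  have finK: "finite K" unfolding K_def by (rule finite_all_edges) simp
  have T_sub: "T \<subseteq> {1..r} \<times> Pow {..<n} \<times> Pow {..<n}" by (auto simp: T_def)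
  then have finT: "finite T" by (rule finite_subset) auto
  have "card T \<le> card ({1..r} \<times> Pow {..<n} \<times> Pow {..<n})" by (rule card_mono[OF _ T_sub]) auto
  also have "\<dots> = r * 4 ^ n" by (simp add: card_cartesian_product card_Pow flip: power_mult_distrib)
  finally have cT: "card T \<le> r * 4 ^ n" .
  have bad: "card (bad i A B) * r ^ (m * m) = (r - 1) ^ (m * m) * r ^ card K" if "(i, A, B) \<in> T" for i A B
  proof -
    have AB: "A \<subseteq> {..<n}" "B \<subseteq> {..<n}" "A \<inter> B = {}" "card A = m" "card B = m" "i \<in> {1..r}"
      using that by (auto simp: T_def)
    have "inj_on (\<lambda>(a, b). {a, b}) (A \<times> B)"
      using AB(3) by (auto simp: inj_on_def doubleton_eq_iff)
    then have card_cross: "card (cross A B) = m * m"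
      unfolding cross_def by (simp add: card_image card_cartesian_product AB)
    have sub: "cross A B \<subseteq> K"
    proof
      fix e assume "e \<in> cross A B"
      then obtain a b where ab: "e = {a, b}" "a \<in> A" "b \<in> B" by (auto simp: cross_def)
      then have "a \<noteq> b" using AB(3) by auto
      then show "e \<in> K" using ab AB by (auto simp: K_def all_edges_def)
    qed
    have "card (bad i A B) = (\<Prod>e\<in>K. if e \<in> cross A B then r - 1 else r)"
      unfolding bad_def using finK AB(6) by (simp add: card_PiE if_distrib cong: if_cong)
    also have "\<dots> = (r - 1) ^ (m * m) * r ^ (card K - m * m)"
      using sub finK card_cross
      by (simp add: prod.If_cases Int_absorb1 card_Diff_subset finite_subset flip: Diff_eq)
    finally have "card (bad i A B) * r ^ (m * m) = (r - 1) ^ (m * m) * r ^ ((card K - m * m) + m * m)"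
      by (simp add: power_add)
    moreover have "m * m \<le> card K" using card_mono[OF finK sub] card_cross by simp
    ultimately show ?thesis by simp
  qed
  define F where "F = PiE K (\<lambda>_. {1..r})"
  have cardF: "card F = r ^ card K" unfolding F_def using finK by (simp add: card_PiE)
  define U where "U = (\<Union>(i, A, B)\<in>T. bad i A B)"
  have "card U \<le> (\<Sum>(i, A, B)\<in>T. card (bad i A B))"
    unfolding U_def using card_UN_le[OF finT, of "\<lambda>(i, A, B). bad i A B"]
    by (simp add: case_prod_unfold)
  then have "card U * r ^ (m * m) \<le> (\<Sum>(i, A, B)\<in>T. card (bad i A B)) * r ^ (m * m)" by simp
  also have "\<dots> = (\<Sum>t\<in>T. (r - 1) ^ (m * m) * r ^ card K)"
    unfolding sum_distrib_right by (intro sum.cong) (auto simp: bad)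
  also have "\<dots> \<le> r * 4 ^ n * (r - 1) ^ (m * m) * r ^ card K" using cT by simp
  also have "\<dots> < r ^ (m * m) * r ^ card K" using count r by simp
  finally have "card U < card F" using r cardF by simp
  moreover have "finite U" unfolding U_def bad_def using finT finK
    by (auto intro!: finite_PiE)
  ultimately obtain f where f: "f \<in> F" "f \<notin> U"
    by (meson card_mono not_le subsetI)
  define E where "E i = {e \<in> K. f e = i}" for i
  have "decomposition r n E"
    unfolding E_def K_def by (rule decomposition_of_colouring) (use f in \<open>auto simp: F_def K_def\<close>)
  moreover have "no_bipartite_hole m {..<n} (E i)" if i: "i \<in> {1..r}" for i
    unfolding no_bipartite_hole_def
  proof (intro allI impI, rule ccontr)
    fix A B :: "nat set"
    assume AB: "A \<subseteq> {..<n}" "B \<subseteq> {..<n}" "A \<inter> B = {}" "m \<le> card A" "m \<le> card B"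
      and no: "\<not> (\<exists>a\<in>A. \<exists>b\<in>B. {a, b} \<in> E i)"
    obtain A' where A': "A' \<subseteq> A" "card A' = m" using AB(4) obtain_subset_with_card_n by metis
    obtain B' where B': "B' \<subseteq> B" "card B' = m" using AB(5) obtain_subset_with_card_n by metis
    have "(i, A', B') \<in> T" using i A' B' AB by (auto simp: T_def)
    moreover have "f \<in> bad i A' B'"
    proof -
      have "f e \<noteq> i" if e: "e \<in> K" "e \<in> cross A' B'" for e
      proof -
        obtain a b where "a \<in> A" "b \<in> B" "e = {a, b}" using e(2) A' B' unfolding cross_def by blast
        then show ?thesis using no e(1) by (auto simp: E_def)
      qed
      then show ?thesis using f(1) unfolding F_def bad_def PiE_iff by auto
    qed
    ultimately show False using f(2) by (auto simp: U_def)
  qed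
  ultimately show ?thesis by blast
qed

text \<open>
  The union bound works with \<open>m * m\<close> linear in \<open>n\<close>, so \<open>m\<close> can be of order \<open>sqrt n\<close>.
\<close>

lemma asymptotic_decomposition_without_holes:
  assumes r: "2 \<le> r"
  shows "\<exists>m :: nat \<Rightarrow> nat. (\<lambda>n. real (m n) / real n) \<longlonglongrightarrow> 0 \<and> (\<forall>n. 0 < m n) \<and>
    (\<forall>\<^sub>F n in sequentially. \<exists>E. decomposition r n E \<and>
        (\<forall>i\<in>{1..r}. no_bipartite_hole (m n) {..<n} (E i)))"
proof -
  define q where "q = (real r - 1) / real r"
  have q: "0 < q" "q < 1" using r by (auto simp: q_def)
  \<comment> \<open>With \<open>m * m \<ge> L * n\<close> the bound becomes \<open>r * 4 ^ n / 8 ^ n = r / 2 ^ n\<close>, which is below 1 for \<open>n \<ge> r\<close>.\<close>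
  obtain L where L: "q ^ L < 1 / 8" using real_arch_pow_inv[OF _ q(2), of "1 / 8"] by auto
  define m where "m n = nat \<lceil>sqrt (real L * real n)\<rceil> + 1" for n
  have "(\<lambda>n. real (m n) / real n) \<longlonglongrightarrow> 0"
  proof (rule tendsto_sandwich[of "\<lambda>_. 0"])
    have "real (m n) \<le> sqrt (real L * real n) + 2" for n
      unfolding m_def using of_nat_ceiling[of "sqrt (real L * real n)"]
      by (simp add: of_nat_nat) linarith
    then show "\<forall>\<^sub>F n in sequentially. real (m n) / real n \<le> (sqrt (real L * real n) + 2) / real n"
      by (intro always_eventually allI divide_right_mono) auto
    have "L \<noteq> 0" using L by (intro notI) simp
    then have "0 < real L" by simp
    then show "(\<lambda>n. (sqrt (real L * real n) + 2) / real n) \<longlonglongrightarrow> 0" by real_asymp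
  qed auto
  moreover have "\<exists>E. decomposition r n E \<and> (\<forall>i\<in>{1..r}. no_bipartite_hole (m n) {..<n} (E i))"
    if n: "r \<le> n" for n
  proof (rule decomposition_without_holes)
    have "real L * real n = (sqrt (real L * real n))\<^sup>2" by simp
    also have "\<dots> \<le> (real (m n))\<^sup>2"
      unfolding m_def by (intro power_mono) (auto, linarith)
    finally have "real (L * n) \<le> real (m n * m n)" by (simp add: power2_eq_square)
    then have mm: "L * n \<le> m n * m n" by (simp only: of_nat_le_iff)
    have "real r * 4 ^ n * q ^ (m n * m n) \<le> real r * 4 ^ n * q ^ (L * n)"
      using mm q by (intro mult_left_mono power_decreasing) auto
    also have "\<dots> = real r * 4 ^ n * (q ^ L) ^ n" by (simp add: power_mult)
    also have "\<dots> \<le> real r * 4 ^ n * (1 / 8) ^ n"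
      using L q by (intro mult_left_mono power_mono) auto
    also have "\<dots> = real r / 2 ^ n" by (simp add: power_divide flip: power_mult_distrib)
        (simp add: field_simps flip: power_mult_distrib)
    also have "\<dots> < 1"
    proof -
      have "r < 2 ^ n" using n less_exp by (rule le_less_trans)
      then have "real r < real (2 ^ n)" by (simp only: of_nat_less_iff)
      then show ?thesis by simp
    qed
    finally have "real r * 4 ^ n * q ^ (m n * m n) * real r ^ (m n * m n) < real r ^ (m n * m n)"
      using r by simp
    moreover have "q ^ (m n * m n) * real r ^ (m n * m n) = (real r - 1) ^ (m n * m n)"
      using r by (simp add: q_def flip: power_mult_distrib)
    ultimately have "real (r * 4 ^ n * (r - 1) ^ (m n * m n)) < real (r ^ (m n * m n))"
      using r by (simp add: of_nat_diff mult.assoc)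
    then show "r * 4 ^ n * (r - 1) ^ (m n * m n) < r ^ (m n * m n)" by (simp only: of_nat_less_iff)
  qed (use r in simp)
  then have "\<forall>\<^sub>F n in sequentially. \<exists>E. decomposition r n E \<and>
        (\<forall>i\<in>{1..r}. no_bipartite_hole (m n) {..<n} (E i))"
    by (auto simp: eventually_sequentially)
  ultimately show ?thesis by (intro exI[of _ m]) (auto simp: m_def)
qed

theorem treewidth_type_limit:
  assumes r: "2 \<le> r" and \<beta>: "\<beta> \<in> {tw, la, pw, ppw}"
  shows "(\<lambda>n. real (beta_times \<beta> r n) / real n ^ r) \<longlonglongrightarrow> 1"
proof -
  obtain m :: "nat \<Rightarrow> nat" where m: "(\<lambda>n. real (m n) / real n) \<longlonglongrightarrow> 0" "\<And>n. 0 < m n"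
    and ev: "\<forall>\<^sub>F n in sequentially. \<exists>E. decomposition r n E \<and>
        (\<forall>i\<in>{1..r}. no_bipartite_hole (m n) {..<n} (E i))"
    using asymptotic_decomposition_without_holes[OF r] by blast
  have "(\<lambda>n. 4 * (real (m n) / real n)) \<longlonglongrightarrow> 4 * 0" by (intro tendsto_mult m tendsto_const)
  then have small: "\<forall>\<^sub>F n in sequentially. 4 * (real (m n) / real n) < 1"
    by (rule order_tendstoD) simp
  show ?thesis
  proof (rule tendsto_sandwich)
    show "(\<lambda>n. (1 - 4 * (real (m n) / real n)) ^ r) \<longlonglongrightarrow> 1"
    proof -
      have "(\<lambda>n. (1 - 4 * (real (m n) / real n)) ^ r) \<longlonglongrightarrow> (1 - 4 * 0) ^ r"
        by (intro tendsto_intros m)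
      then show ?thesis by simp
    qed
    show "\<forall>\<^sub>F n in sequentially.
        (1 - 4 * (real (m n) / real n)) ^ r \<le> real (beta_times \<beta> r n) / real n ^ r"
      using ev small eventually_gt_at_top[of 0]
    proof eventually_elim
      case (elim n)
      then obtain E where E: "decomposition r n E"
        "\<And>i. i \<in> {1..r} \<Longrightarrow> no_bipartite_hole (m n) {..<n} (E i)" by blast
      have "n - 4 * m n \<le> \<beta> n (E i)" if "i \<in> {1..r}" for i
        using treewidth_params(2)[OF \<beta> decomposition_subset[OF E(1) that] E(2)[OF that] m(2)] by simp
      then have le: "(n - 4 * m n) ^ r \<le> beta_times \<beta> r n" by (rule beta_times_ge[OF E(1)])
      have lt: "4 * m n \<le> n" using elim(2,3) by (simp add: field_simps)
      then have "(1 - 4 * (real (m n) / real n)) ^ r = real ((n - 4 * m n) ^ r) / real n ^ r"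
        using elim(3) by (simp add: of_nat_diff field_simps flip: power_divide)
      also have "\<dots> \<le> real (beta_times \<beta> r n) / real n ^ r"
        using le by (intro divide_right_mono) (simp_all only: of_nat_le_iff, simp)
      finally show ?case .
    qed
    show "\<forall>\<^sub>F n in sequentially. real (beta_times \<beta> r n) / real n ^ r \<le> 1"
      using eventually_gt_at_top[of 0]
    proof eventually_elim
      case (elim n)
      obtain E where E: "decomposition r n E" "beta_times \<beta> r n = (\<Prod>i=1..r. \<beta> n (E i))"
        using beta_times_attained[of r] r by force
      have "(\<Prod>i=1..r. \<beta> n (E i)) \<le> (\<Prod>i=1..r. n)"
        using treewidth_params(1)[OF \<beta> decomposition_subset[OF E(1)]] by (intro prod_mono) auto
      then have "beta_times \<beta> r n \<le> n ^ r" using E(2) by simp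
      then have "real (beta_times \<beta> r n) \<le> real n ^ r" by (simp only: of_nat_le_iff flip: of_nat_power)
      then show ?case using elim by (simp add: divide_le_eq)
    qed
  qed simp
qed


section \<open>Nullity and the Strong Arnold Property\<close>

text \<open>
  Gaussian elimination: an equation \<open>j\<close> with a nonzero coefficient at \<open>p\<close> expresses the unknown \<open>p\<close>
  by the others, and substituting it removes one equation and one unknown from the system.
\<close>

lemma homogeneous_system_solvable:
  fixes M :: "'j \<Rightarrow> 'i \<Rightarrow> 'a :: field"
  assumes "finite J" and "finite I" and "card J < card I"
  shows "\<exists>c. (\<exists>i\<in>I. c i \<noteq> 0) \<and> (\<forall>j\<in>J. (\<Sum>i\<in>I. M j i * c i) = 0)"
  using assms
proof (induction J arbitrary: I M rule: finite_induct)
  case empty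
  then have "I \<noteq> {}" by auto
  then show ?case by (intro exI[of _ "\<lambda>_. 1"]) auto
next
  case (insert j J)
  show ?case
  proof (cases "\<forall>i\<in>I. M j i = 0")
    case True
    then show ?thesis using insert.IH[of I M] insert by auto
  next
    case False
    then obtain p where p: "p \<in> I" "M j p \<noteq> 0" by blast
    define I' where "I' = I - {p}"
    have I': "finite I'" "card J < card I'" and split: "\<And>f :: 'i \<Rightarrow> 'a. sum f I = f p + sum f I'"
      using insert p by (auto simp: I'_def sum.remove)
    obtain c where c: "\<exists>i\<in>I'. c i \<noteq> 0"
      "\<And>j'. j' \<in> J \<Longrightarrow> (\<Sum>i\<in>I'. (M j' i - M j' p * M j i / M j p) * c i) = 0"
      using insert.IH[OF I', of "\<lambda>j' i. M j' i - M j' p * M j i / M j p"] by blast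
    define d where "d i = (if i = p then - (\<Sum>i\<in>I'. M j i * c i) / M j p else c i)" for i
    have d: "(\<Sum>i\<in>I'. f i * d i) = (\<Sum>i\<in>I'. f i * c i)" for f
      by (intro sum.cong) (auto simp: d_def I'_def)
    have "(\<Sum>i\<in>I. M j' i * d i) = 0" if "j' \<in> insert j J" for j'
    proof (cases "j' = j")
      case True
      then show ?thesis unfolding split d using p by (simp add: d_def)
    next
      case False
      then have "0 = (\<Sum>i\<in>I'. (M j' i - M j' p * M j i / M j p) * c i)" using that c(2) by auto
      also have "\<dots> = (\<Sum>i\<in>I'. M j' i * c i) - M j' p / M j p * (\<Sum>i\<in>I'. M j i * c i)"
        by (simp add: sum_distrib_left left_diff_distrib sum_subtractf mult.assoc)
      finally show ?thesis unfolding split d using p by (simp add: d_def)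
    qed
    moreover have "\<exists>i\<in>I. d i \<noteq> 0" using c(1) by (auto simp: d_def I'_def)
    ultimately show ?thesis by blast
  qed
qed

lemma kernel_basis:
  fixes A :: "real mat"
  assumes A: "A \<in> carrier_mat n n"
  obtains B where "finite B" "card B = kernel_dim A" "B \<subseteq> carrier_vec n"
    "\<And>v. v \<in> B \<Longrightarrow> A *\<^sub>v v = 0\<^sub>v n"
    "\<And>a v. (\<And>i. i < n \<Longrightarrow> (\<Sum>v\<in>B. a v * v $ i) = 0) \<Longrightarrow> v \<in> B \<Longrightarrow> a v = 0"
proof -
  interpret kernel n n A by unfold_locales (rule A)
  obtain B where fin: "finite B" and bas: "basis B" using kernel_basis_exists[OF A] by blast
  have B: "B \<subseteq> mat_kernel A" and li: "lin_indpt B" using bas unfolding Ker.basis_def by auto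
  show ?thesis
  proof (rule that[OF fin])
    show "card B = kernel_dim A" using Ker.dim_basis[OF fin bas] by simp
    show "B \<subseteq> carrier_vec n" "\<And>v. v \<in> B \<Longrightarrow> A *\<^sub>v v = 0\<^sub>v n"
      using B mat_kernel[OF A] by auto
    fix a v assume a: "\<And>i. i < n \<Longrightarrow> (\<Sum>v\<in>B. a v * v $ i) = 0" and v: "v \<in> B"
    have "lincomb a B \<in> mat_kernel A" using B by (intro Ker.lincomb_closed) auto
    then have "lincomb a B \<in> carrier_vec n" using mat_kernel[OF A] by auto
    then have "lincomb a B = 0\<^sub>v n"
      using lincomb_index[OF _ B, of _ a] a by (intro eq_vecI) auto
    then show "a v = 0" using li fin v unfolding Ker.lin_dep_def by blast
  qed
qed

lemma kernel_dim_le: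
  fixes A :: "real mat"
  assumes A: "A \<in> carrier_mat n n"
  shows "kernel_dim A \<le> n"
proof -
  obtain B :: "real vec set" where B: "finite B" "card B = kernel_dim A"
    "\<And>a v. (\<And>i. i < n \<Longrightarrow> (\<Sum>v\<in>B. a v * v $ i) = 0) \<Longrightarrow> v \<in> B \<Longrightarrow> a v = 0"
    by (rule kernel_basis[OF A]) blast
  show ?thesis
  proof (rule ccontr)
    assume "\<not> ?thesis"
    then obtain c where c: "\<exists>v\<in>B. c v \<noteq> 0" "\<And>i. i \<in> {..<n} \<Longrightarrow> (\<Sum>v\<in>B. v $ i * c v) = 0"
      using homogeneous_system_solvable[of "{..<n}" B "\<lambda>i v. v $ i"] B by auto
    have "c v = 0" if "v \<in> B" for v
      by (rule B(3)[OF _ that]) (use c(2) in \<open>simp add: mult.commute\<close>)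
    then show False using c(1) by blast
  qed
qed

text \<open>
  Vectors that have coordinates \<open>p j\<close> dual to them are independent: the coordinate \<open>p i\<close> of a linear
  combination is the coefficient of \<open>v i\<close>.
\<close>

lemma kernel_dim_ge:
  fixes A :: "real mat" and v :: "'i \<Rightarrow> real vec"
  assumes A: "A \<in> carrier_mat n n"
    and I: "finite I"
    and v: "\<And>i. i \<in> I \<Longrightarrow> v i \<in> carrier_vec n \<and> A *\<^sub>v v i = 0\<^sub>v n"
    and p: "\<And>i. i \<in> I \<Longrightarrow> p i < n"
    and dual: "\<And>i j. i \<in> I \<Longrightarrow> j \<in> I \<Longrightarrow> v i $ p j = (if i = j then 1 else 0)"
  shows "card I \<le> kernel_dim A"
proof -
  interpret kernel n n A by unfold_locales (rule A)
  have inj: "inj_on v I" using dual by (metis inj_onI zero_neq_one)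
  have S: "v ` I \<subseteq> mat_kernel A" using v mat_kernel[OF A] by auto
  have "lin_indpt (v ` I)"
  proof
    assume "lin_dep (v ` I)"
    then obtain T a w where T: "finite T" "T \<subseteq> v ` I" "lincomb a T = 0\<^sub>v n" "w \<in> T" "a w \<noteq> 0"
      unfolding Ker.lin_dep_def by auto
    then obtain i where i: "i \<in> I" "w = v i" by blast
    have "x $ p i = (if x = w then 1 else 0)" if x: "x \<in> T" for x
    proof -
      obtain k where k: "k \<in> I" "x = v k" using x T(2) by blast
      then have "x = w \<longleftrightarrow> k = i" using i inj_on_eq_iff[OF inj] by simp
      then show ?thesis using dual[OF k(1) i(1)] k(2) by simp
    qed
    then have "(\<Sum>x\<in>T. a x * x $ p i) = (\<Sum>x\<in>T. if x = w then a x else 0)"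
      by (intro sum.cong) auto
    then have "(\<Sum>x\<in>T. a x * x $ p i) = a w" using T by simp
    moreover have "(\<Sum>x\<in>T. a x * x $ p i) = 0"
      using lincomb_index[OF p[OF i(1)], of T a] T(2,3) S p[OF i(1)] by auto
    ultimately show False using T(5) by simp
  qed
  moreover obtain B where "finite B" "basis B" using kernel_basis_exists[OF A] by blast
  then have "Ker.fin_dim" unfolding Ker.fin_dim_def Ker.basis_def by auto
  ultimately have "card (v ` I) \<le> dim" using Ker.li_le_dim(2) S by blast
  then show ?thesis using inj by (simp add: card_image)
qed

lemma card_subsets_at_most_two:
  assumes "finite B"
  shows "2 * card ((\<lambda>(u, v). {u, v}) ` (B \<times> B)) = card B * (card B + 1)"
proof -
  have eq: "(\<lambda>(u, v). {u, v}) ` (B \<times> B) = {U. U \<subseteq> B \<and> card U = 1} \<union> {U. U \<subseteq> B \<and> card U = 2}"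
    (is "?L = ?R")
  proof
    show "?L \<subseteq> ?R"
    proof
      fix U assume "U \<in> ?L"
      then obtain u v where "U = {u, v}" "u \<in> B" "v \<in> B" by auto
      then show "U \<in> ?R" by (cases "u = v") auto
    qed
    show "?R \<subseteq> ?L" by (auto simp: card_1_singleton_iff card_2_iff image_iff)
  qed
  have "card ?R = card B + (card B choose 2)"
    using assms by (subst card_Un_disjoint) (auto simp: n_subsets)
  moreover have "2 * (card B choose 2) = card B * (card B - 1)"
    by (cases "card B") (auto simp: choose_two)
  ultimately show ?thesis unfolding eq by (cases "card B") auto
qed

lemma sym_matricesD:
  assumes "A \<in> sym_matrices n E"
  shows "A \<in> carrier_mat n n" "\<And>i j. i < n \<Longrightarrow> j < n \<Longrightarrow> A $$ (i, j) = A $$ (j, i)"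
    "\<And>i j. i < n \<Longrightarrow> j < n \<Longrightarrow> i \<noteq> j \<Longrightarrow> A $$ (i, j) \<noteq> 0 \<longleftrightarrow> {i, j} \<in> E"
proof -
  show A: "A \<in> carrier_mat n n" using assms by (auto simp: sym_matrices_def)
  have "transpose_mat A = A" using assms by (auto simp: sym_matrices_def)
  then show "A $$ (i, j) = A $$ (j, i)" if "i < n" "j < n" for i j
    using that A by (metis carrier_matD index_transpose_mat(1))
  show "\<And>i j. i < n \<Longrightarrow> j < n \<Longrightarrow> i \<noteq> j \<Longrightarrow> A $$ (i, j) \<noteq> 0 \<longleftrightarrow> {i, j} \<in> E"
    using assms by (auto simp: sym_matrices_def)
qed

text \<open>
  Let \<open>B\<close> be a basis of the kernel of \<open>A\<close>, of size \<open>k\<close>. The symmetric matrices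
  \<open>\<Sum>u\<in>B. \<Sum>v\<in>B. c {u, v} * u v\<^sup>T\<close> are annihilated by \<open>A\<close> and depend on \<open>k * (k + 1) / 2\<close> free
  coefficients. To vanish on the edges and on the diagonal amounts to \<open>card E + n\<close> linear equations.
  If there were fewer equations than coefficients, a nonzero such matrix would satisfy them all and
  violate the Strong Arnold Property.
\<close>

theorem strong_arnold_nullity_bound:
  assumes AS: "A \<in> sym_matrices n E" and SAP: "strong_arnold n A" and E: "E \<subseteq> all_edges {..<n}"
  shows "kernel_dim A * (kernel_dim A + 1) \<le> 2 * (card E + n)"
proof (rule ccontr)
  assume large: "\<not> ?thesis"
  note A = sym_matricesD(1)[OF AS]
  obtain B where B: "finite B" "card B = kernel_dim A" "B \<subseteq> carrier_vec n"
    "\<And>v. v \<in> B \<Longrightarrow> A *\<^sub>v v = 0\<^sub>v n"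
    "\<And>a v. (\<And>i. i < n \<Longrightarrow> (\<Sum>v\<in>B. a v * v $ i) = 0) \<Longrightarrow> v \<in> B \<Longrightarrow> a v = 0"
    by (rule kernel_basis[OF A]) blast
  \<comment> \<open>Unknowns are indexed by the sets \<open>{u, v}\<close>, equations by the edges and the singletons \<open>{i}\<close>; \<open>Min\<close> and \<open>Max\<close> read off the position of the matrix entry in both cases.\<close>
  define g :: "real vec \<times> real vec \<Rightarrow> real vec set" where "g = (\<lambda>(u, v). {u, v})"
  define I where "I = g ` (B \<times> B)"
  define J where "J = E \<union> (\<lambda>i. {i}) ` {..<n}"
  have finE: "finite E" using E by (rule finite_subset) (simp add: all_edges_def)
  have "card J = card E + n"
  proof -
    have "E \<inter> (\<lambda>i. {i}) ` {..<n} = {}" using E by (auto simp: all_edges_def)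
    then show ?thesis unfolding J_def using finE
      by (simp add: card_Un_disjoint card_image)
  qed
  moreover have "2 * card I = card B * (card B + 1)"
    unfolding I_def g_def by (rule card_subsets_at_most_two[OF B(1)])
  ultimately have "card J < card I" using large B(2) by simp
  moreover have "finite J" "finite I" using finE B(1) by (auto simp: J_def I_def)
  ultimately obtain c where c: "\<exists>U\<in>I. c U \<noteq> 0"
    "\<And>e. e \<in> J \<Longrightarrow> (\<Sum>U\<in>I. (\<Sum>p | p \<in> B \<times> B \<and> g p = U. fst p $ Min e * snd p $ Max e) * c U) = 0"
    using homogeneous_system_solvable
      [of J I "\<lambda>e U. \<Sum>p | p \<in> B \<times> B \<and> g p = U. fst p $ Min e * snd p $ Max e"] by blast
  define x where "x i j = (\<Sum>u\<in>B. \<Sum>v\<in>B. c {u, v} * (u $ i * v $ j))" for i j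
  have x_sym: "x i j = x j i" for i j
    unfolding x_def by (subst sum.swap) (simp add: insert_commute mult.commute)
  have x_J: "x (Min e) (Max e) = 0" if "e \<in> J" for e
  proof -
    have "x (Min e) (Max e) = (\<Sum>p\<in>B \<times> B. c (g p) * (fst p $ Min e * snd p $ Max e))"
      unfolding x_def g_def by (simp add: sum.cartesian_product case_prod_unfold)
    also have "\<dots> = (\<Sum>U\<in>I. \<Sum>p | p \<in> B \<times> B \<and> g p = U. c (g p) * (fst p $ Min e * snd p $ Max e))"
      unfolding I_def using B(1) by (intro sum.group[symmetric]) auto
    also have "\<dots> = (\<Sum>U\<in>I. (\<Sum>p | p \<in> B \<times> B \<and> g p = U. fst p $ Min e * snd p $ Max e) * c U)"
      by (intro sum.cong refl) (simp add: sum_distrib_left mult.commute)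
    finally show ?thesis using c(2)[OF that] by simp
  qed
  have x_diag: "x i i = 0" if "i < n" for i using x_J[of "{i}"] that by (simp add: J_def)
  have x_edge: "x i j = 0" if "{i, j} \<in> E" for i j
    using x_J[of "{i, j}"] that x_sym[of i j] by (cases "i \<le> j") (auto simp: J_def min_def max_def)
  define X where "X = mat n n (\<lambda>(i, j). x i j)"
  have X: "X \<in> carrier_mat n n" by (simp add: X_def)
  have "X \<noteq> 0\<^sub>m n n"
  proof
    assume "X = 0\<^sub>m n n"
    then have zero: "x i j = 0" if "i < n" "j < n" for i j
      using that by (metis X_def index_mat(1) index_zero_mat(1) case_prod_conv)
    have "c {u, v} = 0" if u: "u \<in> B" and v: "v \<in> B" for u v
    proof (rule B(5)[OF _ v, of "\<lambda>v. c {u, v}"])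
      fix j assume j: "j < n"
      show "(\<Sum>v\<in>B. c {u, v} * v $ j) = 0"
      proof (rule B(5)[OF _ u, of "\<lambda>u. \<Sum>v\<in>B. c {u, v} * v $ j"])
        fix i assume "i < n"
        then show "(\<Sum>u\<in>B. (\<Sum>v\<in>B. c {u, v} * v $ j) * u $ i) = 0"
          using zero[OF _ j, of i] by (simp add: x_def sum_distrib_left mult.commute mult.left_commute)
      qed
    qed
    then show False using c(1) by (auto simp: I_def g_def)
  qed
  moreover have "transpose_mat X = X" using x_sym by (intro eq_matI) (auto simp: X_def)
  moreover have "A * X = 0\<^sub>m n n"
  proof (rule eq_matI)
    fix i l assume "i < dim_row (0\<^sub>m n n :: real mat)" "l < dim_col (0\<^sub>m n n :: real mat)"
    then have il: "i < n" "l < n" by auto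
    have Au: "(\<Sum>j<n. A $$ (i, j) * u $ j) = 0" if "u \<in> B" for u
    proof -
      have "(A *\<^sub>v u) $ i = (\<Sum>j<n. A $$ (i, j) * u $ j)"
        using A il B(3) that by (auto simp: scalar_prod_def atLeast0LessThan intro!: sum.cong)
      then show ?thesis using B(4)[OF that] il by simp
    qed
    have "(A * X) $$ (i, l) = (\<Sum>j<n. A $$ (i, j) * x j l)"
      using A il by (auto simp: X_def scalar_prod_def atLeast0LessThan intro!: sum.cong)
    also have "\<dots> = (\<Sum>u\<in>B. \<Sum>v\<in>B. c {u, v} * v $ l * (\<Sum>j<n. A $$ (i, j) * u $ j))"
      unfolding x_def sum_distrib_left
      by (subst sum.swap, intro sum.cong refl, subst sum.swap) (simp add: ac_simps)
    also have "\<dots> = 0" by (simp add: Au)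
    finally show "(A * X) $$ (i, l) = 0\<^sub>m n n $$ (i, l)" using il by simp
  qed (use A X in auto)
  moreover have "hadamard_prod A X = 0\<^sub>m n n"
  proof (rule eq_matI)
    fix i j assume "i < dim_row (0\<^sub>m n n :: real mat)" "j < dim_col (0\<^sub>m n n :: real mat)"
    then have ij: "i < n" "j < n" by auto
    then have "A $$ (i, j) * x i j = 0"
      using x_diag x_edge sym_matricesD(3)[OF AS ij] by (cases "i = j") auto
    then show "hadamard_prod A X $$ (i, j) = 0\<^sub>m n n $$ (i, j)"
      using ij A by (simp add: hadamard_prod_def X_def)
  qed (use A in \<open>auto simp: hadamard_prod_def\<close>)
  moreover have "hadamard_prod (1\<^sub>m n) X = 0\<^sub>m n n"
    by (rule eq_matI) (auto simp: hadamard_prod_def X_def x_diag)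
  ultimately show False using SAP X unfolding strong_arnold_def by blast
qed


section \<open>Quadratic forms and negative eigenvalues\<close>

lemma symmetric_mat_scalar_prod:
  fixes A :: "real mat"
  assumes A: "A \<in> carrier_mat n n" "transpose_mat A = A" and xy: "x \<in> carrier_vec n" "y \<in> carrier_vec n"
  shows "x \<bullet> (A *\<^sub>v y) = y \<bullet> (A *\<^sub>v x)"
proof -
  have "x \<bullet> (A *\<^sub>v y) = (A *\<^sub>v x) \<bullet> y"
    using transpose_vec_mult_scalar[OF A(1) xy(2,1)] A(2) by simp
  also have "\<dots> = y \<bullet> (A *\<^sub>v x)" using A(1) xy by (intro comm_scalar_prod[of _ n]) auto
  finally show ?thesis .
qed

lemma scalar_prod_self_pos:
  fixes x :: "real vec"
  assumes "x \<in> carrier_vec n" "x \<noteq> 0\<^sub>v n"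
  shows "0 < x \<bullet> x"
proof -
  have "x \<bullet> x = (\<Sum>i<n. (x $ i)\<^sup>2)"
    using assms(1) by (auto simp: scalar_prod_def atLeast0LessThan power2_eq_square intro!: sum.cong)
  moreover obtain i where "i < n" "x $ i \<noteq> 0" using assms by (metis eq_vecI carrier_vecD index_zero_vec)
  then have "0 < (\<Sum>i<n. (x $ i)\<^sup>2)" by (intro sum_pos2[of _ i]) auto
  ultimately show ?thesis by simp
qed

text \<open>
  A complex eigenvector \<open>x + \<i> y\<close> exists. Comparing \<open>y \<bullet> A x\<close> with \<open>x \<bullet> A y\<close> shows that the
  imaginary part of the eigenvalue is zero, so \<open>x\<close> and \<open>y\<close> satisfy the eigenvalue equation
  separately and one of them is nonzero.
\<close>

lemma symmetric_real_eigenvector: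
  fixes A :: "real mat"
  assumes A: "A \<in> carrier_mat n n" "transpose_mat A = A" and n: "0 < n"
  shows "\<exists>a v. v \<in> carrier_vec n \<and> v \<bullet> v = 1 \<and> A *\<^sub>v v = a \<cdot>\<^sub>v v"
proof -
  define C where "C = map_mat complex_of_real A"
  have C: "C \<in> carrier_mat n n" using A(1) by (simp add: C_def)
  obtain k where "eigenvalue C k" using spectrum_non_empty[OF C n] by (auto simp: spectrum_def)
  then obtain z where z: "z \<in> carrier_vec n" "z \<noteq> 0\<^sub>v n" "C *\<^sub>v z = k \<cdot>\<^sub>v z"
    using C by (auto simp: eigenvalue_def eigenvector_def)
  define x where "x = map_vec Re z"
  define y where "y = map_vec Im z"
  have xy: "x \<in> carrier_vec n" "y \<in> carrier_vec n" using z(1) by (auto simp: x_def y_def)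
  have row: "(\<Sum>j<n. complex_of_real (A $$ (i, j)) * z $ j) = k * z $ i" if i: "i < n" for i
  proof -
    have "(C *\<^sub>v z) $ i = (\<Sum>j<n. complex_of_real (A $$ (i, j)) * z $ j)"
      using i A(1) z(1) by (auto simp: C_def scalar_prod_def atLeast0LessThan intro!: sum.cong)
    then show ?thesis using z i by simp
  qed
  have Ax: "A *\<^sub>v x = Re k \<cdot>\<^sub>v x - Im k \<cdot>\<^sub>v y"
  proof (rule eq_vecI)
    fix i assume "i < dim_vec (Re k \<cdot>\<^sub>v x - Im k \<cdot>\<^sub>v y)"
    then have i: "i < n" using xy by simp
    have "(A *\<^sub>v x) $ i = (\<Sum>j<n. A $$ (i, j) * Re (z $ j))"
      using i A(1) z(1) by (auto simp: x_def scalar_prod_def atLeast0LessThan intro!: sum.cong)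
    also have "\<dots> = Re (k * z $ i)" unfolding row[OF i, symmetric] by simp
    finally show "(A *\<^sub>v x) $ i = (Re k \<cdot>\<^sub>v x - Im k \<cdot>\<^sub>v y) $ i"
      using i z(1) by (simp add: x_def y_def)
  qed (use A xy in auto)
  have Ay: "A *\<^sub>v y = Re k \<cdot>\<^sub>v y + Im k \<cdot>\<^sub>v x"
  proof (rule eq_vecI)
    fix i assume "i < dim_vec (Re k \<cdot>\<^sub>v y + Im k \<cdot>\<^sub>v x)"
    then have i: "i < n" using xy by simp
    have "(A *\<^sub>v y) $ i = (\<Sum>j<n. A $$ (i, j) * Im (z $ j))"
      using i A(1) z(1) by (auto simp: y_def scalar_prod_def atLeast0LessThan intro!: sum.cong)
    also have "\<dots> = Im (k * z $ i)" unfolding row[OF i, symmetric] by simp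
    finally show "(A *\<^sub>v y) $ i = (Re k \<cdot>\<^sub>v y + Im k \<cdot>\<^sub>v x) $ i"
      using i z(1) by (simp add: x_def y_def)
  qed (use A xy in auto)
  have nz: "x \<noteq> 0\<^sub>v n \<or> y \<noteq> 0\<^sub>v n"
  proof (rule ccontr)
    assume "\<not> ?thesis"
    then have "Re (z $ i) = 0 \<and> Im (z $ i) = 0" if "i < n" for i
      using that z(1) unfolding x_def y_def by (metis carrier_vecD index_map_vec(1) index_zero_vec(1))
    then have "z = 0\<^sub>v n" using z(1) by (intro eq_vecI) (auto simp: complex_eq_iff)
    then show False using z(2) by simp
  qed
  have pos: "0 < x \<bullet> x + y \<bullet> y"
    using nz xy scalar_prod_self_pos[of x n] scalar_prod_self_pos[of y n]
    by (cases "x = 0\<^sub>v n"; cases "y = 0\<^sub>v n") auto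
  have "y \<bullet> (A *\<^sub>v x) = x \<bullet> (A *\<^sub>v y)" by (rule symmetric_mat_scalar_prod[OF A xy(2,1)])
  then have "Re k * (y \<bullet> x) - Im k * (y \<bullet> y) = Re k * (x \<bullet> y) + Im k * (x \<bullet> x)"
    unfolding Ax Ay using xy
    by (simp add: scalar_prod_minus_distrib[of _ n] scalar_prod_add_distrib[of _ n])
  moreover have "y \<bullet> x = x \<bullet> y" by (rule comm_scalar_prod[OF xy(2,1)])
  ultimately have "Im k * (x \<bullet> x + y \<bullet> y) = 0" by (simp add: algebra_simps)
  then have k: "Im k = 0" using pos by simp
  obtain w where w: "w \<in> carrier_vec n" "w \<noteq> 0\<^sub>v n" "A *\<^sub>v w = Re k \<cdot>\<^sub>v w"
  proof (cases "x = 0\<^sub>v n")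
    case True
    have "A *\<^sub>v y = Re k \<cdot>\<^sub>v y" using Ay xy k by (intro eq_vecI) auto
    then show ?thesis using that[of y] True nz xy by simp
  next
    case False
    have "A *\<^sub>v x = Re k \<cdot>\<^sub>v x" using Ax xy k by (intro eq_vecI) auto
    then show ?thesis using that[of x] False xy by simp
  qed
  define v where "v = (1 / sqrt (w \<bullet> w)) \<cdot>\<^sub>v w"
  have "0 < w \<bullet> w" by (rule scalar_prod_self_pos[OF w(1,2)])
  then have "v \<bullet> v = 1" using w(1) by (simp add: v_def)
  moreover have "A *\<^sub>v v = Re k \<cdot>\<^sub>v v"
    using A(1) w(1,3) by (simp add: v_def mult_mat_vec[of A n n] smult_smult_assoc mult.commute)
  moreover have "v \<in> carrier_vec n" using w(1) by (simp add: v_def)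
  ultimately show ?thesis by blast
qed

text \<open>
  The reflection in the hyperplane orthogonal to \<open>v - e\<^sub>0\<close> exchanges the unit vectors \<open>e\<^sub>0\<close> and \<open>v\<close>.
  Being symmetric and involutory, it serves as an orthogonal matrix with first column \<open>v\<close>.
\<close>

lemma householder_reflection:
  fixes v :: "real vec"
  assumes v: "v \<in> carrier_vec n" "v \<bullet> v = 1" and n: "0 < n"
  shows "\<exists>W \<in> carrier_mat n n. transpose_mat W = W \<and> W * W = 1\<^sub>m n \<and> (\<forall>i<n. W $$ (i, 0) = v $ i)"
proof (cases "v $ 0 = 1")
  case True
  have sum1: "(\<Sum>i<n. (v $ i)\<^sup>2) = 1"
    using v by (auto simp: scalar_prod_def atLeast0LessThan power2_eq_square)
  have "v $ i = 0" if "i < n" "i \<noteq> 0" for i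
  proof -
    have "(\<Sum>i<n. (v $ i)\<^sup>2) = (v $ 0)\<^sup>2 + (\<Sum>i\<in>{..<n} - {0}. (v $ i)\<^sup>2)"
      using n by (intro sum.remove) auto
    then have "(\<Sum>i\<in>{..<n} - {0}. (v $ i)\<^sup>2) = 0" using sum1 True by simp
    then have "\<forall>i\<in>{..<n} - {0}. (v $ i)\<^sup>2 = 0" by (subst (asm) sum_nonneg_eq_0_iff) auto
    then show ?thesis using that by auto
  qed
  then show ?thesis using True n by (intro bexI[of _ "1\<^sub>m n"]) auto
next
  case False
  define w where "w i = v $ i - (if i = 0 then 1 else 0)" for i
  \<comment> \<open>This is \<open>2 / (w \<bullet> w)\<close>, as \<open>w \<bullet> w = 2 - 2 * v $ 0\<close>.\<close>
  define c where "c = 1 / (1 - v $ 0)"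
  define W where "W = mat n n (\<lambda>(i, j). (if i = j then 1 else 0) - c * w i * w j)"
  have sum1: "(\<Sum>i<n. v $ i * v $ i) = 1" using v by (auto simp: scalar_prod_def atLeast0LessThan)
  have "(\<Sum>i<n. w i * w i) = (\<Sum>i<n. v $ i * v $ i + (if i = 0 then 1 - 2 * v $ i else 0))"
    by (intro sum.cong) (auto simp: w_def algebra_simps)
  also have "\<dots> = 2 - 2 * v $ 0" using sum1 n by (simp add: sum.distrib)
  finally have ww: "c * (\<Sum>i<n. w i * w i) = 2" using False by (simp add: c_def field_simps)
  have "W * W = 1\<^sub>m n"
  proof (rule eq_matI)
    fix i k assume "i < dim_row (1\<^sub>m n :: real mat)" "k < dim_col (1\<^sub>m n :: real mat)"
    then have ik: "i < n" "k < n" by auto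
    have "(W * W) $$ (i, k) = (\<Sum>j<n. ((if i = j then 1 else 0) - c * w i * w j) * ((if j = k then 1 else 0) - c * w j * w k))"
      using ik by (auto simp: W_def scalar_prod_def atLeast0LessThan)
    also have "\<dots> = (\<Sum>j<n. (if j = i then (if i = k then 1 else 0) - c * w i * w k else 0)
        - (if j = k then c * w i * w k else 0) + c * w i * w k * c * (w j * w j))"
      by (intro sum.cong) (auto simp: algebra_simps)
    also have "\<dots> = (if i = k then 1 else 0) - c * w i * w k - c * w i * w k + c * w i * w k * (c * (\<Sum>j<n. w j * w j))"
      using ik by (simp add: sum.distrib sum_subtractf sum_distrib_left mult.assoc)
    also have "\<dots> = (if i = k then 1 else 0)" unfolding ww by simp
    finally show "(W * W) $$ (i, k) = 1\<^sub>m n $$ (i, k)" using ik by simp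
  qed (auto simp: W_def)
  moreover have "W $$ (i, 0) = v $ i" if "i < n" for i
  proof -
    have "c * w 0 = -1" using False by (simp add: c_def w_def field_simps)
    then have "c * w i * w 0 = - w i" by (metis mult.commute mult.left_commute mult_minus1)
    then show ?thesis using that n by (simp add: W_def w_def)
  qed
  moreover have "transpose_mat W = W" by (intro eq_matI) (auto simp: W_def)
  moreover have "W \<in> carrier_mat n n" by (simp add: W_def)
  ultimately show ?thesis by blast
qed

text \<open>
  Deflation: conjugating with a reflection that has a unit eigenvector as first column splits off a
  \<open>1 \<times> 1\<close> block, and the remaining block is again symmetric.
\<close>

theorem real_symmetric_diagonalizable:
  fixes A :: "real mat"
  assumes "A \<in> carrier_mat n n" and "transpose_mat A = A"
  shows "\<exists>D U. similar_mat_wit A D U (transpose_mat U) \<and> diagonal_mat D"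
  using assms
proof (induction n arbitrary: A)
  case 0
  then have "similar_mat_wit A A (1\<^sub>m 0) (transpose_mat (1\<^sub>m 0))"
    by (intro similar_mat_witI[of _ _ 0]) auto
  moreover have "diagonal_mat A" using 0 by (simp add: diagonal_mat_def)
  ultimately show ?case by blast
next
  case (Suc m)
  define n where "n = Suc m"
  have A: "A \<in> carrier_mat n n" "transpose_mat A = A" and n: "0 < n" using Suc.prems by (auto simp: n_def)
  obtain a v where v: "v \<in> carrier_vec n" "v \<bullet> v = 1" "A *\<^sub>v v = a \<cdot>\<^sub>v v"
    using symmetric_real_eigenvector[OF A n] by blast
  obtain W where W: "W \<in> carrier_mat n n" "transpose_mat W = W" "W * W = 1\<^sub>m n"
    "\<And>i. i < n \<Longrightarrow> W $$ (i, 0) = v $ i"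
    using householder_reflection[OF v(1,2) n] by blast
  define A' where "A' = W * A * W"
  have A': "A' \<in> carrier_mat n n" using W A by (simp add: A'_def)
  have "transpose_mat A' = transpose_mat W * (transpose_mat A * transpose_mat W)"
    unfolding A'_def using W(1) A(1) transpose_mult[of "W * A" n n W n] transpose_mult[of W n n A n] by simp
  then have A'_sym: "transpose_mat A' = A'"
    unfolding A'_def using W(1,2) A by (simp add: assoc_mult_mat[of _ n n _ n _ n])
  have "W * A' * W = (W * W) * A * (W * W)"
    unfolding A'_def using W(1) A(1) by (simp add: assoc_mult_mat[of _ n n _ n _ n])
  also have "\<dots> = A" using W(3) A(1) by simp
  finally have AA': "A = W * A' * W" ..
  have simA: "similar_mat_wit A A' W W"
    using W A A' AA' by (intro similar_mat_witI[of _ _ n]) auto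
  have colW: "col W 0 = v" using W(1,4) v(1) n by (intro eq_vecI) auto
  have "col A' 0 = (W * A) *\<^sub>v col W 0"
    unfolding A'_def by (rule col_mult2[of _ n n _ n]) (use W(1) A(1) n in auto)
  also have "\<dots> = W *\<^sub>v (A *\<^sub>v col W 0)"
    by (rule assoc_mult_mat_vec[of _ n n _ n]) (use W(1) A(1) n in auto)
  also have "\<dots> = a \<cdot>\<^sub>v (W *\<^sub>v col W 0)"
    unfolding colW v(3) using W(1) v(1) by (simp add: mult_mat_vec[of W n n])
  also have "W *\<^sub>v col W 0 = col (W * W) 0"
    by (rule col_mult2[of _ n n _ n, symmetric]) (use W(1) n in auto)
  finally have col0: "col A' 0 = a \<cdot>\<^sub>v unit_vec n 0" using W(3) n by simp
  have A'0: "A' $$ (i, 0) = (if i = 0 then a else 0)" "A' $$ (0, i) = (if i = 0 then a else 0)" if "i < n" for i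
  proof -
    have "A' $$ (i, 0) = col A' 0 $ i" using A' that n by simp
    then show e: "A' $$ (i, 0) = (if i = 0 then a else 0)" using col0 that n by simp
    have "A' $$ (0, i) = transpose_mat A' $$ (0, i)" by (simp add: A'_sym)
    also have "\<dots> = A' $$ (i, 0)" using A' that n by simp
    finally show "A' $$ (0, i) = (if i = 0 then a else 0)" using e by simp
  qed
  define A4 where "A4 = mat m m (\<lambda>(i, j). A' $$ (Suc i, Suc j))"
  define a1 where "a1 = mat 1 1 (\<lambda>_. a)"
  have A4: "A4 \<in> carrier_mat m m" by (simp add: A4_def)
  have a1: "a1 \<in> carrier_mat 1 1" by (simp add: a1_def)
  have "transpose_mat A4 = A4"
  proof (rule eq_matI)
    fix i j assume "i < dim_row A4" "j < dim_col A4"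
    then have ij: "i < m" "j < m" by (auto simp: A4_def)
    have "A' $$ (Suc j, Suc i) = transpose_mat A' $$ (Suc i, Suc j)" using A' ij by (simp add: n_def)
    then show "transpose_mat A4 $$ (i, j) = A4 $$ (i, j)" using ij A'_sym by (simp add: A4_def)
  qed (auto simp: A4_def)
  then obtain D' U' where IH: "similar_mat_wit A4 D' U' (transpose_mat U')" "diagonal_mat D'"
    using Suc.IH[OF A4] by blast
  have DU: "D' \<in> carrier_mat m m" "U' \<in> carrier_mat m m"
    using similar_mat_witD2[OF A4 IH(1)] by auto
  have block: "A' = four_block_mat a1 (0\<^sub>m 1 m) (0\<^sub>m m 1) A4"
  proof (rule eq_matI)
    fix i j assume "i < dim_row (four_block_mat a1 (0\<^sub>m 1 m) (0\<^sub>m m 1) A4)"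
      "j < dim_col (four_block_mat a1 (0\<^sub>m 1 m) (0\<^sub>m m 1) A4)"
    then have ij: "i < n" "j < n" using a1 A4 by (auto simp: n_def)
    then show "A' $$ (i, j) = four_block_mat a1 (0\<^sub>m 1 m) (0\<^sub>m m 1) A4 $$ (i, j)"
      using A'0[OF ij(1)] A'0[OF ij(2)] a1 A4
      by (cases i; cases j) (auto simp: n_def a1_def A4_def)
  qed (use A' a1 A4 in \<open>auto simp: n_def\<close>)
  define D where "D = four_block_mat a1 (0\<^sub>m 1 m) (0\<^sub>m m 1) D'"
  define F where "F = four_block_mat (1\<^sub>m 1) (0\<^sub>m 1 m) (0\<^sub>m m 1) U'"
  have F: "F \<in> carrier_mat n n"
    unfolding F_def n_def using four_block_carrier_mat[OF one_carrier_mat[of 1] DU(2)] by simp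
  have "similar_mat_wit a1 a1 (1\<^sub>m 1) (1\<^sub>m 1)" by (rule similar_mat_wit_refl[OF a1])
  from similar_mat_wit_four_block[OF this IH(1) _ _ a1 A4 zero_carrier_mat zero_carrier_mat, of "0\<^sub>m 1 m" "0\<^sub>m m 1"]
  have "similar_mat_wit A' D F (four_block_mat (1\<^sub>m 1) (0\<^sub>m 1 m) (0\<^sub>m m 1) (transpose_mat U'))"
    using DU unfolding block D_def F_def by simp
  also have "four_block_mat (1\<^sub>m 1) (0\<^sub>m 1 m) (0\<^sub>m m 1) (transpose_mat U') = transpose_mat F"
    unfolding F_def using DU by (subst transpose_four_block_mat[of _ 1 1 _ m _ m]) auto
  finally have "similar_mat_wit A D (W * F) (transpose_mat F * W)"
    by (rule similar_mat_wit_trans[OF simA])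
  moreover have "transpose_mat F * W = transpose_mat (W * F)"
    using W(1,2) F by (simp add: transpose_mult[of _ n n])
  moreover have "diagonal_mat D"
    using IH(2) DU a1 by (auto simp: D_def diagonal_mat_def)
  ultimately show ?case by metis
qed

text \<open>
  Everything that is needed of the diagonalization: it makes the quadratic form a weighted sum of
  squares, and the number of negative weights is the number of negative eigenvalues counted with
  their multiplicity as roots of the characteristic polynomial.
\<close>

lemma symmetric_diagonal_form:
  fixes A :: "real mat"
  assumes A: "A \<in> carrier_mat n n" "transpose_mat A = A"
  obtains U l where "U \<in> carrier_mat n n"
    "\<And>x. x \<in> carrier_vec n \<Longrightarrow> \<exists>y \<in> carrier_vec n. x = U *\<^sub>v y"
    "\<And>y. y \<in> carrier_vec n \<Longrightarrow> (U *\<^sub>v y) \<bullet> (A *\<^sub>v (U *\<^sub>v y)) = (\<Sum>i<n. l i * (y $ i)\<^sup>2)"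
    "num_neg_eigenvalues A = card {i. i < n \<and> l i < 0}"
proof -
  obtain D U where sim: "similar_mat_wit A D U (transpose_mat U)" and diag: "diagonal_mat D"
    using real_symmetric_diagonalizable[OF A] by blast
  have UU: "U * transpose_mat U = 1\<^sub>m n" "transpose_mat U * U = 1\<^sub>m n"
    and AD: "A = U * D * transpose_mat U"
    and D: "D \<in> carrier_mat n n" and U: "U \<in> carrier_mat n n"
    using similar_mat_witD2[OF A(1) sim] by auto
  define l where "l i = D $$ (i, i)" for i
  have Dy: "(D *\<^sub>v y) $ i = l i * y $ i" if "i < n" "y \<in> carrier_vec n" for i y
  proof -
    have "(D *\<^sub>v y) $ i = (\<Sum>j<n. D $$ (i, j) * y $ j)"
      using D that by (auto simp: scalar_prod_def atLeast0LessThan intro!: sum.cong)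
    also have "\<dots> = (\<Sum>j<n. if j = i then l i * y $ i else 0)"
      using diag D that(1) by (intro sum.cong) (auto simp: diagonal_mat_def l_def)
    finally show ?thesis using that by simp
  qed
  show ?thesis
  proof (rule that[OF U, of l])
    show "\<exists>y \<in> carrier_vec n. x = U *\<^sub>v y" if x: "x \<in> carrier_vec n" for x
    proof
      have "U *\<^sub>v (transpose_mat U *\<^sub>v x) = (U * transpose_mat U) *\<^sub>v x"
        using U x by (simp add: assoc_mult_mat_vec[of _ n n _ n])
      then show "x = U *\<^sub>v (transpose_mat U *\<^sub>v x)" using UU x by simp
    qed (use U x in simp)
    show "(U *\<^sub>v y) \<bullet> (A *\<^sub>v (U *\<^sub>v y)) = (\<Sum>i<n. l i * (y $ i)\<^sup>2)" if y: "y \<in> carrier_vec n" for y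
    proof -
      have "A * U = U * D * (transpose_mat U * U)"
        unfolding AD using U D by (simp add: assoc_mult_mat[of _ n n _ n _ n])
      then have AU: "A * U = U * D" using UU U D by simp
      have "A *\<^sub>v (U *\<^sub>v y) = U *\<^sub>v (D *\<^sub>v y)"
        using assoc_mult_mat_vec[OF A(1) U y] assoc_mult_mat_vec[OF U D y] AU by simp
      then have "(U *\<^sub>v y) \<bullet> (A *\<^sub>v (U *\<^sub>v y)) = (transpose_mat U *\<^sub>v (U *\<^sub>v y)) \<bullet> (D *\<^sub>v y)"
        using transpose_vec_mult_scalar[OF U, of "D *\<^sub>v y" "U *\<^sub>v y"] U D y by simp
      also have "transpose_mat U *\<^sub>v (U *\<^sub>v y) = y"
        using assoc_mult_mat_vec[OF transpose_carrier_mat[THEN iffD2, OF U] U y] UU(2) y by simp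
      also have "y \<bullet> (D *\<^sub>v y) = (\<Sum>i<n. y $ i * (D *\<^sub>v y) $ i)"
        using y D by (simp add: scalar_prod_def atLeast0LessThan)
      also have "\<dots> = (\<Sum>i<n. l i * (y $ i)\<^sup>2)"
        using y by (intro sum.cong) (auto simp: Dy power2_eq_square)
      finally show ?thesis .
    qed
    have "upper_triangular D" using diag D unfolding upper_triangular_def diagonal_mat_def by auto
    moreover have "char_poly A = char_poly D"
      using sim by (intro char_poly_similar) (auto simp: similar_mat_def)
    ultimately have cp: "char_poly A = (\<Prod>a\<leftarrow>diag_mat D. [:- a, 1:])"
      using char_poly_upper_triangular[OF D] by simp
    have dm: "diag_mat D = map l [0..<n]" using D by (simp add: diag_mat_def l_def)
    have ord: "order x (char_poly A) = card {i. i < n \<and> l i = x}" for x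
    proof -
      have "order x (char_poly A) = (\<Sum>a\<leftarrow>diag_mat D. order x [:- a, 1:])"
        unfolding cp by (subst order_prod_list) (auto simp: o_def)
      also have "\<dots> = (\<Sum>i<n. if l i = x then 1 else 0)"
        unfolding dm by (simp add: o_def order_linear' interv_sum_list_conv_sum_set_nat atLeast0LessThan)
      also have "\<dots> = card {i. i < n \<and> l i = x}" by (simp add: sum.If_cases Int_def)
      finally show ?thesis .
    qed
    have ev: "eigenvalue A x \<longleftrightarrow> x \<in> l ` {..<n}" for x
    proof -
      have "eigenvalue A x \<longleftrightarrow> poly (char_poly A) x = 0" by (rule eigenvalue_root_char_poly[OF A(1)])
      also have "\<dots> \<longleftrightarrow> x \<in> l ` {..<n}" unfolding cp dm
        by (auto simp: poly_prod_list prod_list_zero_iff o_def)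
      finally show ?thesis .
    qed
    define N where "N = {x. x < 0 \<and> x \<in> l ` {..<n}}"
    have "finite N" unfolding N_def by simp
    have "num_neg_eigenvalues A = (\<Sum>x\<in>N. card {i. i < n \<and> l i = x})"
      by (simp add: num_neg_eigenvalues_def ord ev N_def)
    also have "\<dots> = card (\<Union>x\<in>N. {i. i < n \<and> l i = x})"
      using \<open>finite N\<close> by (intro card_UN_disjoint[symmetric]) auto
    also have "(\<Union>x\<in>N. {i. i < n \<and> l i = x}) = {i. i < n \<and> l i < 0}" by (auto simp: N_def)
    finally show "num_neg_eigenvalues A = card {i. i < n \<and> l i < 0}" .
  qed
qed

text \<open>
  Inertia in the case that matters for \<open>mu\<close>. Two negative eigenvalues would give a plane on which
  the form is negative definite, and the plane would meet the hyperplane orthogonal to \<open>h\<close>; no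
  negative eigenvalue would make the form nonnegative everywhere.
\<close>

theorem one_negative_eigenvalue:
  fixes A :: "real mat"
  assumes A: "A \<in> carrier_mat n n" "transpose_mat A = A" and h: "h \<in> carrier_vec n"
    and nonneg: "\<And>x. x \<in> carrier_vec n \<Longrightarrow> h \<bullet> x = 0 \<Longrightarrow> 0 \<le> x \<bullet> (A *\<^sub>v x)"
    and z: "z \<in> carrier_vec n" "z \<bullet> (A *\<^sub>v z) < 0"
  shows "num_neg_eigenvalues A = 1"
proof -
  obtain U l where U: "U \<in> carrier_mat n n"
    and surj: "\<And>x. x \<in> carrier_vec n \<Longrightarrow> \<exists>y \<in> carrier_vec n. x = U *\<^sub>v y"
    and form: "\<And>y. y \<in> carrier_vec n \<Longrightarrow> (U *\<^sub>v y) \<bullet> (A *\<^sub>v (U *\<^sub>v y)) = (\<Sum>i<n. l i * (y $ i)\<^sup>2)"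
    and num: "num_neg_eigenvalues A = card {i. i < n \<and> l i < 0}"
    by (rule symmetric_diagonal_form[OF A]) blast
  have "\<exists>i<n. l i < 0"
  proof (rule ccontr)
    assume "\<not> ?thesis"
    then have l: "0 \<le> l i" if "i < n" for i using that not_less by blast
    obtain y where "y \<in> carrier_vec n" "z = U *\<^sub>v y" using surj[OF z(1)] by blast
    then have "z \<bullet> (A *\<^sub>v z) = (\<Sum>i<n. l i * (y $ i)\<^sup>2)" using form by simp
    also have "\<dots> \<ge> 0" using l by (intro sum_nonneg) auto
    finally show False using z(2) by simp
  qed
  then obtain i where i: "i < n" "l i < 0" by blast
  have "j = i" if j: "j < n" "l j < 0" for j
  proof (rule ccontr)
    assume ji: "j \<noteq> i"
    define H where "H k = h \<bullet> (U *\<^sub>v unit_vec n k)" for k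
    \<comment> \<open>The coefficients of a nonzero vector in the plane that is orthogonal to \<open>h\<close>.\<close>
    obtain p q where pq: "p * H i + q * H j = 0" "p \<noteq> 0 \<or> q \<noteq> 0"
    proof (cases "H j = 0")
      case True
      then show ?thesis using that[of 0 1] by simp
    next
      case False
      then show ?thesis using that[of "H j" "- H i"] by simp
    qed
    define y where "y = p \<cdot>\<^sub>v unit_vec n i + q \<cdot>\<^sub>v unit_vec n j"
    have y: "y \<in> carrier_vec n" by (simp add: y_def)
    have "U *\<^sub>v y = p \<cdot>\<^sub>v (U *\<^sub>v unit_vec n i) + q \<cdot>\<^sub>v (U *\<^sub>v unit_vec n j)"
      unfolding y_def using U by (simp add: mult_add_distrib_mat_vec[of _ n n] mult_mat_vec[of _ n n])
    then have "h \<bullet> (U *\<^sub>v y) = p * H i + q * H j"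
      unfolding H_def using U h by (simp add: scalar_prod_add_distrib[of _ n])
    then have "0 \<le> (\<Sum>k<n. l k * (y $ k)\<^sup>2)"
      using nonneg[of "U *\<^sub>v y"] pq(1) form[OF y] U y by simp
    also have "(\<Sum>k<n. l k * (y $ k)\<^sup>2) = (\<Sum>k<n. (if k = i then l i * p\<^sup>2 else 0) + (if k = j then l j * q\<^sup>2 else 0))"
      using ji i(1) j(1) by (intro sum.cong) (auto simp: y_def)
    also have "\<dots> = l i * p\<^sup>2 + l j * q\<^sup>2" using i j by (simp add: sum.distrib)
    finally have "0 \<le> l i * p\<^sup>2 + l j * q\<^sup>2" .
    moreover have "l i * p\<^sup>2 \<le> 0" "l j * q\<^sup>2 \<le> 0" using i j by (simp_all add: mult_nonpos_nonneg)
    ultimately have "l i * p\<^sup>2 = 0" "l j * q\<^sup>2 = 0" by linarith+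
    then show False using pq(2) i(2) j(2) by simp
  qed
  then have "{i. i < n \<and> l i < 0} = {i}" using i by blast
  then show ?thesis using num by simp
qed


section \<open>Extension of a matrix by a diagonally dominant block\<close>

text \<open>
  At an entry of largest modulus the diagonal term outweighs the sum of the other terms, which are
  at most \<open>card S - 1 < n\<close> in number, unless that entry is zero.
\<close>

lemma dominant_system_zero:
  fixes f :: "'a \<Rightarrow> real"
  assumes S: "finite S" "card S \<le> n"
    and d: "\<And>i. i \<in> S \<Longrightarrow> \<bar>d i\<bar> = real n"
    and w: "\<And>i j. \<bar>w i j\<bar> \<le> 1" "\<And>i. w i i = 0"
    and eq: "\<And>i. i \<in> S \<Longrightarrow> d i * f i + (\<Sum>j\<in>S. w i j * f j) = 0"
    and i: "i \<in> S"
  shows "f i = 0"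
proof -
  have "S \<noteq> {}" using i by blast
  then have "Max ((\<lambda>i. \<bar>f i\<bar>) ` S) \<in> (\<lambda>i. \<bar>f i\<bar>) ` S" using S by (intro Max_in) auto
  then obtain p where p: "p \<in> S" "\<bar>f p\<bar> = Max ((\<lambda>i. \<bar>f i\<bar>) ` S)" by auto
  have max: "\<bar>f j\<bar> \<le> \<bar>f p\<bar>" if "j \<in> S" for j unfolding p(2) using S that by (intro Max_ge) auto
  have "real n * \<bar>f p\<bar> = \<bar>d p * f p\<bar>" using d[OF p(1)] by (simp add: abs_mult)
  also have "\<dots> = \<bar>\<Sum>j\<in>S. w p j * f j\<bar>" using eq[OF p(1)] by linarith
  also have "\<dots> \<le> (\<Sum>j\<in>S. \<bar>w p j * f j\<bar>)" by (rule sum_abs)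
  also have "\<dots> = (\<Sum>j\<in>S - {p}. \<bar>w p j * f j\<bar>)" using w(2) S p(1) by (simp add: sum.remove)
  also have "\<dots> \<le> (\<Sum>j\<in>S - {p}. \<bar>f p\<bar>)"
  proof (rule sum_mono)
    fix j assume "j \<in> S - {p}"
    then have "\<bar>w p j\<bar> * \<bar>f j\<bar> \<le> 1 * \<bar>f p\<bar>" using w max by (intro mult_mono) auto
    then show "\<bar>w p j * f j\<bar> \<le> \<bar>f p\<bar>" by (simp add: abs_mult)
  qed
  also have "\<dots> = (real (card S) - 1) * \<bar>f p\<bar>"
  proof -
    have "1 \<le> card S" using \<open>S \<noteq> {}\<close> S by (simp add: Suc_le_eq card_gt_0_iff)
    then show ?thesis using S p(1) by (simp add: of_nat_diff)
  qed
  also have "\<dots> \<le> (real n - 1) * \<bar>f p\<bar>" using S by (intro mult_right_mono) auto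
  finally have "\<bar>f p\<bar> \<le> 0" by (simp add: algebra_simps)
  then show ?thesis using max[OF i] by simp
qed

text \<open>
  Each mixed term is at least \<open>- ((x i)\<^sup>2 + (x j)\<^sup>2) / 2\<close>, and every square is counted \<open>card S\<close> times.
\<close>

lemma weighted_form_bound:
  fixes x :: "'a \<Rightarrow> real"
  assumes "finite S" "card S \<le> n" and w: "\<And>i j. \<bar>w i j\<bar> \<le> 1"
  shows "0 \<le> real n * (\<Sum>i\<in>S. (x i)\<^sup>2) + (\<Sum>i\<in>S. \<Sum>j\<in>S. w i j * x i * x j)"
proof -
  have term_ge: "- ((x i)\<^sup>2 + (x j)\<^sup>2) / 2 \<le> w i j * x i * x j" for i j
  proof -
    have "\<bar>w i j * x i * x j\<bar> \<le> 1 * (\<bar>x i\<bar> * \<bar>x j\<bar>)"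
      unfolding abs_mult mult.assoc using w by (intro mult_right_mono) auto
    moreover have "2 * (\<bar>x i\<bar> * \<bar>x j\<bar>) \<le> (x i)\<^sup>2 + (x j)\<^sup>2"
      using sum_squares_bound[of "\<bar>x i\<bar>" "\<bar>x j\<bar>"] by simp
    ultimately have "- ((x i)\<^sup>2 + (x j)\<^sup>2) / 2 \<le> - \<bar>w i j * x i * x j\<bar>" by simp
    also have "\<dots> \<le> w i j * x i * x j" using abs_ge_minus_self[of "w i j * x i * x j"] by simp
    finally show ?thesis .
  qed
  have "- real (card S) * (\<Sum>i\<in>S. (x i)\<^sup>2) = (\<Sum>i\<in>S. \<Sum>j\<in>S. - ((x i)\<^sup>2 + (x j)\<^sup>2) / 2)"
    by (simp add: sum.distrib sum_negf add_divide_distrib diff_divide_distrib sum_subtractf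
        flip: sum_divide_distrib sum_distrib_left)
  also have "\<dots> \<le> (\<Sum>i\<in>S. \<Sum>j\<in>S. w i j * x i * x j)" by (intro sum_mono term_ge)
  finally have "0 \<le> real (card S) * (\<Sum>i\<in>S. (x i)\<^sup>2) + (\<Sum>i\<in>S. \<Sum>j\<in>S. w i j * x i * x j)" by simp
  also have "real (card S) * (\<Sum>i\<in>S. (x i)\<^sup>2) \<le> real n * (\<Sum>i\<in>S. (x i)\<^sup>2)"
    using assms(2) by (intro mult_right_mono sum_nonneg) auto
  finally show ?thesis by simp
qed

text \<open>
  A set \<open>U\<close> of vertices that no edge leaves, and a symmetric matrix \<open>core\<close> on \<open>U\<close> that has the right
  zero pattern and the Strong Arnold Property. Below, \<open>core\<close> is extended to all vertices by a diagonally
  dominant block on the complement of \<open>U\<close>. This block is invertible, so the kernel and the Strong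
  Arnold Property are those of \<open>core\<close>, whatever the edges outside \<open>U\<close> are. Signs are allowed in
  the dominating diagonal \<open>d\<close> in order to place a negative eigenvalue there.
\<close>

locale core_matrix =
  fixes n :: nat and E :: "nat set set" and U :: "nat set"
    and core :: "nat \<Rightarrow> nat \<Rightarrow> real" and d :: "nat \<Rightarrow> real"
  assumes U: "U \<subseteq> {..<n}"
    and core_sym: "\<And>i j. i \<in> U \<Longrightarrow> j \<in> U \<Longrightarrow> core i j = core j i"
    and core_edge: "\<And>i j. i \<in> U \<Longrightarrow> j \<in> U \<Longrightarrow> i \<noteq> j \<Longrightarrow> core i j \<noteq> 0 \<longleftrightarrow> {i, j} \<in> E"
    and no_cross: "\<And>i j. i \<in> U \<Longrightarrow> j < n \<Longrightarrow> j \<notin> U \<Longrightarrow> {i, j} \<notin> E"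
    and core_arnold: "\<And>x i k. (\<And>i j. i \<in> U \<Longrightarrow> j \<in> U \<Longrightarrow> {i, j} \<in> E \<Longrightarrow> x i j = 0) \<Longrightarrow>
      (\<And>i. i \<in> U \<Longrightarrow> x i i = 0) \<Longrightarrow>
      (\<And>i k. i \<in> U \<Longrightarrow> k \<in> U \<Longrightarrow> (\<Sum>j\<in>U. core i j * x j k) = 0) \<Longrightarrow>
      i \<in> U \<Longrightarrow> k \<in> U \<Longrightarrow> x i k = (0 :: real)"
    and d: "\<And>i. \<bar>d i\<bar> = real n"
begin

definition S :: "nat set" where "S = {..<n} - U"

definition w :: "nat \<Rightarrow> nat \<Rightarrow> real" where "w i j = (if i \<noteq> j \<and> {i, j} \<in> E then - 1 else 0)"

definition A :: "real mat" where
  "A = mat n n (\<lambda>(i, j). if i \<in> U \<and> j \<in> U then core i j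
     else if i \<in> U \<or> j \<in> U then 0 else if i = j then d i else w i j)"

lemma A_carrier: "A \<in> carrier_mat n n"
  by (simp add: A_def)

lemma S_bounds: "finite S" "card S \<le> n"
  using card_mono[of "{..<n}" S] by (auto simp: S_def)

lemma A_row:
  assumes i: "i < n"
  shows "(\<Sum>j<n. A $$ (i, j) * f j) =
    (if i \<in> U then \<Sum>j\<in>U. core i j * f j else d i * f i + (\<Sum>j\<in>S. w i j * f j))"
proof -
  have "(\<Sum>j<n. A $$ (i, j) * f j) = (\<Sum>j\<in>S. A $$ (i, j) * f j) + (\<Sum>j\<in>U. A $$ (i, j) * f j)"
    unfolding S_def using U by (intro sum.subset_diff) auto
  also have "(\<Sum>j\<in>U. A $$ (i, j) * f j) = (if i \<in> U then \<Sum>j\<in>U. core i j * f j else 0)"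
    using i U by (auto simp: A_def intro!: sum.cong sum.neutral)
  also have "(\<Sum>j\<in>S. A $$ (i, j) * f j) = (if i \<in> U then 0 else d i * f i + (\<Sum>j\<in>S. w i j * f j))"
  proof (cases "i \<in> U")
    case True
    then show ?thesis using i by (auto simp: A_def S_def intro!: sum.neutral)
  next
    case False
    then have iS: "i \<in> S" using i by (simp add: S_def)
    have "(\<Sum>j\<in>S. A $$ (i, j) * f j) = (\<Sum>j\<in>S. (if j = i then d i * f i else 0) + w i j * f j)"
      using i False by (intro sum.cong) (auto simp: A_def S_def w_def)
    also have "\<dots> = d i * f i + (\<Sum>j\<in>S. w i j * f j)"
      using iS S_bounds by (simp add: sum.distrib)
    finally show ?thesis using False by simp
  qed
  finally show ?thesis by simp
qed

lemma A_mult_vec: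
  assumes "x \<in> carrier_vec n" "i < n"
  shows "(A *\<^sub>v x) $ i = (\<Sum>j<n. A $$ (i, j) * x $ j)"
  using assms A_carrier by (auto simp: scalar_prod_def atLeast0LessThan intro!: sum.cong)

lemma A_sym: "transpose_mat A = A"
  using core_sym by (intro eq_matI) (auto simp: A_def w_def insert_commute)

lemma A_sym_matrices: "A \<in> sym_matrices n E"
proof -
  have "A $$ (i, j) \<noteq> 0 \<longleftrightarrow> {i, j} \<in> E" if "i < n" "j < n" "i \<noteq> j" for i j
    using that core_edge[of i j] no_cross[of i j] no_cross[of j i]
    by (auto simp: A_def w_def insert_commute)
  then show ?thesis unfolding sym_matrices_def using A_carrier A_sym by blast
qed

text \<open>
  The rows of \<open>A * X = 0\<close> outside \<open>U\<close> form a diagonally dominant system, so \<open>X\<close> vanishes on these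
  rows and, by symmetry, on these columns. What remains of \<open>X\<close> is a matrix on \<open>U\<close>, to which the
  property of \<open>core\<close> applies.
\<close>

lemma A_strong_arnold: "strong_arnold n A"
  unfolding strong_arnold_def
proof
  assume "\<exists>X\<in>carrier_mat n n. X \<noteq> 0\<^sub>m n n \<and> transpose_mat X = X \<and>
     A * X = 0\<^sub>m n n \<and> hadamard_prod A X = 0\<^sub>m n n \<and> hadamard_prod (1\<^sub>m n) X = 0\<^sub>m n n"
  then obtain X where X: "X \<in> carrier_mat n n" "X \<noteq> 0\<^sub>m n n" "transpose_mat X = X"
    "A * X = 0\<^sub>m n n" "hadamard_prod A X = 0\<^sub>m n n" "hadamard_prod (1\<^sub>m n) X = 0\<^sub>m n n" by blast
  define x where "x i j = X $$ (i, j)" for i j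
  have x_sym: "x i j = x j i" if "i < n" "j < n" for i j
    using X(1,3) that unfolding x_def by (metis carrier_matD index_transpose_mat(1))
  have row: "(\<Sum>j<n. A $$ (i, j) * x j k) = 0" if ik: "i < n" "k < n" for i k
  proof -
    have "(A * X) $$ (i, k) = (\<Sum>j<n. A $$ (i, j) * x j k)"
      using ik X(1) A_carrier by (auto simp: x_def scalar_prod_def atLeast0LessThan intro!: sum.cong)
    then show ?thesis using X(4) ik by simp
  qed
  have diag: "x i i = 0" if "i < n" for i
  proof -
    have "hadamard_prod (1\<^sub>m n) X $$ (i, i) = x i i" using that by (simp add: hadamard_prod_def x_def)
    then show ?thesis using X(6) that by simp
  qed
  have edge: "x i j = 0" if "i < n" "j < n" "i \<noteq> j" "{i, j} \<in> E" for i j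
  proof -
    have "hadamard_prod A X $$ (i, j) = A $$ (i, j) * x i j"
      using that A_carrier by (simp add: hadamard_prod_def x_def)
    then have "A $$ (i, j) * x i j = 0" using X(5) that by simp
    moreover have "A $$ (i, j) \<noteq> 0" using sym_matricesD(3)[OF A_sym_matrices that(1-3)] that(4) by blast
    ultimately show ?thesis by simp
  qed
  have outside: "x i k = 0" if "i \<in> S" "k < n" for i k
  proof (rule dominant_system_zero[OF S_bounds, where d = d and w = w and f = "\<lambda>i. x i k"])
    show "d i * x i k + (\<Sum>j\<in>S. w i j * x j k) = 0" if "i \<in> S" for i
      using row[of i k] A_row[of i "\<lambda>j. x j k"] that \<open>k < n\<close> by (simp add: S_def)
  qed (use d that in \<open>auto simp: w_def\<close>)
  have inside: "x i k = 0" if "i \<in> U" "k \<in> U" for i k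
  proof (rule core_arnold[of x])
    show "x i j = 0" if "i \<in> U" "j \<in> U" "{i, j} \<in> E" for i j
      using that U edge[of i j] diag[of i] by (cases "i = j") auto
    show "x i i = 0" if "i \<in> U" for i using that U diag by auto
    show "(\<Sum>j\<in>U. core i j * x j k) = 0" if "i \<in> U" "k \<in> U" for i k
      using row[of i k] A_row[of i "\<lambda>j. x j k"] that U by auto
  qed (use that in auto)
  have "x i k = 0" if "i < n" "k < n" for i k
    using that inside[of i k] outside[of i k] outside[of k i] x_sym[of i k]
    by (cases "i \<in> U"; cases "k \<in> U") (auto simp: S_def)
  then have "X = 0\<^sub>m n n" using X(1) by (intro eq_matI) (auto simp: x_def)
  then show False using X(2) by simp
qed

lemma A_form:
  assumes x: "x \<in> carrier_vec n"
  shows "x \<bullet> (A *\<^sub>v x) = (\<Sum>i\<in>U. \<Sum>j\<in>U. core i j * x $ i * x $ j) + (\<Sum>i\<in>S. d i * (x $ i)\<^sup>2)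
    + (\<Sum>i\<in>S. \<Sum>j\<in>S. w i j * x $ i * x $ j)"
proof -
  have "x \<bullet> (A *\<^sub>v x) = (\<Sum>i<n. x $ i * (A *\<^sub>v x) $ i)"
    using A_carrier by (simp add: scalar_prod_def atLeast0LessThan)
  also have "\<dots> = (\<Sum>i<n. x $ i * (if i \<in> U then \<Sum>j\<in>U. core i j * x $ j
      else d i * x $ i + (\<Sum>j\<in>S. w i j * x $ j)))"
    using x by (intro sum.cong) (auto simp: A_mult_vec A_row)
  also have "\<dots> = (\<Sum>i\<in>S. x $ i * (d i * x $ i + (\<Sum>j\<in>S. w i j * x $ j)))
      + (\<Sum>i\<in>U. x $ i * (\<Sum>j\<in>U. core i j * x $ j))"
    unfolding S_def using U by (subst sum.subset_diff[of U]) (auto intro!: arg_cong2[where f = "(+)"] sum.cong)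
  finally show ?thesis
    by (simp add: distrib_left sum.distrib sum_distrib_left power2_eq_square mult.commute mult.left_commute)
qed

lemma A_form_ge_core:
  assumes x: "x \<in> carrier_vec n" and dpos: "\<And>i. i \<in> S \<Longrightarrow> d i = real n \<or> x $ i = 0"
  shows "(\<Sum>i\<in>U. \<Sum>j\<in>U. core i j * x $ i * x $ j) \<le> x \<bullet> (A *\<^sub>v x)"
proof -
  have "(\<Sum>i\<in>S. d i * (x $ i)\<^sup>2) = real n * (\<Sum>i\<in>S. (x $ i)\<^sup>2)"
    unfolding sum_distrib_left using dpos by (intro sum.cong) auto
  moreover have "0 \<le> real n * (\<Sum>i\<in>S. (x $ i)\<^sup>2) + (\<Sum>i\<in>S. \<Sum>j\<in>S. w i j * x $ i * x $ j)"
    by (rule weighted_form_bound[OF S_bounds]) (auto simp: w_def)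
  ultimately show ?thesis unfolding A_form[OF x] by linarith
qed

lemma A_form_supported:
  assumes "\<And>i. i \<in> S \<Longrightarrow> f i = 0"
  shows "vec n f \<bullet> (A *\<^sub>v vec n f) = (\<Sum>i\<in>U. \<Sum>j\<in>U. core i j * f i * f j)"
proof -
  have zero: "vec n f $ i = 0" if "i \<in> S" for i using that assms by (auto simp: S_def)
  have "(\<Sum>i\<in>S. d i * (vec n f $ i)\<^sup>2) = 0" "(\<Sum>i\<in>S. \<Sum>j\<in>S. w i j * vec n f $ i * vec n f $ j) = 0"
    using zero by (auto intro!: sum.neutral)
  moreover have "vec n f $ i = f i" if "i \<in> U" for i using that U by auto
  then have "(\<Sum>i\<in>U. \<Sum>j\<in>U. core i j * vec n f $ i * vec n f $ j) =
      (\<Sum>i\<in>U. \<Sum>j\<in>U. core i j * f i * f j)" by (intro sum.cong) auto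
  ultimately show ?thesis unfolding A_form[OF vec_carrier] by linarith
qed

lemma A_kernel:
  assumes "\<And>i. i \<in> S \<Longrightarrow> f i = 0" and "\<And>i. i \<in> U \<Longrightarrow> (\<Sum>j\<in>U. core i j * f j) = 0"
  shows "A *\<^sub>v vec n f = 0\<^sub>v n"
proof (rule eq_vecI)
  fix i assume "i < dim_vec (0\<^sub>v n :: real vec)"
  then have i: "i < n" by simp
  have "(A *\<^sub>v vec n f) $ i = (\<Sum>j<n. A $$ (i, j) * f j)" using i by (simp add: A_mult_vec)
  also have "\<dots> = 0" unfolding A_row[OF i] using assms i by (auto simp: S_def intro!: sum.neutral)
  finally show "(A *\<^sub>v vec n f) $ i = 0\<^sub>v n $ i" using i by simp
qed (use A_carrier in simp)

lemma A_nullity_ge: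
  assumes I: "I \<subseteq> U"
    and supp: "\<And>k i. k \<in> I \<Longrightarrow> i \<notin> U \<Longrightarrow> f k i = 0"
    and ker: "\<And>k i. k \<in> I \<Longrightarrow> i \<in> U \<Longrightarrow> (\<Sum>j\<in>U. core i j * f k j) = 0"
    and dual: "\<And>k i. k \<in> I \<Longrightarrow> i \<in> I \<Longrightarrow> f k i = (if k = i then 1 else 0)"
  shows "card I \<le> kernel_dim A"
proof (rule kernel_dim_ge[OF A_carrier, where v = "\<lambda>k. vec n (f k)" and p = id])
  show "finite I" by (rule finite_subset[OF subset_trans[OF I U]]) simp
  show "vec n (f k) \<in> carrier_vec n \<and> A *\<^sub>v vec n (f k) = 0\<^sub>v n" if "k \<in> I" for k
    using A_kernel[of "f k"] supp[OF that] ker[OF that] by (auto simp: S_def)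
qed (use I U dual in auto)

lemma A_pos_semidef:
  assumes dpos: "\<And>i. d i = real n"
    and core: "\<And>f. 0 \<le> (\<Sum>i\<in>U. \<Sum>j\<in>U. core i j * f i * f j)"
  shows "pos_semidef n A"
  unfolding pos_semidef_def
proof
  fix x :: "real vec" assume "x \<in> carrier_vec n"
  then show "0 \<le> x \<bullet> (A *\<^sub>v x)"
    using A_form_ge_core[of x] dpos core[of "\<lambda>i. x $ i"] by fastforce
qed

lemma A_one_negative:
  assumes h: "\<And>x. x \<in> carrier_vec n \<Longrightarrow> (\<Sum>i<n. h i * x $ i) = 0 \<Longrightarrow>
      (\<forall>i\<in>S. d i = real n \<or> x $ i = 0) \<and> 0 \<le> (\<Sum>i\<in>U. \<Sum>j\<in>U. core i j * x $ i * x $ j)"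
    and z: "z \<in> carrier_vec n" "z \<bullet> (A *\<^sub>v z) < 0"
  shows "num_neg_eigenvalues A = 1"
proof (rule one_negative_eigenvalue[OF A_carrier A_sym _ _ z, of "vec n h"])
  fix x assume x: "x \<in> carrier_vec n" "vec n h \<bullet> x = 0"
  then have "(\<Sum>i<n. h i * x $ i) = 0" by (simp add: scalar_prod_def atLeast0LessThan)
  from h[OF x(1) this] show "0 \<le> x \<bullet> (A *\<^sub>v x)" using A_form_ge_core[OF x(1)] by fastforce
qed simp

lemma A_offdiag_nonpos:
  assumes "\<And>i j. i \<in> U \<Longrightarrow> j \<in> U \<Longrightarrow> i \<noteq> j \<Longrightarrow> core i j \<le> 0"
  shows "\<forall>i<n. \<forall>j<n. i \<noteq> j \<longrightarrow> A $$ (i, j) \<le> 0"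
  using assms by (auto simp: A_def w_def)

end

lemma finite_nullities: "finite {kernel_dim A |A. A \<in> sym_matrices n E \<and> P A}"
  by (rule finite_subset[of _ "{..n}"]) (auto simp: sym_matrices_def kernel_dim_le)

lemma xi_ge: "A \<in> sym_matrices n E \<Longrightarrow> strong_arnold n A \<Longrightarrow> kernel_dim A \<le> xi n E"
  unfolding xi_def by (rule Max_ge[OF finite_nullities]) auto

lemma nu_ge:
  "A \<in> sym_matrices n E \<Longrightarrow> strong_arnold n A \<Longrightarrow> pos_semidef n A \<Longrightarrow> kernel_dim A \<le> nu n E"
  unfolding nu_def by (rule Max_ge[OF finite_nullities]) auto

lemma mu_ge:
  "A \<in> sym_matrices n E \<Longrightarrow> strong_arnold n A \<Longrightarrow> num_neg_eigenvalues A = 1 \<Longrightarrow>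
    \<forall>i<n. \<forall>j<n. i \<noteq> j \<longrightarrow> A $$ (i, j) \<le> 0 \<Longrightarrow> kernel_dim A \<le> mu n E"
  unfolding mu_def by (rule Max_ge[OF finite_nullities]) auto

text \<open>
  The maxima are taken over nonempty sets for every graph on at least one vertex: with \<open>U\<close> empty the
  extension is an invertible matrix. It is positive definite when \<open>d = n\<close>, and when the diagonal
  entry at the vertex \<open>0\<close> is changed to \<open>- n\<close>, the form stays nonnegative on the hyperplane where
  the coordinate \<open>0\<close> vanishes, so exactly one eigenvalue is negative.
\<close>

lemma colin_de_verdiere_attained:
  assumes \<beta>: "\<beta> \<in> {nu, mu, xi}" and n: "0 < n"
  shows "\<exists>A. A \<in> sym_matrices n E \<and> strong_arnold n A \<and> \<beta> n E = kernel_dim A"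
proof -
  interpret pos: core_matrix n E "{}" "\<lambda>_ _. 0" "\<lambda>_. real n" by unfold_locales auto
  interpret neg: core_matrix n E "{}" "\<lambda>_ _. 0" "\<lambda>i. if i = 0 then - real n else real n"
    by unfold_locales auto
  have "pos_semidef n pos.A" by (rule pos.A_pos_semidef) auto
  then have nu: "{kernel_dim A |A. A \<in> sym_matrices n E \<and> strong_arnold n A \<and> pos_semidef n A} \<noteq> {}"
    using pos.A_sym_matrices pos.A_strong_arnold by blast
  have xi: "{kernel_dim A |A. A \<in> sym_matrices n E \<and> strong_arnold n A} \<noteq> {}"
    using pos.A_sym_matrices pos.A_strong_arnold by blast
  have "num_neg_eigenvalues neg.A = 1"
  proof (rule neg.A_one_negative[where h = "\<lambda>i. if i = 0 then 1 else 0" and z = "unit_vec n 0"])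
    show "unit_vec n 0 \<bullet> (neg.A *\<^sub>v unit_vec n 0) < 0"
    proof -
      have "neg.A *\<^sub>v unit_vec n 0 = col neg.A 0"
        using neg.A_carrier n by (intro eq_vecI) auto
      then show ?thesis using n by (simp add: neg.A_def)
    qed
  next
    fix x :: "real vec" assume x: "(\<Sum>i<n. (if i = 0 then 1 else 0) * x $ i) = 0"
    have "(\<Sum>i<n. (if i = 0 then 1 else 0) * x $ i) = (\<Sum>i<n. if i = 0 then x $ i else 0)"
      by (intro sum.cong) auto
    then have "x $ 0 = 0" using x n by simp
    then show "(\<forall>i\<in>neg.S. (if i = 0 then - real n else real n) = real n \<or> x $ i = 0) \<and>
       0 \<le> (\<Sum>i\<in>{}. \<Sum>j\<in>{}. 0 * x $ i * x $ j)" by auto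
  qed simp
  then have mu: "{kernel_dim A |A. A \<in> sym_matrices n E \<and> strong_arnold n A \<and>
     num_neg_eigenvalues A = 1 \<and> (\<forall>i<n. \<forall>j<n. i \<noteq> j \<longrightarrow> A $$ (i, j) \<le> 0)} \<noteq> {}"
    using neg.A_sym_matrices neg.A_strong_arnold neg.A_offdiag_nonpos by blast
  note Max_in[OF finite_nullities nu, folded nu_def] Max_in[OF finite_nullities mu, folded mu_def]
    Max_in[OF finite_nullities xi, folded xi_def]
  then show ?thesis using \<beta> by auto
qed

theorem colin_de_verdiere_edge_bound:
  assumes \<beta>: "\<beta> \<in> {nu, mu, xi}" and n: "0 < n" and E: "E \<subseteq> all_edges {..<n}"
  shows "(\<beta> n E)\<^sup>2 \<le> 2 * card E + 2 * n"
proof -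
  obtain A where "A \<in> sym_matrices n E" "strong_arnold n A" "\<beta> n E = kernel_dim A"
    using colin_de_verdiere_attained[OF \<beta> n] by blast
  then have "\<beta> n E * (\<beta> n E + 1) \<le> 2 * (card E + n)"
    using strong_arnold_nullity_bound[OF _ _ E] by simp
  then show ?thesis by (simp add: power2_eq_square)
qed


section \<open>Matrices of cliques and complete bipartite graphs\<close>

text \<open>
  On a clique \<open>U\<close> that no edge leaves, the core is the all-ones matrix \<open>J\<close>, or \<open>- J\<close> in the case
  of \<open>mu\<close>. Its form is \<open>\<plusminus>(\<Sum>i\<in>U. x i)\<^sup>2\<close> and its kernel consists of the vectors with
  coordinate sum zero. The Strong Arnold Property is trivial because all pairs in \<open>U\<close> are edges.
\<close>

lemma clique_class_colin_de_verdiere: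
  assumes \<beta>: "\<beta> \<in> {nu, mu, xi}" and U: "U \<subseteq> {..<n}"
    and clique: "\<And>i j. i \<in> U \<Longrightarrow> j \<in> U \<Longrightarrow> i \<noteq> j \<Longrightarrow> {i, j} \<in> E"
    and no_cross: "\<And>i j. i \<in> U \<Longrightarrow> j < n \<Longrightarrow> j \<notin> U \<Longrightarrow> {i, j} \<notin> E"
  shows "card U - 1 \<le> \<beta> n E"
proof (cases "U = {}")
  case False
  then obtain p where p: "p \<in> U" by blast
  have finU: "finite U" using U finite_subset by blast
  have core: "core_matrix n E U (\<lambda>_ _. \<sigma>) (\<lambda>_. real n)" if "\<sigma> \<noteq> 0" for \<sigma> :: real
  proof
    fix x :: "nat \<Rightarrow> nat \<Rightarrow> real" and i k
    assume "\<And>i j. i \<in> U \<Longrightarrow> j \<in> U \<Longrightarrow> {i, j} \<in> E \<Longrightarrow> x i j = 0" "\<And>i. i \<in> U \<Longrightarrow> x i i = 0"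
      "i \<in> U" "k \<in> U"
    then show "x i k = 0" using clique by (cases "i = k") auto
  qed (use that U clique no_cross in auto)
  interpret pos: core_matrix n E U "\<lambda>_ _. 1" "\<lambda>_. real n" by (rule core) simp
  interpret neg: core_matrix n E U "\<lambda>_ _. - 1" "\<lambda>_. real n" by (rule core) simp
  define f where "f k i = (if i = k then 1 else if i = p then - 1 else (0 :: real))" for k i
  have sum_f: "(\<Sum>j\<in>U. f k j) = 0" if "k \<in> U - {p}" for k
  proof -
    have "(\<Sum>j\<in>U. f k j) = (\<Sum>j\<in>U. (if j = k then 1 else 0) + (if j = p then - 1 else 0))"
      using that by (intro sum.cong) (auto simp: f_def)
    also have "\<dots> = 0" using that p finU by (simp add: sum.distrib)
    finally show ?thesis .
  qed
  have card: "card (U - {p}) = card U - 1" using p finU by simp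
  have pos_null: "card U - 1 \<le> kernel_dim pos.A"
    unfolding card[symmetric]
    by (rule pos.A_nullity_ge[where f = f]) (use p sum_f in \<open>auto simp: f_def\<close>)
  have neg_null: "card U - 1 \<le> kernel_dim neg.A"
    unfolding card[symmetric]
    by (rule neg.A_nullity_ge[where f = f]) (use p sum_f in \<open>auto simp: f_def sum_negf\<close>)
  have square: "(\<Sum>i\<in>U. \<Sum>j\<in>U. c * g i * g j) = c * (\<Sum>i\<in>U. g i)\<^sup>2" for g :: "nat \<Rightarrow> real" and c
    unfolding power2_eq_square sum_product by (simp add: sum_distrib_left mult.assoc)
  have "pos_semidef n pos.A"
    by (rule pos.A_pos_semidef) (simp_all only: square, simp)
  note nu = nu_ge[OF pos.A_sym_matrices pos.A_strong_arnold this]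
  note xi = xi_ge[OF pos.A_sym_matrices pos.A_strong_arnold]
  have "num_neg_eigenvalues neg.A = 1"
  proof (rule neg.A_one_negative[where h = "\<lambda>i. if i \<in> U then 1 else 0"
        and z = "vec n (\<lambda>i. if i \<in> U then 1 else 0)"])
    fix x :: "real vec" assume "(\<Sum>i<n. (if i \<in> U then 1 else 0) * x $ i) = 0"
    moreover have "(\<Sum>i<n. (if i \<in> U then 1 else 0) * x $ i) = (\<Sum>i\<in>U. x $ i)"
      using U by (intro sum.mono_neutral_cong_right) auto
    ultimately have "(\<Sum>i\<in>U. \<Sum>j\<in>U. - 1 * x $ i * x $ j) = 0" unfolding square by simp
    then show "(\<forall>i\<in>neg.S. real n = real n \<or> x $ i = 0) \<and> 0 \<le> (\<Sum>i\<in>U. \<Sum>j\<in>U. - 1 * x $ i * x $ j)"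
      by (intro conjI ballI disjI1 refl) linarith
  next
    have "vec n (\<lambda>i. if i \<in> U then 1 else 0) \<bullet> (neg.A *\<^sub>v vec n (\<lambda>i. if i \<in> U then 1 else 0))
        = (\<Sum>i\<in>U. \<Sum>j\<in>U. - 1 * (if i \<in> U then 1 else 0) * (if j \<in> U then 1 else 0))"
      by (rule neg.A_form_supported) (auto simp: neg.S_def)
    also have "\<dots> = - (real (card U))\<^sup>2" unfolding square by simp
    also have "\<dots> < 0" using finU p by auto
    finally show "vec n (\<lambda>i. if i \<in> U then 1 else 0) \<bullet>
        (neg.A *\<^sub>v vec n (\<lambda>i. if i \<in> U then 1 else 0)) < (0 :: real)" .
  qed simp
  note mu = mu_ge[OF neg.A_sym_matrices neg.A_strong_arnold this neg.A_offdiag_nonpos]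
  show ?thesis using \<beta> nu xi mu pos_null neg_null by auto
qed simp

text \<open>
  The block matrix \<open>[[I, - M], [- M\<^sup>T, I]]\<close> on \<open>P \<union> Q\<close> with \<open>M = c J + \<Phi>\<close>, where \<open>J\<close> is the all-ones
  matrix and \<open>\<Phi>\<close> is the \<open>0\<close>-\<open>1\<close> matrix of the injection \<open>\<phi>\<close> from \<open>P\<close> to \<open>Q\<close>. A vector that has
  coordinate sum zero on \<open>P\<close>, is copied to \<open>Q\<close> along \<open>\<phi>\<close>, and is zero on the rest of \<open>Q\<close> lies in the
  kernel for every \<open>c\<close>. All entries of \<open>M\<close> are nonzero if \<open>c\<close> is neither \<open>0\<close> nor \<open>- 1\<close>.
\<close>

definition bipartite_core :: "real \<Rightarrow> nat set \<Rightarrow> nat set \<Rightarrow> (nat \<Rightarrow> nat) \<Rightarrow> nat \<Rightarrow> nat \<Rightarrow> real" where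
  "bipartite_core c P Q \<phi> i j =
     (if i = j then 1
      else if i \<in> P \<and> j \<in> Q then - (c + (if j = \<phi> i then 1 else 0))
      else if i \<in> Q \<and> j \<in> P then - (c + (if i = \<phi> j then 1 else 0))
      else 0)"

context
  fixes P Q :: "nat set" and \<phi> :: "nat \<Rightarrow> nat"
  assumes fin: "finite P" "finite Q" and disj: "P \<inter> Q = {}"
    and \<phi>: "inj_on \<phi> P" "\<phi> ` P \<subseteq> Q"
begin

lemma bipartite_core_row_left:
  assumes "i \<in> P"
  shows "(\<Sum>j\<in>P \<union> Q. bipartite_core c P Q \<phi> i j * f j) = f i - c * (\<Sum>j\<in>Q. f j) - f (\<phi> i)"
proof -
  have "(\<Sum>j\<in>P \<union> Q. bipartite_core c P Q \<phi> i j * f j) =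
      (\<Sum>j\<in>P. bipartite_core c P Q \<phi> i j * f j) + (\<Sum>j\<in>Q. bipartite_core c P Q \<phi> i j * f j)"
    by (rule sum.union_disjoint[OF fin disj])
  also have "(\<Sum>j\<in>P. bipartite_core c P Q \<phi> i j * f j) = (\<Sum>j\<in>P. if j = i then f j else 0)"
    using assms disj by (intro sum.cong) (auto simp: bipartite_core_def)
  also have "\<dots> = f i" using assms fin by simp
  also have "(\<Sum>j\<in>Q. bipartite_core c P Q \<phi> i j * f j) = (\<Sum>j\<in>Q. - (c * f j) - (if j = \<phi> i then f j else 0))"
    using assms disj by (intro sum.cong) (auto simp: bipartite_core_def algebra_simps)
  also have "\<dots> = - (c * (\<Sum>j\<in>Q. f j)) - f (\<phi> i)"
    using assms fin \<phi> by (auto simp: sum_subtractf sum_negf sum_distrib_left)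
  finally show ?thesis by simp
qed

lemma bipartite_core_row_right:
  assumes "i \<in> Q"
  shows "(\<Sum>j\<in>P \<union> Q. bipartite_core c P Q \<phi> i j * f j) =
    f i - c * (\<Sum>j\<in>P. f j) - (\<Sum>j | j \<in> P \<and> \<phi> j = i. f j)"
proof -
  have "(\<Sum>j\<in>P \<union> Q. bipartite_core c P Q \<phi> i j * f j) =
      (\<Sum>j\<in>P. bipartite_core c P Q \<phi> i j * f j) + (\<Sum>j\<in>Q. bipartite_core c P Q \<phi> i j * f j)"
    by (rule sum.union_disjoint[OF fin disj])
  also have "(\<Sum>j\<in>Q. bipartite_core c P Q \<phi> i j * f j) = (\<Sum>j\<in>Q. if j = i then f j else 0)"
    using assms disj by (intro sum.cong) (auto simp: bipartite_core_def)
  also have "\<dots> = f i" using assms fin by simp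
  also have "(\<Sum>j\<in>P. bipartite_core c P Q \<phi> i j * f j) =
      (\<Sum>j\<in>P. - (c * f j) - (if \<phi> j = i then f j else 0))"
    using assms disj by (intro sum.cong) (auto simp: bipartite_core_def algebra_simps)
  also have "\<dots> = - (c * (\<Sum>j\<in>P. f j)) - (\<Sum>j | j \<in> P \<and> \<phi> j = i. f j)"
    using fin by (simp add: sum_subtractf sum_negf sum_distrib_left sum.inter_filter)
  finally show ?thesis by simp
qed

text \<open>
  The matching part of \<open>M\<close> completes the squares; the rank-one part \<open>c J\<close> contributes the product of
  the coordinate sums. The inner sums have at most one term because \<open>\<phi>\<close> is injective.
\<close>

lemma bipartite_core_form:
  "(\<Sum>i\<in>P \<union> Q. \<Sum>j\<in>P \<union> Q. bipartite_core c P Q \<phi> i j * f i * f j) =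
    (\<Sum>j\<in>Q. (f j - (\<Sum>i | i \<in> P \<and> \<phi> i = j. f i))\<^sup>2) - 2 * c * (\<Sum>i\<in>P. f i) * (\<Sum>j\<in>Q. f j)"
proof -
  define g where "g j = (\<Sum>i | i \<in> P \<and> \<phi> i = j. f i)" for j
  have g_\<phi>: "g (\<phi> i) = f i" if "i \<in> P" for i
  proof -
    have "{k. k \<in> P \<and> \<phi> k = \<phi> i} = {i}" using that \<phi>(1) by (auto dest: inj_onD)
    then show ?thesis by (simp add: g_def)
  qed
  have g_out: "g j = 0" if "j \<notin> \<phi> ` P" for j
    unfolding g_def by (rule sum.neutral) (use that in auto)
  have over_P: "(\<Sum>j\<in>Q. g j * h j) = (\<Sum>i\<in>P. f i * h (\<phi> i))" for h
  proof -
    have "(\<Sum>j\<in>Q. g j * h j) = (\<Sum>j\<in>\<phi> ` P. g j * h j)"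
      using fin \<phi>(2) g_out by (intro sum.mono_neutral_right) auto
    also have "\<dots> = (\<Sum>i\<in>P. g (\<phi> i) * h (\<phi> i))" using \<phi>(1) by (simp add: sum.reindex)
    finally show ?thesis using g_\<phi> by simp
  qed
  have "(\<Sum>i\<in>P \<union> Q. \<Sum>j\<in>P \<union> Q. bipartite_core c P Q \<phi> i j * f i * f j) =
      (\<Sum>i\<in>P \<union> Q. f i * (\<Sum>j\<in>P \<union> Q. bipartite_core c P Q \<phi> i j * f j))"
    by (simp add: sum_distrib_left mult.commute mult.left_commute)
  also have "\<dots> = (\<Sum>i\<in>P. f i * (f i - c * (\<Sum>j\<in>Q. f j) - f (\<phi> i))) +
      (\<Sum>i\<in>Q. f i * (f i - c * (\<Sum>j\<in>P. f j) - g i))"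
    unfolding sum.union_disjoint[OF fin disj, of "\<lambda>i. f i * (\<Sum>j\<in>P \<union> Q. bipartite_core c P Q \<phi> i j * f j)"]
    by (simp add: bipartite_core_row_left bipartite_core_row_right g_def)
  also have "\<dots> = (\<Sum>i\<in>P. f i * f i) - (\<Sum>i\<in>P. f i * f (\<phi> i)) + (\<Sum>i\<in>Q. f i * f i) - (\<Sum>i\<in>Q. g i * f i)
      - 2 * c * (\<Sum>i\<in>P. f i) * (\<Sum>j\<in>Q. f j)"
    by (simp add: right_diff_distrib sum_subtractf mult.commute mult.left_commute flip: sum_distrib_left sum_distrib_right)
  also have "(\<Sum>i\<in>P. f i * f (\<phi> i)) = (\<Sum>j\<in>Q. g j * f j)" by (rule over_P[symmetric])
  also have "(\<Sum>i\<in>P. f i * f i) = (\<Sum>j\<in>Q. g j * g j)" using over_P[of g] g_\<phi> by simp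
  also have "(\<Sum>j\<in>Q. g j * g j) - (\<Sum>j\<in>Q. g j * f j) + (\<Sum>i\<in>Q. f i * f i) - (\<Sum>i\<in>Q. g i * f i)
      = (\<Sum>j\<in>Q. (f j - g j)\<^sup>2)"
    by (simp add: power2_eq_square algebra_simps sum.distrib sum_subtractf sum_distrib_left)
  finally show ?thesis by (simp add: g_def)
qed

lemma sum_fibres: "(\<Sum>j\<in>Q. \<Sum>i | i \<in> P \<and> \<phi> i = j. f i) = (\<Sum>i\<in>P. f i)"
  using sum.group[OF fin \<phi>(2), of f] by simp

text \<open>
  For \<open>q = card Q\<close>, \<open>c = - 1 / q\<close>, \<open>s\<close> the coordinate sum on \<open>P\<close> and \<open>t\<close> the sum of the terms
  \<open>z j\<close> that are squared in the form, Cauchy-Schwarz bounds \<open>q\<close> times the form from below by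
  \<open>t\<^sup>2 + 2 * s * (s + t) = (t + s)\<^sup>2 + s\<^sup>2\<close>.
\<close>

lemma bipartite_core_psd:
  assumes "Q \<noteq> {}"
  shows "0 \<le> (\<Sum>i\<in>P \<union> Q. \<Sum>j\<in>P \<union> Q. bipartite_core (- 1 / real (card Q)) P Q \<phi> i j * f i * f j)"
proof -
  define z where "z j = f j - (\<Sum>i | i \<in> P \<and> \<phi> i = j. f i)" for j
  define s where "s = (\<Sum>i\<in>P. f i)"
  define q where "q = real (card Q)"
  have q: "0 < q" using assms fin by (simp add: q_def card_gt_0_iff)
  have "(\<Sum>j\<in>Q. f j) = s + (\<Sum>j\<in>Q. z j)"
    unfolding z_def sum_subtractf sum_fibres s_def by simp
  then have "(\<Sum>i\<in>P \<union> Q. \<Sum>j\<in>P \<union> Q. bipartite_core (- 1 / q) P Q \<phi> i j * f i * f j) =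
      (\<Sum>j\<in>Q. (z j)\<^sup>2) + 2 / q * s * (s + (\<Sum>j\<in>Q. z j))"
    unfolding bipartite_core_form z_def[symmetric] s_def[symmetric] by simp
  also have "q * \<dots> = q * (\<Sum>j\<in>Q. (z j)\<^sup>2) + 2 * s * (s + (\<Sum>j\<in>Q. z j))"
    using q by (simp add: distrib_left)
  finally have eq: "q * (\<Sum>i\<in>P \<union> Q. \<Sum>j\<in>P \<union> Q. bipartite_core (- 1 / q) P Q \<phi> i j * f i * f j) =
      q * (\<Sum>j\<in>Q. (z j)\<^sup>2) + 2 * s * (s + (\<Sum>j\<in>Q. z j))" .
  have "(\<Sum>j\<in>Q. z j)\<^sup>2 \<le> q * (\<Sum>j\<in>Q. (z j)\<^sup>2)"
    using sum_squared_le_sum_of_squares[of z Q] by (simp add: q_def mult.commute)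
  moreover have "0 \<le> ((\<Sum>j\<in>Q. z j) + s)\<^sup>2 + s\<^sup>2" by simp
  ultimately have "0 \<le> q * (\<Sum>j\<in>Q. (z j)\<^sup>2) + 2 * s * (s + (\<Sum>j\<in>Q. z j))"
    by (simp add: power2_eq_square algebra_simps)
  then have "0 \<le> (\<Sum>i\<in>P \<union> Q. \<Sum>j\<in>P \<union> Q. bipartite_core (- 1 / q) P Q \<phi> i j * f i * f j)"
    using q unfolding eq[symmetric] zero_le_mult_iff by linarith
  then show ?thesis unfolding q_def .
qed

end

text \<open>
  The constant \<open>c = - 1 / card Q\<close> makes the core positive semidefinite. For \<open>c = 1\<close> all its
  off-diagonal entries are nonpositive, its form is a sum of squares on the hyperplane where the
  coordinates on \<open>P\<close> add up to zero, and the all-ones vector gives a negative value. The Strong Arnold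
  Property holds because a symmetric \<open>X\<close> that vanishes between \<open>P\<close> and \<open>Q\<close> has the same diagonal
  blocks as its product with the core.
\<close>

lemma bipartite_class_colin_de_verdiere:
  assumes \<beta>: "\<beta> \<in> {nu, mu, xi}" and PQ: "P \<subseteq> {..<n}" "Q \<subseteq> {..<n}" "P \<inter> Q = {}"
    and card: "card P \<le> card Q" "2 \<le> card Q"
    and complete: "\<And>i j. i \<in> P \<Longrightarrow> j \<in> Q \<Longrightarrow> {i, j} \<in> E"
    and indep: "\<And>i j. i \<in> P \<Longrightarrow> j \<in> P \<Longrightarrow> {i, j} \<notin> E" "\<And>i j. i \<in> Q \<Longrightarrow> j \<in> Q \<Longrightarrow> {i, j} \<notin> E"
    and no_cross: "\<And>i j. i \<in> P \<union> Q \<Longrightarrow> j < n \<Longrightarrow> j \<notin> P \<union> Q \<Longrightarrow> {i, j} \<notin> E"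
  shows "card P - 1 \<le> \<beta> n E"
proof (cases "P = {}")
  case False
  then obtain p where p: "p \<in> P" by blast
  have fin: "finite P" "finite Q" using PQ finite_subset by blast+
  obtain \<phi> where \<phi>: "inj_on \<phi> P" "\<phi> ` P \<subseteq> Q"
    using card_le_inj[OF fin card(1)] by blast
  note row_left = bipartite_core_row_left[OF fin PQ(3) \<phi>]
  note row_right = bipartite_core_row_right[OF fin PQ(3) \<phi>]
  have core: "core_matrix n E (P \<union> Q) (bipartite_core c P Q \<phi>) (\<lambda>_. real n)"
    if c: "c \<noteq> 0" "c \<noteq> - 1" for c
  proof
    show "P \<union> Q \<subseteq> {..<n}" using PQ by blast
    have disj: "i \<notin> Q" if "i \<in> P" for i using that PQ(3) by blast
    show "bipartite_core c P Q \<phi> i j = bipartite_core c P Q \<phi> j i" for i j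
      using disj[of i] disj[of j]
      by (cases "i \<in> P"; cases "j \<in> P"; cases "i \<in> Q"; cases "j \<in> Q"; cases "i = j")
        (simp_all add: bipartite_core_def)
    show "bipartite_core c P Q \<phi> i j \<noteq> 0 \<longleftrightarrow> {i, j} \<in> E"
      if ij: "i \<in> P \<union> Q" "j \<in> P \<union> Q" "i \<noteq> j" for i j
    proof -
      have c': "c + (if b then 1 else 0) \<noteq> 0" for b using c by (simp add: add_eq_0_iff)
      consider "i \<in> P" "j \<in> Q" | "i \<in> Q" "j \<in> P" | "i \<in> P" "j \<in> P" | "i \<in> Q" "j \<in> Q"
        using ij by blast
      then show ?thesis
      proof cases
        case 1
        then show ?thesis using complete[of i j] c'[of "j = \<phi> i"] ij(3) by (simp add: bipartite_core_def)
      next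
        case 2
        then show ?thesis using complete[of j i] c'[of "i = \<phi> j"] ij(3) disj[of j]
          by (simp add: bipartite_core_def insert_commute)
      next
        case 3
        then show ?thesis using indep(1) disj ij(3) by (simp add: bipartite_core_def)
      next
        case 4
        then show ?thesis using indep(2) disj[of i] disj[of j] ij(3) by (auto simp: bipartite_core_def)
      qed
    qed
    fix x :: "nat \<Rightarrow> nat \<Rightarrow> real" and i k
    assume edge: "\<And>i j. i \<in> P \<union> Q \<Longrightarrow> j \<in> P \<union> Q \<Longrightarrow> {i, j} \<in> E \<Longrightarrow> x i j = 0"
      and ker: "\<And>i k. i \<in> P \<union> Q \<Longrightarrow> k \<in> P \<union> Q \<Longrightarrow>
        (\<Sum>j\<in>P \<union> Q. bipartite_core c P Q \<phi> i j * x j k) = 0"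
      and ik: "i \<in> P \<union> Q" "k \<in> P \<union> Q"
    have PQ0: "x i j = 0" "x j i = 0" if "i \<in> P" "j \<in> Q" for i j
      using that edge[of i j] edge[of j i] complete[of i j] insert_commute[of i j "{}"] by auto
    show "x i k = 0"
    proof (cases "i \<in> P \<and> k \<in> P \<or> i \<in> Q \<and> k \<in> Q")
      case True
      then show ?thesis
      proof
        assume ik: "i \<in> P \<and> k \<in> P"
        then have "0 = x i k - c * (\<Sum>j\<in>Q. x j k) - x (\<phi> i) k"
          using ker[of i k] row_left[of i c "\<lambda>j. x j k"] by simp
        moreover have "(\<Sum>j\<in>Q. x j k) = 0" "x (\<phi> i) k = 0" using ik PQ0 \<phi>(2) by (auto intro!: sum.neutral)
        ultimately show ?thesis by simp
      next
        assume ik: "i \<in> Q \<and> k \<in> Q"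
        then have "0 = x i k - c * (\<Sum>j\<in>P. x j k) - (\<Sum>j | j \<in> P \<and> \<phi> j = i. x j k)"
          using ker[of i k] row_right[of i c "\<lambda>j. x j k"] by simp
        moreover have "(\<Sum>j\<in>P. x j k) = 0" "(\<Sum>j | j \<in> P \<and> \<phi> j = i. x j k) = 0"
          using ik PQ0 by (auto intro!: sum.neutral)
        ultimately show ?thesis by simp
      qed
    next
      case False
      then show ?thesis using ik PQ0 by blast
    qed
  qed (use no_cross in auto)
  have q: "real (card Q) \<ge> 2" using card(2) by simp
  interpret pos: core_matrix n E "P \<union> Q" "bipartite_core (- 1 / real (card Q)) P Q \<phi>" "\<lambda>_. real n"
    by (rule core) (use q in \<open>auto simp: field_simps\<close>)
  interpret neg: core_matrix n E "P \<union> Q" "bipartite_core 1 P Q \<phi>" "\<lambda>_. real n"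
    by (rule core) auto
  \<comment> \<open>Kernel vectors: \<open>e k + e (\<phi> k) - e p - e (\<phi> p)\<close> for the unit vectors \<open>e i\<close>.\<close>
  define f where "f k i = (if i = k \<or> i = \<phi> k then 1 else if i = p \<or> i = \<phi> p then - 1 else (0 :: real))" for k i
  have \<phi>Q: "\<phi> i \<in> Q" if "i \<in> P" for i using that \<phi>(2) by blast
  have ne: "i \<noteq> j" if "i \<in> P" "j \<in> Q" for i j using that PQ(3) by blast
  have \<phi>_eq: "\<phi> i = \<phi> j \<longleftrightarrow> i = j" if "i \<in> P" "j \<in> P" for i j
    using that \<phi>(1) by (auto dest: inj_onD)
  have f_match: "f k (\<phi> i) = f k i" if "k \<in> P" "i \<in> P" for k i
  proof -
    have "\<phi> i \<noteq> k" "\<phi> i \<noteq> p" "i \<noteq> \<phi> k" "i \<noteq> \<phi> p" using that p \<phi>Q ne by metis+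
    then show ?thesis using that p \<phi>_eq by (simp add: f_def)
  qed
  have f_out: "f k i = 0" if "k \<in> P" "i \<notin> P" "i \<notin> \<phi> ` P" for k i
    using that p by (auto simp: f_def)
  have sum_P: "(\<Sum>j\<in>P. f k j) = 0" if "k \<in> P - {p}" for k
  proof -
    have "(\<Sum>j\<in>P. f k j) = (\<Sum>j\<in>P. (if j = k then 1 else 0) + (if j = p then - 1 else 0))"
      using that ne \<phi>Q[of k] \<phi>Q[OF p] by (intro sum.cong) (auto simp: f_def)
    also have "\<dots> = 0" using that p fin by (simp add: sum.distrib)
    finally show ?thesis .
  qed
  have sum_Q: "(\<Sum>j\<in>Q. f k j) = 0" if k: "k \<in> P - {p}" for k
  proof -
    have "(\<Sum>j\<in>Q. f k j) = (\<Sum>j\<in>\<phi> ` P. f k j)"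
      using fin \<phi>(2) k PQ(3) by (intro sum.mono_neutral_right) (auto intro!: f_out)
    also have "\<dots> = (\<Sum>j\<in>P. f k (\<phi> j))" using \<phi>(1) by (simp add: sum.reindex)
    also have "\<dots> = (\<Sum>j\<in>P. f k j)" using k f_match by (intro sum.cong) auto
    finally show ?thesis using sum_P[OF k] by simp
  qed
  have ker: "(\<Sum>j\<in>P \<union> Q. bipartite_core c P Q \<phi> i j * f k j) = 0"
    if k: "k \<in> P - {p}" and i: "i \<in> P \<union> Q" for c k i
  proof (cases "i \<in> P")
    case True
    then show ?thesis using row_left[OF True] sum_Q[OF k] f_match k by simp
  next
    case False
    then have iQ: "i \<in> Q" using i by blast
    have "(\<Sum>j | j \<in> P \<and> \<phi> j = i. f k j) = f k i"
    proof (cases "i \<in> \<phi> ` P")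
      case True
      then obtain j where j: "j \<in> P" "i = \<phi> j" by blast
      then have "{j'. j' \<in> P \<and> \<phi> j' = i} = {j}" using \<phi>_eq by blast
      then show ?thesis using j f_match k by simp
    next
      case False
      then have "{j'. j' \<in> P \<and> \<phi> j' = i} = {}" by blast
      moreover have "f k i = 0" using f_out[of k i] k False \<open>i \<notin> P\<close> by blast
      ultimately show ?thesis by (simp only: sum.empty)
    qed
    then show ?thesis using row_right[OF iQ] sum_P[OF k] by simp
  qed
  have cardP: "card (P - {p}) = card P - 1" using p fin by simp
  have supp: "f k i = 0" if "k \<in> P - {p}" "i \<notin> P \<union> Q" for k i
    using that f_out[of k i] \<phi>(2) by blast
  have dual: "f k i = (if k = i then 1 else 0)" if "k \<in> P - {p}" "i \<in> P - {p}" for k i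
    using that ne \<phi>Q[of k] \<phi>Q[OF p] by (auto simp: f_def)
  have pos_null: "card P - 1 \<le> kernel_dim pos.A"
    unfolding cardP[symmetric]
    by (rule pos.A_nullity_ge[where f = f]) (use supp ker dual in auto)
  have neg_null: "card P - 1 \<le> kernel_dim neg.A"
    unfolding cardP[symmetric]
    by (rule neg.A_nullity_ge[where f = f]) (use supp ker dual in auto)
  have "Q \<noteq> {}" using card(2) by auto
  then have "pos_semidef n pos.A"
    by (intro pos.A_pos_semidef bipartite_core_psd[OF fin PQ(3) \<phi>]) simp
  note nu = nu_ge[OF pos.A_sym_matrices pos.A_strong_arnold this]
  note xi = xi_ge[OF pos.A_sym_matrices pos.A_strong_arnold]
  have "num_neg_eigenvalues neg.A = 1"
  proof (rule neg.A_one_negative[where h = "\<lambda>i. if i \<in> P then 1 else 0"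
        and z = "vec n (\<lambda>i. if i \<in> P \<union> Q then 1 else 0)"])
    fix x :: "real vec" assume "(\<Sum>i<n. (if i \<in> P then 1 else 0) * x $ i) = 0"
    moreover have "(\<Sum>i<n. (if i \<in> P then 1 else 0) * x $ i) = (\<Sum>i\<in>P. x $ i)"
      using PQ by (intro sum.mono_neutral_cong_right) auto
    ultimately have "0 \<le> (\<Sum>i\<in>P \<union> Q. \<Sum>j\<in>P \<union> Q. bipartite_core 1 P Q \<phi> i j * x $ i * x $ j)"
      unfolding bipartite_core_form[OF fin PQ(3) \<phi>] by (simp add: sum_nonneg)
    then show "(\<forall>i\<in>neg.S. real n = real n \<or> x $ i = 0) \<and>
        0 \<le> (\<Sum>i\<in>P \<union> Q. \<Sum>j\<in>P \<union> Q. bipartite_core 1 P Q \<phi> i j * x $ i * x $ j)"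
      by simp
  next
    define e :: "nat \<Rightarrow> real" where "e i = (if i \<in> P \<union> Q then 1 else 0)" for i
    have "vec n e \<bullet> (neg.A *\<^sub>v vec n e)
        = (\<Sum>i\<in>P \<union> Q. \<Sum>j\<in>P \<union> Q. bipartite_core 1 P Q \<phi> i j * e i * e j)"
      by (rule neg.A_form_supported) (auto simp: neg.S_def e_def)
    also have "\<dots> = (\<Sum>j\<in>Q. (e j - (\<Sum>i | i \<in> P \<and> \<phi> i = j. e i))\<^sup>2) - 2 * (\<Sum>i\<in>P. e i) * (\<Sum>j\<in>Q. e j)"
      unfolding bipartite_core_form[OF fin PQ(3) \<phi>] by simp
    also have "\<dots> \<le> (\<Sum>j\<in>Q. 1) - 2 * (\<Sum>i\<in>P. e i) * (\<Sum>j\<in>Q. e j)"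
    proof (intro diff_right_mono sum_mono)
      fix j assume j: "j \<in> Q"
      have "(\<Sum>i | i \<in> P \<and> \<phi> i = j. e i) = 0 \<or> (\<Sum>i | i \<in> P \<and> \<phi> i = j. e i) = 1"
      proof (cases "j \<in> \<phi> ` P")
        case True
        then obtain i where i: "i \<in> P" "j = \<phi> i" by blast
        then have "{i. i \<in> P \<and> \<phi> i = j} = {i}" using \<phi>_eq by blast
        then show ?thesis using i by (simp add: e_def)
      next
        case False
        then have "{i. i \<in> P \<and> \<phi> i = j} = {}" by blast
        then show ?thesis by (simp only: sum.empty) simp
      qed
      then show "(e j - (\<Sum>i | i \<in> P \<and> \<phi> i = j. e i))\<^sup>2 \<le> 1" using j by (auto simp: e_def)
    qed
    also have "\<dots> = real (card Q) - 2 * real (card P) * real (card Q)" by (simp add: e_def)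
    also have "\<dots> < 0"
    proof -
      have "1 \<le> real (card P)" using p fin by (simp add: Suc_le_eq card_gt_0_iff) blast
      then have "1 * real (card Q) \<le> real (card P) * real (card Q)" by (intro mult_right_mono) auto
      then show ?thesis using q by simp
    qed
    finally show "vec n (\<lambda>i. if i \<in> P \<union> Q then 1 else 0) \<bullet>
        (neg.A *\<^sub>v vec n (\<lambda>i. if i \<in> P \<union> Q then 1 else 0)) < (0 :: real)"
      unfolding e_def[abs_def] .
  qed simp
  note mu = mu_ge[OF neg.A_sym_matrices neg.A_strong_arnold this neg.A_offdiag_nonpos]
  have "kernel_dim neg.A \<le> mu n E" by (rule mu) (auto simp: bipartite_core_def)
  then show ?thesis using \<beta> nu xi pos_null neg_null by auto
qed simp


section \<open>The Hadwiger number\<close>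

text \<open>
  Branch sets are disjoint and nonempty, so their representatives are distinct vertices; and an edge
  between two branch sets determines the pair of branch sets, so distinct pairs need distinct edges.
\<close>

lemma clique_minor_facts:
  fixes m n :: nat
  assumes "minor_of (complete_graph {..<m}) ({..<n}, E)"
  shows "m \<le> n" and "finite E \<Longrightarrow> m choose 2 \<le> card E"
proof -
  obtain B where B: "\<And>x. x < m \<Longrightarrow> B x \<subseteq> {..<n} \<and> B x \<noteq> {}"
    "disjoint_family_on B {..<m}"
    "\<And>x y. x < m \<Longrightarrow> y < m \<Longrightarrow> x \<noteq> y \<Longrightarrow> \<exists>u\<in>B x. \<exists>v\<in>B y. {u, v} \<in> E"
  proof -
    from assms obtain B where B: "\<forall>x\<in>{..<m}. B x \<subseteq> {..<n} \<and> connected_on E (B x)"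
      "disjoint_family_on B {..<m}"
      "\<forall>x\<in>{..<m}. \<forall>y\<in>{..<m}. {x, y} \<in> all_edges {..<m} \<longrightarrow> (\<exists>u\<in>B x. \<exists>v\<in>B y. {u, v} \<in> E)"
      unfolding minor_of_def complete_graph_def fst_conv snd_conv by blast
    show thesis
    proof (rule that[OF _ B(2)])
      show "B x \<subseteq> {..<n} \<and> B x \<noteq> {}" if "x < m" for x using B(1) that by (auto simp: connected_on_def)
      show "\<exists>u\<in>B x. \<exists>v\<in>B y. {u, v} \<in> E" if "x < m" "y < m" "x \<noteq> y" for x y
        using B(3) that by (auto simp: all_edges_def)
    qed
  qed
  have owner: "x = y" if "x < m" "y < m" "u \<in> B x" "u \<in> B y" for x y u
    using that B(2) unfolding disjoint_family_on_def by blast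
  have "\<forall>x. \<exists>u. x < m \<longrightarrow> u \<in> B x" using B(1) by blast
  then obtain f where f: "\<And>x. x < m \<Longrightarrow> f x \<in> B x" by metis
  have "inj_on f {..<m}" using f owner by (metis inj_onI lessThan_iff)
  moreover have "f ` {..<m} \<subseteq> {..<n}" using f B(1) by blast
  ultimately show "m \<le> n" using card_inj_on_le[of f "{..<m}" "{..<n}"] by simp
  assume finE: "finite E"
  have "\<forall>e. \<exists>g. e \<in> all_edges {..<m} \<longrightarrow> g \<in> E \<and>
      (\<exists>x y u v. x < m \<and> y < m \<and> e = {x, y} \<and> u \<in> B x \<and> v \<in> B y \<and> g = {u, v})"
  proof
    fix e
    show "\<exists>g. e \<in> all_edges {..<m} \<longrightarrow> g \<in> E \<and>
      (\<exists>x y u v. x < m \<and> y < m \<and> e = {x, y} \<and> u \<in> B x \<and> v \<in> B y \<and> g = {u, v})"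
    proof (cases "e \<in> all_edges {..<m}")
      case True
      then obtain x y where xy: "e = {x, y}" "x \<noteq> y" "x < m" "y < m"
        by (auto simp: all_edges_def card_2_iff)
      then show ?thesis using B(3)[OF xy(3,4,2)] by blast
    qed blast
  qed
  then obtain g where g: "\<And>e. e \<in> all_edges {..<m} \<Longrightarrow> g e \<in> E \<and>
      (\<exists>x y u v. x < m \<and> y < m \<and> e = {x, y} \<and> u \<in> B x \<and> v \<in> B y \<and> g e = {u, v})"
    by metis
  have "inj_on g (all_edges {..<m})"
  proof (rule inj_onI)
    fix e e' assume e: "e \<in> all_edges {..<m}" and e': "e' \<in> all_edges {..<m}" and eq: "g e = g e'"
    obtain x y u v where 1: "x < m" "y < m" "e = {x, y}" "u \<in> B x" "v \<in> B y" "g e = {u, v}"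
      using g[OF e] by blast
    obtain x' y' u' v' where 2: "x' < m" "y' < m" "e' = {x', y'}" "u' \<in> B x'" "v' \<in> B y'" "g e' = {u', v'}"
      using g[OF e'] by blast
    have "{u, v} = {u', v'}" using eq 1(6) 2(6) by simp
    then consider "u = u'" "v = v'" | "u = v'" "v = u'" by (auto simp: doubleton_eq_iff)
    then show "e = e'"
    proof cases
      case 1
      then show ?thesis using owner \<open>x < m\<close> \<open>y < m\<close> 2 \<open>e = {x, y}\<close> \<open>u \<in> B x\<close> \<open>v \<in> B y\<close> by metis
    next
      case 2
      then have "x = y'" "y = x'"
        using owner \<open>x < m\<close> \<open>y < m\<close> \<open>x' < m\<close> \<open>y' < m\<close> \<open>u \<in> B x\<close> \<open>v \<in> B y\<close> \<open>u' \<in> B x'\<close> \<open>v' \<in> B y'\<close>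
        by blast+
      then show ?thesis using \<open>e = {x, y}\<close> \<open>e' = {x', y'}\<close> by blast
    qed
  qed
  moreover have "g ` all_edges {..<m} \<subseteq> E" using g by blast
  ultimately have "card (all_edges {..<m}) \<le> card E" using finE card_inj_on_le by blast
  then show "m choose 2 \<le> card E" using n_subsets[of "{..<m}" 2] by (simp add: all_edges_def)
qed

lemma finite_clique_minors: "finite {m :: nat. minor_of (complete_graph {..<m}) ({..<n :: nat}, E)}"
  by (rule finite_subset[of _ "{..n}"]) (auto dest: clique_minor_facts(1))

lemma hadwiger_ge:
  "minor_of (complete_graph {..<m}) ({..<n :: nat}, E) \<Longrightarrow> m \<le> hadwiger n E"
  unfolding hadwiger_def by (rule Max_ge[OF finite_clique_minors]) simp

theorem hadwiger_edge_bound: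
  assumes E: "E \<subseteq> all_edges {..<n}"
  shows "(hadwiger n E)\<^sup>2 \<le> 2 * card E + 2 * n"
proof -
  have "minor_of (complete_graph {..<0 :: nat}) ({..<n}, E)"
    by (auto simp: minor_of_def complete_graph_def disjoint_family_on_def)
  then have "{m :: nat. minor_of (complete_graph {..<m}) ({..<n}, E)} \<noteq> {}" by blast
  from Max_in[OF finite_clique_minors this]
  have minor: "minor_of (complete_graph {..<hadwiger n E}) ({..<n}, E)" by (simp add: hadwiger_def)
  have "finite E" using E by (rule finite_subset) (simp add: all_edges_def)
  define h where "h = hadwiger n E"
  have "h \<le> n" "h choose 2 \<le> card E"
    using clique_minor_facts[OF minor] \<open>finite E\<close> by (auto simp: h_def)
  moreover have "h\<^sup>2 = 2 * (h choose 2) + h"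
    by (cases h) (auto simp: choose_two power2_eq_square)
  ultimately show ?thesis unfolding h_def by linarith
qed

lemma clique_class_hadwiger:
  assumes U: "U \<subseteq> {..<n}"
    and clique: "\<And>i j. i \<in> U \<Longrightarrow> j \<in> U \<Longrightarrow> i \<noteq> j \<Longrightarrow> {i, j} \<in> E"
  shows "card U \<le> hadwiger n E"
proof (rule hadwiger_ge)
  have "finite U" using U finite_subset by blast
  then obtain f where f: "bij_betw f {..<card U} U"
    using ex_bij_betw_nat_finite[of U] by (auto simp: atLeast0LessThan)
  then have inU: "f x \<in> U" if "x < card U" for x using that by (auto simp: bij_betw_def)
  have inj: "f x \<noteq> f y" if "x < card U" "y < card U" "x \<noteq> y" for x y
    using f that by (auto simp: bij_betw_def inj_on_def)
  show "minor_of (complete_graph {..<card U}) ({..<n}, E)"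
    unfolding minor_of_def
  proof (intro exI[of _ "\<lambda>x. {f x}"] conjI ballI impI)
    fix x y assume "x \<in> fst (complete_graph {..<card U})" "y \<in> fst (complete_graph {..<card U})"
      "{x, y} \<in> snd (complete_graph {..<card U})"
    then have "x < card U" "y < card U" "x \<noteq> y" by (auto simp: complete_graph_def all_edges_def)
    then show "\<exists>u\<in>{f x}. \<exists>v\<in>{f y}. {u, v} \<in> snd ({..<n}, E)" using clique inU inj by simp
  qed (use inU inj U in \<open>auto simp: complete_graph_def connected_on_def disjoint_family_on_def\<close>)
qed

text \<open>
  Contracting the edges of a matching of \<open>P\<close> into \<open>Q\<close> makes their end points in \<open>P\<close> pairwise adjacent.
\<close>

lemma bipartite_class_hadwiger:
  assumes PQ: "P \<subseteq> {..<n}" "Q \<subseteq> {..<n}" "P \<inter> Q = {}" and card: "card P \<le> card Q"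
    and complete: "\<And>i j. i \<in> P \<Longrightarrow> j \<in> Q \<Longrightarrow> {i, j} \<in> E"
  shows "card P \<le> hadwiger n E"
proof (rule hadwiger_ge)
  have fin: "finite P" "finite Q" using PQ finite_subset by blast+
  obtain \<phi> where \<phi>: "inj_on \<phi> P" "\<phi> ` P \<subseteq> Q" using card_le_inj[OF fin card] by blast
  obtain f where f: "bij_betw f {..<card P} P"
    using ex_bij_betw_nat_finite[OF fin(1)] by (auto simp: atLeast0LessThan)
  then have inP: "f x \<in> P" if "x < card P" for x using that by (auto simp: bij_betw_def)
  then have inQ: "\<phi> (f x) \<in> Q" if "x < card P" for x using that \<phi>(2) by blast
  have inj: "f x \<noteq> f y" if "x < card P" "y < card P" "x \<noteq> y" for x y
    using f that by (auto simp: bij_betw_def inj_on_def)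
  then have inj': "\<phi> (f x) \<noteq> \<phi> (f y)" if "x < card P" "y < card P" "x \<noteq> y" for x y
    using that \<phi>(1) inP by (auto dest: inj_onD)
  have ne: "f x \<noteq> \<phi> (f y)" if "x < card P" "y < card P" for x y
    using inP[OF that(1)] inQ[OF that(2)] PQ(3) by (metis disjoint_iff)
  show "minor_of (complete_graph {..<card P}) ({..<n}, E)"
    unfolding minor_of_def
  proof (intro exI[of _ "\<lambda>x. {f x, \<phi> (f x)}"] conjI ballI impI)
    fix x y assume "x \<in> fst (complete_graph {..<card P})" "y \<in> fst (complete_graph {..<card P})"
    then show "\<exists>u\<in>{f x, \<phi> (f x)}. \<exists>v\<in>{f y, \<phi> (f y)}. {u, v} \<in> snd ({..<n}, E)"
      using complete inP inQ by (auto simp: complete_graph_def)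
  next
    fix x assume "x \<in> fst (complete_graph {..<card P})"
    then have x: "x < card P" by (simp add: complete_graph_def)
    have edge: "{f x, \<phi> (f x)} \<in> E" using complete inP[OF x] inQ[OF x] by blast
    show "connected_on (snd ({..<n}, E)) {f x, \<phi> (f x)}"
      unfolding connected_on_def
    proof (intro conjI ballI)
      fix u v assume "u \<in> {f x, \<phi> (f x)}" "v \<in> {f x, \<phi> (f x)}"
      then have "u = v \<or> (u, v) \<in> {(a, b). a \<in> {f x, \<phi> (f x)} \<and> b \<in> {f x, \<phi> (f x)} \<and> {a, b} \<in> snd ({..<n}, E)}"
        using edge by (auto simp: insert_commute)
      then show "(u, v) \<in> {(a, b). a \<in> {f x, \<phi> (f x)} \<and> b \<in> {f x, \<phi> (f x)} \<and> {a, b} \<in> snd ({..<n}, E)}\<^sup>*"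
        by blast
    qed simp
    show "{f x, \<phi> (f x)} \<subseteq> fst ({..<n}, E)" using inP[OF x] inQ[OF x] PQ by auto
  next
    show "disjoint_family_on (\<lambda>x. {f x, \<phi> (f x)}) (fst (complete_graph {..<card P}))"
      unfolding disjoint_family_on_def complete_graph_def
      using inj inj' ne by (auto simp: eq_commute)
  qed
qed


section \<open>Decompositions into cliques and complete bipartite graphs\<close>

text \<open>
  Cut the vertices into \<open>s\<close> intervals of length \<open>q\<close>, with the remaining vertices added to the last
  one. The \<open>s choose 2\<close> pairs of different intervals are fewer than \<open>r\<close> and each gets a colour of its
  own for the edges between the two intervals. The remaining colours, at most \<open>s\<close> in number, go to the
  edges inside the intervals; surplus intervals share the last colour, which does no harm because the
  resulting class is a disjoint union of cliques.
\<close>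

lemma clique_bipartite_decomposition:
  assumes s: "s * (s - 1) < 2 * r" "2 * r \<le> s * (s + 1)" and q: "q = n div s" "2 \<le> q"
  shows "\<exists>E. decomposition r n E \<and> (\<forall>i\<in>{1..r}.
    (\<exists>U\<subseteq>{..<n}. q \<le> card U \<and> (\<forall>x\<in>U. \<forall>y\<in>U. x \<noteq> y \<longrightarrow> {x, y} \<in> E i) \<and>
       (\<forall>x\<in>U. \<forall>y<n. y \<notin> U \<longrightarrow> {x, y} \<notin> E i)) \<or>
    (\<exists>P Q. P \<subseteq> {..<n} \<and> Q \<subseteq> {..<n} \<and> P \<inter> Q = {} \<and> q \<le> card P \<and> card P \<le> card Q \<and>
       (\<forall>x\<in>P. \<forall>y\<in>Q. {x, y} \<in> E i) \<and> (\<forall>x\<in>P. \<forall>y\<in>P. {x, y} \<notin> E i) \<and>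
       (\<forall>x\<in>Q. \<forall>y\<in>Q. {x, y} \<notin> E i) \<and>
       (\<forall>x\<in>P \<union> Q. \<forall>y<n. y \<notin> P \<union> Q \<longrightarrow> {x, y} \<notin> E i)))"
proof -
  have s0: "0 < s" using q by (cases s) auto
  define bl where "bl v = min (v div q) (s - 1)" for v :: nat
  define V where "V a = {v. v < n \<and> bl v = a}" for a
  have bl_less: "bl v < s" for v using s0 by (simp add: bl_def)
  have V_sub: "V a \<subseteq> {..<n}" for a by (auto simp: V_def)
  have cardV: "q \<le> card (V a)" if a: "a < s" for a
  proof -
    have "{a * q..<a * q + q} \<subseteq> V a"
    proof
      fix v assume v: "v \<in> {a * q..<a * q + q}"
      then have "v div q = a" using q by (intro div_nat_eqI) (auto simp: mult.commute)
      moreover have "a * q + q \<le> n"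
      proof -
        have "(a + 1) * q \<le> s * q" using a by (intro mult_right_mono) auto
        also have "\<dots> \<le> n" using q(1) by simp
        finally show ?thesis by simp
      qed
      ultimately show "v \<in> V a" using v a by (simp add: V_def bl_def)
    qed
    then have "card {a * q..<a * q + q} \<le> card (V a)"
      using V_sub[of a] by (intro card_mono) (auto intro: finite_subset)
    then show ?thesis by simp
  qed
  define npairs where "npairs = s choose 2"
  define pairs where "pairs = {T. T \<subseteq> {..<s} \<and> card T = 2}"
  have "2 * npairs = s * (s - 1)" unfolding npairs_def by (cases s) (auto simp: choose_two)
  then have npairs: "npairs < r" "r \<le> npairs + s" using s s0
    by (auto simp: algebra_simps diff_mult_distrib2)
  have "card pairs = npairs" unfolding pairs_def npairs_def by (simp add: n_subsets)
  moreover have "finite pairs" unfolding pairs_def by simp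
  ultimately obtain h where h: "bij_betw h pairs {1..npairs}"
    using ex_bij_betw_finite_nat by (metis finite_same_card_bij finite_atLeastAtMost card_atLeastAtMost diff_Suc_1)
  \<comment> \<open>The colour of an edge depends on the set \<open>T\<close> of intervals that it meets, which has one or two elements.\<close>
  define col where "col T = (if card T = 2 then h T else min (npairs + 1 + the_elem T) r)" for T
  define E where "E i = {e \<in> all_edges {..<n}. col (bl ` e) = i}" for i
  have col_pair: "col T \<in> {1..npairs}" if "T \<in> pairs" for T
    using that h by (auto simp: col_def pairs_def bij_betw_def)
  have col_single: "col {a} = min (npairs + 1 + a) r" for a by (simp add: col_def)
  have pair: "{a, b} \<in> pairs" if "a \<noteq> b" "a < s" "b < s" for a b
    using that by (simp add: pairs_def)
  have mem_E: "{x, y} \<in> E i \<longleftrightarrow> x \<noteq> y \<and> col {bl x, bl y} = i" if "x < n" "y < n" for x y i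
    using that by (cases "x = y") (auto simp: E_def all_edges_def)
  have dec: "decomposition r n E"
    unfolding E_def
  proof (rule decomposition_of_colouring)
    fix e assume "e \<in> all_edges {..<n}"
    then obtain x y where "e = {x, y}" by (auto simp: all_edges_def card_2_iff)
    then have img: "bl ` e = {bl x, bl y}" by simp
    show "col (bl ` e) \<in> {1..r}"
    proof (cases "bl x = bl y")
      case True
      then show ?thesis unfolding img using npairs by (simp add: col_single)
    next
      case False
      then show ?thesis unfolding img using col_pair[OF pair[OF False bl_less bl_less]] npairs by simp
    qed
  qed
  show ?thesis
  proof (intro exI[of _ E] conjI dec ballI)
    fix i assume i: "i \<in> {1..r}"
    show "(\<exists>U\<subseteq>{..<n}. q \<le> card U \<and> (\<forall>x\<in>U. \<forall>y\<in>U. x \<noteq> y \<longrightarrow> {x, y} \<in> E i) \<and>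
       (\<forall>x\<in>U. \<forall>y<n. y \<notin> U \<longrightarrow> {x, y} \<notin> E i)) \<or>
    (\<exists>P Q. P \<subseteq> {..<n} \<and> Q \<subseteq> {..<n} \<and> P \<inter> Q = {} \<and> q \<le> card P \<and> card P \<le> card Q \<and>
       (\<forall>x\<in>P. \<forall>y\<in>Q. {x, y} \<in> E i) \<and> (\<forall>x\<in>P. \<forall>y\<in>P. {x, y} \<notin> E i) \<and>
       (\<forall>x\<in>Q. \<forall>y\<in>Q. {x, y} \<notin> E i) \<and>
       (\<forall>x\<in>P \<union> Q. \<forall>y<n. y \<notin> P \<union> Q \<longrightarrow> {x, y} \<notin> E i))"
      (is "?clique \<or> ?bipartite")
    proof (cases "i \<le> npairs")
      case False
      define a where "a = i - npairs - 1"
      have a: "a < s" "npairs + 1 + a = i" "i \<le> r" using False i npairs by (auto simp: a_def)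
      have "{x, y} \<in> E i" if "x \<in> V a" "y \<in> V a" "x \<noteq> y" for x y
        using that a by (simp add: V_def mem_E col_single)
      moreover have "{x, y} \<notin> E i" if "x \<in> V a" "y < n" "y \<notin> V a" for x y
      proof
        assume "{x, y} \<in> E i"
        moreover have "bl x \<noteq> bl y" using that by (auto simp: V_def)
        then have "col {bl x, bl y} \<le> npairs" using col_pair[OF pair[OF _ bl_less bl_less]] by simp
        ultimately show False using that a mem_E[of x y i] by (simp add: V_def)
      qed
      ultimately have ?clique using V_sub[of a] cardV[OF a(1)] by blast
      then show ?thesis ..
    next
      case True
      then have "i \<in> h ` pairs" using h i by (auto simp: bij_betw_def)
      then obtain T where T: "T \<in> pairs" "i = h T" by blast
      then obtain a b where ab: "T = {a, b}" "a \<noteq> b" by (auto simp: pairs_def card_2_iff)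
      have less: "a < s" "b < s" using T ab by (auto simp: pairs_def)
      have colT: "col {x, y} = i \<longleftrightarrow> {x, y} = {a, b}" if "x < s" "y < s" for x y
      proof (cases "x = y")
        case True
        then show ?thesis using \<open>i \<le> npairs\<close> npairs ab(2) by (auto simp: col_single doubleton_eq_iff)
      next
        case False
        then have "{x, y} \<in> pairs" using pair that by simp
        moreover have "col {x, y} = h {x, y}" using False by (simp add: col_def)
        ultimately show ?thesis using h T ab by (auto simp: bij_betw_def dest: inj_onD)
      qed
      have bip: ?bipartite if c: "a' \<noteq> b'" "{a', b'} = {a, b}" "card (V a') \<le> card (V b')" for a' b'
      proof (rule exI[of _ "V a'"], rule exI[of _ "V b'"], intro conjI)
        have "a' < s" using c(2) less by (auto simp: doubleton_eq_iff)
        then show "q \<le> card (V a')" by (rule cardV)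
        show "V a' \<inter> V b' = {}" using c(1) by (auto simp: V_def)
        have mem: "{x, y} \<in> E i \<longleftrightarrow> x \<noteq> y \<and> {bl x, bl y} = {a', b'}" if "x < n" "y < n" for x y
          using that by (simp add: mem_E colT bl_less c(2))
        show "\<forall>x\<in>V a'. \<forall>y\<in>V b'. {x, y} \<in> E i" using c(1) by (auto simp: V_def mem)
        show "\<forall>x\<in>V a'. \<forall>y\<in>V a'. {x, y} \<notin> E i" "\<forall>x\<in>V b'. \<forall>y\<in>V b'. {x, y} \<notin> E i"
          using c(1) by (auto simp: V_def mem doubleton_eq_iff)
        show "\<forall>x\<in>V a' \<union> V b'. \<forall>y<n. y \<notin> V a' \<union> V b' \<longrightarrow> {x, y} \<notin> E i"
          by (auto simp: V_def mem doubleton_eq_iff)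
      qed (use V_sub c(3) in auto)
      have ?bipartite
      proof (cases "card (V a) \<le> card (V b)")
        case True
        then show ?thesis using bip[of a b] ab(2) by simp
      next
        case False
        then show ?thesis using bip[of b a] ab(2) by (simp add: insert_commute)
      qed
      then show ?thesis ..
    qed
  qed
qed

lemma beta_times_lower:
  assumes s: "s * (s - 1) < 2 * r" "2 * r \<le> s * (s + 1)" and n: "2 * s \<le> n"
    and \<beta>: "\<beta> \<in> {hadwiger, nu, mu, xi}"
  shows "(n div s - 1) ^ r \<le> beta_times \<beta> r n"
proof (cases "s = 0")
  case True
  then show ?thesis using s by simp
next
  case False
  then have q: "2 \<le> n div s" using n by (simp add: less_eq_div_iff_mult_less_eq)
  obtain E where dec: "decomposition r n E" and
    E: "\<And>i. i \<in> {1..r} \<Longrightarrow>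
    (\<exists>U\<subseteq>{..<n}. n div s \<le> card U \<and> (\<forall>x\<in>U. \<forall>y\<in>U. x \<noteq> y \<longrightarrow> {x, y} \<in> E i) \<and>
       (\<forall>x\<in>U. \<forall>y<n. y \<notin> U \<longrightarrow> {x, y} \<notin> E i)) \<or>
    (\<exists>P Q. P \<subseteq> {..<n} \<and> Q \<subseteq> {..<n} \<and> P \<inter> Q = {} \<and> n div s \<le> card P \<and> card P \<le> card Q \<and>
       (\<forall>x\<in>P. \<forall>y\<in>Q. {x, y} \<in> E i) \<and> (\<forall>x\<in>P. \<forall>y\<in>P. {x, y} \<notin> E i) \<and>
       (\<forall>x\<in>Q. \<forall>y\<in>Q. {x, y} \<notin> E i) \<and>
       (\<forall>x\<in>P \<union> Q. \<forall>y<n. y \<notin> P \<union> Q \<longrightarrow> {x, y} \<notin> E i))"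
    using clique_bipartite_decomposition[OF s refl q] by blast
  show ?thesis
  proof (rule beta_times_ge[OF dec])
    fix i assume "i \<in> {1..r}"
    from E[OF this] show "n div s - 1 \<le> \<beta> n (E i)"
    proof (elim disjE exE conjE)
      fix U assume U: "U \<subseteq> {..<n}" "n div s \<le> card U"
        "\<forall>x\<in>U. \<forall>y\<in>U. x \<noteq> y \<longrightarrow> {x, y} \<in> E i" "\<forall>x\<in>U. \<forall>y<n. y \<notin> U \<longrightarrow> {x, y} \<notin> E i"
      have "card U \<le> hadwiger n (E i)" by (rule clique_class_hadwiger) (use U in auto)
      moreover have "card U - 1 \<le> \<beta> n (E i)" if "\<beta> \<in> {nu, mu, xi}"
        by (rule clique_class_colin_de_verdiere[OF that]) (use U in auto)
      ultimately have "card U - 1 \<le> \<beta> n (E i)" using \<beta> by auto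
      then show ?thesis using U(2) by simp
    next
      fix P Q assume PQ: "P \<subseteq> {..<n}" "Q \<subseteq> {..<n}" "P \<inter> Q = {}" "n div s \<le> card P" "card P \<le> card Q"
        "\<forall>x\<in>P. \<forall>y\<in>Q. {x, y} \<in> E i" "\<forall>x\<in>P. \<forall>y\<in>P. {x, y} \<notin> E i" "\<forall>x\<in>Q. \<forall>y\<in>Q. {x, y} \<notin> E i"
        "\<forall>x\<in>P \<union> Q. \<forall>y<n. y \<notin> P \<union> Q \<longrightarrow> {x, y} \<notin> E i"
      have "card P \<le> hadwiger n (E i)" by (rule bipartite_class_hadwiger[of P n Q]) (use PQ in auto)
      moreover have "card P - 1 \<le> \<beta> n (E i)" if "\<beta> \<in> {nu, mu, xi}"
        by (rule bipartite_class_colin_de_verdiere[OF that PQ(1-3)]) (use PQ q in auto)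
      ultimately have "card P - 1 \<le> \<beta> n (E i)" using \<beta> by auto
      then show ?thesis using PQ(4) by simp
    qed
  qed
qed


section \<open>Asymptotics\<close>

lemma prod_le_mean_power:
  fixes b :: "'i \<Rightarrow> real"
  assumes I: "finite I" "I \<noteq> {}" and b: "\<And>i. i \<in> I \<Longrightarrow> 0 \<le> b i"
  shows "(\<Prod>i\<in>I. b i) \<le> ((\<Sum>i\<in>I. b i) / real (card I)) ^ card I"
proof -
  define p where "p = (\<Prod>i\<in>I. b i)"
  have p0: "0 \<le> p" unfolding p_def using b by (rule prod_nonneg)
  have c: "0 < card I" using I by (simp add: card_gt_0_iff)
  have "p = (p powr (1 / real (card I))) ^ card I"
  proof (cases "p = 0")
    case True
    then show ?thesis using c by simp
  next
    case False
    then have "0 < p" using p0 by simp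
    then have "(p powr (1 / real (card I))) ^ card I = (p powr (1 / real (card I))) powr real (card I)"
      by (simp add: powr_realpow)
    also have "\<dots> = p" using c \<open>0 < p\<close> by (simp add: powr_powr)
    finally show ?thesis ..
  qed
  also have "\<dots> \<le> (\<Sum>i\<in>I. b i / real (card I)) ^ card I"
    unfolding p_def using arith_geom_mean[OF I b] by (intro power_mono) auto
  finally show ?thesis by (simp add: p_def sum_divide_distrib)
qed

text \<open>
  The arithmetic-geometric mean inequality for the squares of the \<open>r\<close> parameters, whose sum is bounded
  because the edge numbers add up to \<open>n choose 2\<close>.
\<close>

lemma beta_times_upper:
  assumes r: "0 < r" and bound: "\<And>E. E \<subseteq> all_edges {..<n} \<Longrightarrow> (\<beta> n E)\<^sup>2 \<le> 2 * card E + 2 * n"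
  shows "(real (beta_times \<beta> r n))\<^sup>2 \<le> (((real n)\<^sup>2 + 2 * real r * real n) / real r) ^ r"
proof -
  obtain E where E: "decomposition r n E" "beta_times \<beta> r n = (\<Prod>i=1..r. \<beta> n (E i))"
    using beta_times_attained[of r] r by force
  have "(\<Sum>i=1..r. card (E i)) = card (\<Union>i\<in>{1..r}. E i)"
    using E(1) finite_subset[OF decomposition_subset[OF E(1)] finite_all_edges]
    by (intro card_UN_disjoint'[symmetric]) (auto simp: decomposition_def)
  also have "\<dots> = n choose 2"
    using E(1) n_subsets[of "{..<n}" 2] by (simp add: decomposition_def all_edges_def)
  finally have sum_E: "(\<Sum>i=1..r. card (E i)) = n choose 2" .
  have "2 * (n choose 2) \<le> n\<^sup>2" by (cases n) (auto simp: choose_two power2_eq_square)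
  moreover have "(\<Sum>i=1..r. 2 * card (E i) + 2 * n) = 2 * (\<Sum>i=1..r. card (E i)) + 2 * r * n"
    by (simp add: sum.distrib sum_distrib_left)
  ultimately have edges: "(\<Sum>i=1..r. 2 * card (E i) + 2 * n) \<le> n\<^sup>2 + 2 * r * n"
    unfolding sum_E by simp
  have "(\<Sum>i=1..r. (\<beta> n (E i))\<^sup>2) \<le> (\<Sum>i=1..r. 2 * card (E i) + 2 * n)"
    using bound decomposition_subset[OF E(1)] by (intro sum_mono) auto
  then have "(\<Sum>i=1..r. (\<beta> n (E i))\<^sup>2) \<le> n\<^sup>2 + 2 * r * n" using edges by simp
  then have "real (\<Sum>i=1..r. (\<beta> n (E i))\<^sup>2) \<le> real (n\<^sup>2 + 2 * r * n)" by (simp only: of_nat_le_iff)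
  then have squares: "(\<Sum>i=1..r. (real (\<beta> n (E i)))\<^sup>2) \<le> (real n)\<^sup>2 + 2 * real r * real n" by simp
  have "(real (beta_times \<beta> r n))\<^sup>2 = (\<Prod>i=1..r. (real (\<beta> n (E i)))\<^sup>2)"
    unfolding E(2) by (simp add: prod_power_distrib)
  also have "\<dots> \<le> ((\<Sum>i=1..r. (real (\<beta> n (E i)))\<^sup>2) / real r) ^ r"
    using prod_le_mean_power[of "{1..r}" "\<lambda>i. (real (\<beta> n (E i)))\<^sup>2"] r by simp
  also have "\<dots> \<le> (((real n)\<^sup>2 + 2 * real r * real n) / real r) ^ r"
    using squares by (intro power_mono divide_right_mono divide_nonneg_nonneg sum_nonneg) auto
  finally show ?thesis .
qed

text \<open>
  The number of intervals is the least \<open>s\<close> with \<open>2 * r \<le> s * (s + 1)\<close>; solving the quadratic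
  inequality for \<open>s\<close> gives the rounded-up square root in the statement. The error terms are the
  differences between the explicit bounds \<open>lo\<close> and \<open>hi\<close> and their limits.
\<close>

theorem minor_type_asymptotics:
  assumes r: "2 \<le> r" and \<beta>: "\<beta> \<in> {hadwiger, nu, mu, xi}"
  defines "L \<equiv> real_of_int \<lceil>sqrt (2 * real r + 1 / 4) - 1 / 2\<rceil> powi (- int r)"
    and "H \<equiv> sqrt (real r) powi (- int r)"
  shows "(\<lambda>n. real (beta_times \<beta> r n)) \<in> \<Theta>(\<lambda>n. real n ^ r)"
    and "\<exists>e1 \<in> o(\<lambda>_. 1). \<exists>e2 \<in> o(\<lambda>_. 1). \<forall>\<^sub>F n in sequentially.
      L - e1 n \<le> real (beta_times \<beta> r n) / real n ^ r \<and>
      real (beta_times \<beta> r n) / real n ^ r \<le> H + e2 n"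
proof -
  define t where "t = sqrt (2 * real r + 1 / 4) - 1 / 2"
  define s where "s = nat \<lceil>t\<rceil>"
  have "1 < sqrt (2 * real r + 1 / 4)" using r by (intro real_less_rsqrt) auto
  then have t: "1 / 2 < t" by (simp add: t_def)
  then have s1: "1 \<le> s" and s_ceil: "real_of_int \<lceil>t\<rceil> = real s" unfolding s_def by linarith+
  have "t \<le> real s" "real s - 1 < t" using s_ceil by linarith+
  have t2: "(t + 1 / 2)\<^sup>2 = 2 * real r + 1 / 4" by (simp add: t_def)
  have "(t + 1 / 2)\<^sup>2 \<le> (real s + 1 / 2)\<^sup>2" using \<open>t \<le> real s\<close> t by (intro power_mono) auto
  then have "2 * real r \<le> real s * (real s + 1)" unfolding t2 by (simp add: power2_eq_square algebra_simps)
  then have "real (2 * r) \<le> real (s * (s + 1))" by (simp add: algebra_simps)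
  then have up: "2 * r \<le> s * (s + 1)" by (simp only: of_nat_le_iff)
  have "(real s - 1 / 2)\<^sup>2 < (t + 1 / 2)\<^sup>2"
    using \<open>real s - 1 < t\<close> s1 by (intro power_strict_mono) auto
  then have "real s * (real s - 1) < 2 * real r" unfolding t2 by (simp add: power2_eq_square algebra_simps)
  then have "real (s * (s - 1)) < real (2 * r)" using s1 by (simp add: of_nat_diff)
  then have low: "s * (s - 1) < 2 * r" by (simp only: of_nat_less_iff)
  define lo where "lo n = (1 / real s - 2 / real n) ^ r" for n
  define hi where "hi n = sqrt (((1 + 2 * real r / real n) / real r) ^ r)" for n
  have L: "L = (1 / real s) ^ r"
    unfolding L_def t_def[symmetric] s_ceil by (simp add: power_int_minus power_one_over inverse_eq_divide)
  have Hr: "H = sqrt ((1 / real r) ^ r)"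
    unfolding H_def by (simp add: power_int_minus real_sqrt_power real_sqrt_divide power_one_over inverse_eq_divide)
  have lo_lim: "lo \<longlonglongrightarrow> L"
  proof -
    have "(\<lambda>n. 2 / real n) \<longlonglongrightarrow> 0" by real_asymp
    then have "lo \<longlonglongrightarrow> (1 / real s - 0) ^ r" unfolding lo_def[abs_def] by (intro tendsto_intros)
    then show ?thesis by (simp add: L)
  qed
  have hi_lim: "hi \<longlonglongrightarrow> H"
  proof -
    have "(\<lambda>n. 2 * real r / real n) \<longlonglongrightarrow> 0" by real_asymp
    then have "hi \<longlonglongrightarrow> sqrt (((1 + 0) / real r) ^ r)"
      unfolding hi_def[abs_def] using r by (intro tendsto_intros) auto
    then show ?thesis by (simp add: Hr)
  qed
  have lower: "\<forall>\<^sub>F n in sequentially. lo n \<le> real (beta_times \<beta> r n) / real n ^ r"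
    using eventually_ge_at_top[of "2 * s"] eventually_gt_at_top[of 0]
  proof eventually_elim
    case (elim n)
    have "2 * real s \<le> real n" using elim(1) by (metis of_nat_le_iff of_nat_mult of_nat_numeral)
    then have pos: "0 \<le> 1 / real s - 2 / real n" using s1 elim(2) by (simp add: field_simps)
    have "real n < real s * (real (n div s) + 1)"
    proof -
      have "n = s * (n div s) + n mod s" by simp
      moreover have "n mod s < s" using s1 by simp
      ultimately have "n < s * (n div s) + s" by linarith
      then have "real n < real (s * (n div s) + s)" by (simp only: of_nat_less_iff)
      then show ?thesis by (simp add: algebra_simps)
    qed
    then have "real n / real s < real (n div s) + 1" using s1 by (simp add: field_simps)
    then have "real n / real s - 2 \<le> real (n div s - 1)" by linarith
    moreover have "(1 / real s - 2 / real n) * real n = real n / real s - 2"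
      using elim(2) by (simp add: field_simps)
    ultimately have "(1 / real s - 2 / real n) * real n \<le> real (n div s - 1)" by linarith
    then have "((1 / real s - 2 / real n) * real n) ^ r \<le> real (n div s - 1) ^ r"
      using mult_nonneg_nonneg[OF pos, of "real n"] by (intro power_mono) auto
    also have "\<dots> = real ((n div s - 1) ^ r)" by simp
    also have "\<dots> \<le> real (beta_times \<beta> r n)"
      using beta_times_lower[OF low up elim(1) \<beta>] by (simp only: of_nat_le_iff)
    finally have "lo n * real n ^ r \<le> real (beta_times \<beta> r n)" by (simp add: lo_def power_mult_distrib)
    then show ?case using elim(2) by (simp add: le_divide_eq)
  qed
  have upper: "\<forall>\<^sub>F n in sequentially. real (beta_times \<beta> r n) / real n ^ r \<le> hi n"
    using eventually_gt_at_top[of 0]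
  proof eventually_elim
    case (elim n)
    have "(\<beta> n E)\<^sup>2 \<le> 2 * card E + 2 * n" if "E \<subseteq> all_edges {..<n}" for E
      using \<beta> hadwiger_edge_bound[OF that] colin_de_verdiere_edge_bound[OF _ elim that, of \<beta>] by auto
    then have "(real (beta_times \<beta> r n))\<^sup>2 \<le> (((real n)\<^sup>2 + 2 * real r * real n) / real r) ^ r"
      using r by (intro beta_times_upper) auto
    also have "(real n)\<^sup>2 + 2 * real r * real n = (real n)\<^sup>2 * (1 + 2 * real r / real n)"
      using elim by (simp add: distrib_left power2_eq_square)
    also have "\<dots> / real r = (real n)\<^sup>2 * ((1 + 2 * real r / real n) / real r)" by simp
    also have "\<dots> ^ r = (real n ^ r)\<^sup>2 * ((1 + 2 * real r / real n) / real r) ^ r"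
      by (simp only: power_mult_distrib power2_eq_square)
    finally have "(real (beta_times \<beta> r n) / real n ^ r)\<^sup>2 \<le> ((1 + 2 * real r / real n) / real r) ^ r"
      using elim by (simp add: power_divide divide_le_eq mult.commute)
    then show ?case unfolding hi_def by (rule real_le_rsqrt)
  qed
  show "\<exists>e1 \<in> o(\<lambda>_. 1). \<exists>e2 \<in> o(\<lambda>_. 1). \<forall>\<^sub>F n in sequentially.
      L - e1 n \<le> real (beta_times \<beta> r n) / real n ^ r \<and>
      real (beta_times \<beta> r n) / real n ^ r \<le> H + e2 n"
  proof (intro bexI)
    show "\<forall>\<^sub>F n in sequentially. L - (L - lo n) \<le> real (beta_times \<beta> r n) / real n ^ r \<and>
      real (beta_times \<beta> r n) / real n ^ r \<le> H + (hi n - H)"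
      using lower upper by eventually_elim simp
    have "(\<lambda>n. L - lo n) \<longlonglongrightarrow> 0" "(\<lambda>n. hi n - H) \<longlonglongrightarrow> 0"
      using tendsto_diff[OF tendsto_const lo_lim, of L] tendsto_diff[OF hi_lim tendsto_const, of H]
      by simp_all
    then show "(\<lambda>n. L - lo n) \<in> o(\<lambda>_. 1)" "(\<lambda>n. hi n - H) \<in> o(\<lambda>_. 1)"
      by (auto intro!: smalloI_tendsto)
  qed
  have Lpos: "0 < L" using s1 by (simp add: L)
  have Hnonneg: "0 \<le> H" by (simp add: Hr)
  have "\<forall>\<^sub>F n in sequentially. L / 2 < lo n" using lo_lim Lpos by (intro order_tendstoD(1)) auto
  then have ev_low: "\<forall>\<^sub>F n in sequentially. L / 2 * norm (real n ^ r) \<le> norm (real (beta_times \<beta> r n))"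
    using lower eventually_gt_at_top[of 0]
  proof eventually_elim
    case (elim n)
    then have "L / 2 \<le> real (beta_times \<beta> r n) / real n ^ r" by linarith
    then show ?case using elim(3) by (simp add: le_divide_eq)
  qed
  have "\<forall>\<^sub>F n in sequentially. hi n < H + 1" using hi_lim by (intro order_tendstoD(2)) auto
  then have ev_up: "\<forall>\<^sub>F n in sequentially. norm (real (beta_times \<beta> r n)) \<le> (H + 1) * norm (real n ^ r)"
    using upper eventually_gt_at_top[of 0]
  proof eventually_elim
    case (elim n)
    then have "real (beta_times \<beta> r n) / real n ^ r \<le> H + 1" by linarith
    then show ?case using elim(3) by (simp add: divide_le_eq)
  qed
  show "(\<lambda>n. real (beta_times \<beta> r n)) \<in> \<Theta>(\<lambda>n. real n ^ r)"
  proof (rule bigthetaI)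
    show "(\<lambda>n. real (beta_times \<beta> r n)) \<in> O(\<lambda>n. real n ^ r)" using ev_up by (rule bigoI)
    show "(\<lambda>n. real (beta_times \<beta> r n)) \<in> \<Omega>(\<lambda>n. real n ^ r)"
      using Lpos ev_low by (intro landau_omega.bigI[of "L / 2"]) auto
  qed
qed

theorem theorem1p4:
  fixes r :: nat
  assumes "r \<ge> 2"
  shows "(\<forall>\<beta>\<in>{tw, la, pw, ppw}.
            (\<lambda>n. real (beta_times \<beta> r n) / real n ^ r) \<longlonglongrightarrow> 1) \<and>
         (\<forall>\<beta>\<in>{hadwiger, nu, mu, xi}.
            (\<lambda>n. real (beta_times \<beta> r n)) \<in> \<Theta>(\<lambda>n. real n ^ r) \<and>
            (\<exists>e1 \<in> o(\<lambda>_. 1). \<exists>e2 \<in> o(\<lambda>_. 1). \<forall>\<^sub>F n in sequentially.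
               real_of_int \<lceil>sqrt (2 * real r + 1 / 4) - 1 / 2\<rceil> powi (- int r) - e1 n
                 \<le> real (beta_times \<beta> r n) / real n ^ r \<and>
               real (beta_times \<beta> r n) / real n ^ r \<le> sqrt (real r) powi (- int r) + e2 n))"
  using treewidth_type_limit[OF assms] minor_type_asymptotics[OF assms] by blast

end
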